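(* Let $W$ be an affine Weyl group of type $\tilde{G}_2$, with simple reflections $s_1,s_2,s_3$. Consider weight functions $L:W\to\mathbb{Z}$ with $L(w)>0$ for all $w\neq 1$; each such $L$ determines a decomposition of $W$ into left cells. Then the following hold. (1) There are only finitely many possible decompositions of $W$ into left cells, i.e. as $L$ ranges over all such weight functions, only finitely many distinct partitions of $W$ into left cells arise. (2) For each such $L$, the number of left cells of $W$ is finite.
   Context: $W$ of type $\tilde G_2$ is the Coxeter group generated by the involutions $S=\{s_1,s_2,s_3\}$ with relations $(s_1s_2)^6=1$, $(s_2s_3)^3=1$, $(s_1s_3)^2=1$. $\ell$ is the length function and $\leq$ the Bruhat order. A weight function on $W$ is a function $L:W\to\mathbb{Z}$ such that $L(ww')=L(w)+L(w')$ whenever $\ell(ww')=\ell(w)+\ell(w')$. Left cells with respect to $L$: let $\mathcal{A}=\mathbb{Z}[v,v^{-1}]$ with $v$ an indeterminate. Let $\mathcal{H}$ be the Iwahori-Hecke algebra over $\mathcal{A}$ with $\mathcal{A}$-basis $\{T_w\mid w\in W\}$ and multiplication, for $s\in S$, $w\in W$: $T_sT_w=T_{sw}$ if $\ell(sw)>\ell(w)$, and $T_sT_w=T_{sw}+(v^{L(s)}-v^{-L(s)})T_w$ if $\ell(sw)<\ell(w)$. Let $a\mapsto\bar a$ be the ring involution of $\mathcal{A}$ with $\bar v=v^{-1}$, extended to the ring involution of $\mathcal{H}$ given by $\overline{\sum_w a_wT_w}=\sum_w\bar a_wT_{w^{-1}}^{-1}$. For each $w\in W$ there is a unique $C_w\in\mathcal{H}$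 with $\overline{C_w}=C_w$ and $C_w=T_w+\sum_{y<w}P_{y,w}T_y$, where $P_{y,w}\in v^{-1}\mathbb{Z}[v^{-1}]$; the $C_w$ form a basis of $\mathcal{H}$ (the Kazhdan-Lusztig basis). Write $y\leftarrow_L w$ if $C_y$ appears with non-zero coefficient in $C_sC_w$ (expanded in the Kazhdan-Lusztig basis) for some $s\in S$. The pre-order $\leq_L$ is defined by: $y\leq_L w$ if there is a sequence $y=y_0,\dots,y_n=w$ in $W$ with $y_i\leftarrow_L y_{i+1}$ for $0\leq i\leq n-1$. The equivalence classes of the associated equivalence relation $\sim_L$ ($y\sim_L w$ iff $y\leq_L w$ and $w\leq_L y$) are the left cells of $W$. *)

theory Defs
  imports "HOL-Library.Poly_Mapping" "HOL-Algebra.Ring"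
begin

datatype gen = G1 | G2 | G3

fun cox_mat :: "gen \<Rightarrow> gen \<Rightarrow> nat" where
  "cox_mat G1 G1 = 1" | "cox_mat G1 G2 = 6" | "cox_mat G1 G3 = 2"
| "cox_mat G2 G1 = 6" | "cox_mat G2 G2 = 1" | "cox_mat G2 G3 = 3"
| "cox_mat G3 G1 = 2" | "cox_mat G3 G2 = 3" | "cox_mat G3 G3 = 1"

text \<open>The congruence on the free monoid of words generated by the Coxeter relations. The diagonal
  entries of the Coxeter matrix make every generator an involution, so the quotient monoid is
  already the group with this presentation.\<close>

inductive word_eq :: "gen list \<Rightarrow> gen list \<Rightarrow> bool" where
  rel: "word_eq (concat (replicate (cox_mat s t) [s, t])) []"
| refl: "word_eq xs xs"
| sym: "word_eq xs ys \<Longrightarrow> word_eq ys xs"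
| trans: "word_eq xs ys \<Longrightarrow> word_eq ys zs \<Longrightarrow> word_eq xs zs"
| append: "word_eq xs xs' \<Longrightarrow> word_eq ys ys' \<Longrightarrow> word_eq (xs @ ys) (xs' @ ys')"

lemma cox_mat_sym: "cox_mat s t = cox_mat t s"
  by (cases s; cases t) simp_all

lemma rev_concat_replicate:
  "rev (concat (replicate n [s, t])) = concat (replicate n [t, s])"
proof -
  have "concat (replicate n [t, s]) @ [t, s] = [t, s] @ concat (replicate n [t, s])" for n
    by (induction n) simp_all
  then show ?thesis
    by (induction n) simp_all
qed

lemma word_eq_rev: "word_eq xs ys \<Longrightarrow> word_eq (rev xs) (rev ys)"
proof (induction rule: word_eq.induct)
  case (rel s t)
  show ?case
    using word_eq.rel[of t s] by (simp add: rev_concat_replicate cox_mat_sym[of t s])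
qed (auto intro: word_eq.intros)

lemma word_eq_rev_append: "word_eq (rev xs @ xs) []"
proof (induction xs)
  case Nil
  show ?case by (simp add: word_eq.refl)
next
  case (Cons s xs)
  have "word_eq [s, s] []"
    using word_eq.rel[of s s] by (cases s) simp_all
  then have "word_eq (rev xs @ ([s, s] @ xs)) (rev xs @ ([] @ xs))"
    by (intro word_eq.append word_eq.refl)
  then show ?case
    using Cons.IH by (auto intro: word_eq.trans)
qed

quotient_type W = "gen list" / word_eq morphisms rep_W word
  by (intro equivpI reflpI sympI transpI) (fact word_eq.intros)+

instantiation W :: "{monoid_mult, inverse}"
begin

lift_definition one_W :: W is "[]" .

lift_definition times_W :: "W \<Rightarrow> W \<Rightarrow> W" is "(@)"
  by (rule word_eq.append)

lift_definition inverse_W :: "W \<Rightarrow> W" is rev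
  by (rule word_eq_rev)

definition divide_W :: "W \<Rightarrow> W \<Rightarrow> W" where
  "divide_W x y = x * inverse y"

instance
  by standard (transfer; simp add: word_eq.refl)+

end

lemma W_left_inverse: "inverse x * x = (1 :: W)"
  by transfer (rule word_eq_rev_append)

lemma W_right_inverse: "x * inverse x = (1 :: W)"
  by transfer (metis rev_rev_ident word_eq_rev_append)

definition s1 :: W where "s1 = word [G1]"
definition s2 :: W where "s2 = word [G2]"
definition s3 :: W where "s3 = word [G3]"

definition S :: "W set" where "S = {s1, s2, s3}"

lemma W_relations:
  "s1 * s1 = 1" "s2 * s2 = 1" "s3 * s3 = 1"
  "(s1 * s2) ^ 6 = 1" "(s2 * s3) ^ 3 = 1" "(s1 * s3) ^ 2 = 1"
proof -
  have pow: "(word [s] * word [t]) ^ n = word (concat (replicate n [s, t]))" for s t n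
    by (induction n) (simp_all add: one_W_def times_W.abs_eq)
  have rel: "(word [s] * word [t]) ^ cox_mat s t = 1" for s t
    unfolding pow one_W_def W.abs_eq_iff by (rule word_eq.rel)
  show "s1 * s1 = 1" "s2 * s2 = 1" "s3 * s3 = 1"
    "(s1 * s2) ^ 6 = 1" "(s2 * s3) ^ 3 = 1" "(s1 * s3) ^ 2 = 1"
    using rel[of G1 G1] rel[of G2 G2] rel[of G3 G3] rel[of G1 G2] rel[of G2 G3] rel[of G1 G3]
    by (simp_all add: s1_def s2_def s3_def)
qed

definition len :: "W \<Rightarrow> nat" where
  "len w = (LEAST n. \<exists>xs. length xs = n \<and> set xs \<subseteq> S \<and> w = prod_list xs)"

definition reflections :: "W set" where
  "reflections = {w * s * inverse w | w s. s \<in> S}"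

definition bruhat_le :: "W \<Rightarrow> W \<Rightarrow> bool" where
  "bruhat_le = (\<lambda>y w. \<exists>t\<in>reflections. w = t * y \<and> len y < len w)\<^sup>*\<^sup>*"

definition weight_function :: "(W \<Rightarrow> int) \<Rightarrow> bool" where
  "weight_function L \<longleftrightarrow> (\<forall>w w'. len (w * w') = len w + len w' \<longrightarrow> L (w * w') = L w + L w')"

text \<open>The ring $\mathbb{Z}[v,v^{-1}]$ as finitely supported functions from exponents to
  coefficients; the multiplication of \<^type>\<open>poly_mapping\<close> is the convolution product.\<close>

type_synonym laurent = "int \<Rightarrow>\<^sub>0 int"

definition vpow :: "int \<Rightarrow> laurent" where
  "vpow k = Poly_Mapping.single k 1"

definition lbar :: "laurent \<Rightarrow> laurent" where
  "lbar = Poly_Mapping.map_key uminus"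

definition vneg :: "laurent set" where
  "vneg = {p. Poly_Mapping.keys p \<subseteq> {..<0}}"

text \<open>The free module over the Laurent polynomials with basis \<open>T w\<close>.\<close>

type_synonym hecke = "W \<Rightarrow>\<^sub>0 laurent"

definition T :: "W \<Rightarrow> hecke" where
  "T w = Poly_Mapping.single w 1"

definition scale :: "laurent \<Rightarrow> hecke \<Rightarrow> hecke" where
  "scale a = Poly_Mapping.map ((*) a)"

text \<open>The \<open>T s * T w\<close> rule alone does not mention arbitrary products; it determines the
  multiplication among the bilinear, associative and unital ones.\<close>

definition is_hecke_mult :: "(W \<Rightarrow> int) \<Rightarrow> (hecke \<Rightarrow> hecke \<Rightarrow> hecke) \<Rightarrow> bool" where
  "is_hecke_mult L m \<longleftrightarrow>
     (\<forall>h h' k. m (h + h') k = m h k + m h' k) \<and>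
     (\<forall>h k k'. m h (k + k') = m h k + m h k') \<and>
     (\<forall>a h k. m (scale a h) k = scale a (m h k)) \<and>
     (\<forall>a h k. m h (scale a k) = scale a (m h k)) \<and>
     (\<forall>h k l. m (m h k) l = m h (m k l)) \<and>
     (\<forall>h. m (T 1) h = h) \<and>
     (\<forall>h. m h (T 1) = h) \<and>
     (\<forall>s\<in>S. \<forall>w.
        (len (s * w) > len w \<longrightarrow> m (T s) (T w) = T (s * w)) \<and>
        (len (s * w) < len w \<longrightarrow>
           m (T s) (T w) = T (s * w) + scale (vpow (L s) - vpow (- L s)) (T w)))"

definition hecke_algebra :: "(W \<Rightarrow> int) \<Rightarrow> hecke ring" where
  "hecke_algebra L =
     \<lparr>carrier = UNIV, mult = (THE m. is_hecke_mult L m), one = T 1, zero = 0, add = (+)\<rparr>"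

definition hbar :: "(W \<Rightarrow> int) \<Rightarrow> hecke \<Rightarrow> hecke" where
  "hbar L h = (\<Sum>w\<in>Poly_Mapping.keys h.
     scale (lbar (Poly_Mapping.lookup h w)) (inv\<^bsub>hecke_algebra L\<^esub> (T (inverse w))))"

text \<open>The conditions on coefficients say that
  \<open>C = T w + (\<Sum>y < w. P y w T y)\<close> with all \<open>P y w\<close> in $v^{-1}\mathbb{Z}[v^{-1}]$.\<close>

definition is_KL_element :: "(W \<Rightarrow> int) \<Rightarrow> W \<Rightarrow> hecke \<Rightarrow> bool" where
  "is_KL_element L w C \<longleftrightarrow>
     hbar L C = C \<and>
     Poly_Mapping.lookup C w = 1 \<and>
     (\<forall>y. y \<noteq> w \<longrightarrow>
        (if bruhat_le y w then Poly_Mapping.lookup C y \<in> vneg else Poly_Mapping.lookup C y = 0))"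

definition KL :: "(W \<Rightarrow> int) \<Rightarrow> W \<Rightarrow> hecke" where
  "KL L w = (THE C. is_KL_element L w C)"

text \<open>\<open>c\<close> is the (unique) family of coordinates of the product in the Kazhdan-Lusztig basis.\<close>

definition left_arrow :: "(W \<Rightarrow> int) \<Rightarrow> W \<Rightarrow> W \<Rightarrow> bool" where
  "left_arrow L y w \<longleftrightarrow> (\<exists>s\<in>S. \<exists>c :: W \<Rightarrow>\<^sub>0 laurent.
     KL L s \<otimes>\<^bsub>hecke_algebra L\<^esub> KL L w =
       (\<Sum>z\<in>Poly_Mapping.keys c. scale (Poly_Mapping.lookup c z) (KL L z)) \<and>
     Poly_Mapping.lookup c y \<noteq> 0)"

definition left_le :: "(W \<Rightarrow> int) \<Rightarrow> W \<Rightarrow> W \<Rightarrow> bool" where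
  "left_le L = (left_arrow L)\<^sup>*\<^sup>*"

definition left_equiv :: "(W \<Rightarrow> int) \<Rightarrow> (W \<times> W) set" where
  "left_equiv L = {(y, w). left_le L y w \<and> left_le L w y}"

definition left_cells :: "(W \<Rightarrow> int) \<Rightarrow> W set set" where
  "left_cells L = UNIV // left_equiv L"

end

theory Submission
  imports Defs
begin

text \<open>The group acts simply transitively on the orbit of a vector \<open>\<rho>\<close>, so an element is
  determined by its coordinates, and their signs give its descents. Multiplication by a suitable element
  of the Hecke algebra that is independent of \<open>w\<close> has a matrix in the standard basis whose
  entries have bounded degree. Since the standard and the Kazhdan-Lusztig basis are related by a
  matrix that is unitriangular modulo negative powers of \<open>v\<close>, the entries of maximal degree give relations
  \<open>\<le>\<^sub>L\<close>. Three such elements, attached to the parabolic subgroups of types $G_2$ and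
  $A_2$, show that translating an element of the lowest two-sided cell, or an element of one of the
  two kinds of boundary strips along its strip, does not change its left cell, whatever the weights are.
  All other elements, up to finitely many, are squeezed between two of these by paths on which the length
  increases. Hence finitely many elements meet all left cells for all weight functions.\<close>

section \<open>The Coxeter group and its geometric representation\<close>

text \<open>The obstacle is uniformity: the Kazhdan-Lusztig basis varies with \<open>L\<close>, and
  infinitely many \<open>L\<close> must be treated at once. Hence no Kazhdan-Lusztig polynomial is
  computed. As \<open>s2\<close> and \<open>s3\<close> have equal weight, exponents are i * L s1 + j
  * L s2, and bounding all pairs (i, j) componentwise by one pair bounds the degree for every
  positive weight, with equality for that pair only. The operators are left multiplications by e x e
  + g e, where e is the sum of ch(u) T_u over a finite parabolic subgroup, ch is a linear character
  of its Hecke algebra and g is a scalar. Such an operator is determined by its columns at minimal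
  coset representatives. Far from the origin these fall into finitely many families on which the
  relevant roots have constant sign, so the calculation is finite. The comparison of leading
  coefficients only involves rows of long elements, so the finitely many short representatives need
  no inspection. For one kind of strip the word u of maximal degree depends on \<open>L\<close>;
  squeezing between translates removes this dependence.\<close>

fun sg :: "gen \<Rightarrow> W" where
  "sg G1 = s1" | "sg G2 = s2" | "sg G3 = s3"

lemma sg_eq: "sg s = word [s]"
  by (cases s) (simp_all add: s1_def s2_def s3_def)

lemma S_eq: "S = range sg"
proof -
  have *: "(UNIV :: gen set) = {G1, G2, G3}"
    using gen.exhaust by blast
  show ?thesis
    unfolding *     by (simp add: S_def)
qed

lemma word_Nil: "word [] = 1"
  by (simp add: one_W_def)

lemma word_append: "word (xs @ ys) = word xs * word ys"
  by (simp add: times_W.abs_eq)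

lemma word_Cons: "word (s # xs) = sg s * word xs"
  using word_append[of "[s]" xs] by (simp add: sg_eq)

lemma word_surj: "\<exists>xs. w = word xs"
  by (metis Quotient3_W Quotient3_abs_rep)

lemma W_induct [case_names one step]:
  assumes "P 1" "\<And>s w. P w \<Longrightarrow> P (sg s * w)"
  shows "P (w :: W)"
proof -
  have "P (word xs)" for xs
    by (induction xs) (simp_all add: assms word_Nil word_Cons)
  then show ?thesis
    using word_surj[of w] by blast
qed

lemma sg_sg [simp]: "sg s * sg s = 1"
  by (cases s) (simp_all add: W_relations)

lemma sg_sg_left [simp]: "sg s * (sg s * w) = w"
  by (simp flip: mult.assoc)

lemma W_left_cancel: "(x :: W) * y = x * z \<longleftrightarrow> y = z"
  by (metis W_left_inverse mult.assoc mult_1)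

lemma W_right_cancel: "(y :: W) * x = z * x \<longleftrightarrow> y = z"
  by (metis W_right_inverse mult.assoc mult_1_right)

lemma W_inverse_unique: "(x :: W) * y = 1 \<Longrightarrow> inverse x = y"
  by (metis W_left_inverse W_left_cancel W_right_inverse)

lemma W_inverse_mult: "inverse (x * y) = inverse y * inverse (x :: W)"
  by (rule W_inverse_unique) (metis W_right_inverse mult.assoc mult_1_right)

lemma W_inverse_inverse [simp]: "inverse (inverse x) = (x :: W)"
  by (rule W_inverse_unique) (rule W_left_inverse)

lemma W_inverse_one [simp]: "inverse (1 :: W) = 1"
  by (rule W_inverse_unique) simp

lemma inverse_sg [simp]: "inverse (sg s) = sg s"
  by (rule W_inverse_unique) simp

subsection \<open>Length\<close>

lemma prod_list_sg: "prod_list (map sg xs) = word xs"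
  by (induction xs) (simp_all add: word_Nil word_Cons)

lemma len_eq: "len w = (LEAST n. \<exists>xs. length xs = n \<and> w = word xs)"
proof -
  have "(\<exists>ws. length ws = n \<and> set ws \<subseteq> S \<and> w = prod_list ws) \<longleftrightarrow>
      (\<exists>xs. length xs = n \<and> w = word xs)" for n
  proof
    assume "\<exists>ws. length ws = n \<and> set ws \<subseteq> S \<and> w = prod_list ws"
    then obtain ws where ws: "length ws = n" "set ws \<subseteq> S" "w = prod_list ws"
      by blast
    have "ws \<in> lists (range sg)"
      using ws(2) by (auto simp: S_eq)
    then obtain xs where "ws = map sg xs"
      by (metis lists_image imageE lists_UNIV)
    then show "\<exists>xs. length xs = n \<and> w = word xs"
      using ws by (auto simp: prod_list_sg)
  next
    assume "\<exists>xs. length xs = n \<and> w = word xs"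
    then obtain xs where "length xs = n" "w = word xs"
      by blast
    then show "\<exists>ws. length ws = n \<and> set ws \<subseteq> S \<and> w = prod_list ws"
      by (intro exI[of _ "map sg xs"]) (auto simp: prod_list_sg S_eq)
  qed
  then show ?thesis
    by (simp add: len_def)
qed

lemma len_word_le: "len (word xs) \<le> length xs"
  unfolding len_eq by (rule Least_le) blast

lemma reduced_word: "\<exists>xs. length xs = len w \<and> w = word xs"
proof -
  have "\<exists>n xs. length xs = n \<and> w = word xs"
    using word_surj[of w] by blast
  then show ?thesis
    unfolding len_eq by (rule LeastI_ex)
qed

lemma len_one [simp]: "len 1 = 0"
  using len_word_le[of "[]"] by (simp add: word_Nil)

lemma len_mult_le: "len (x * y) \<le> len x + len y"
  by (metis reduced_word len_word_le word_append length_append)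

lemma len_inverse [simp]: "len (inverse x) = len x"
proof -
  have "len (inverse x) \<le> len x" for x
  proof -
    obtain xs where "length xs = len x" "x = word xs"
      using reduced_word by blast
    then show ?thesis
      using len_word_le[of "rev xs"] by (simp add: inverse_W.abs_eq)
  qed
  from this[of x] this[of "inverse x"] show ?thesis
    by simp
qed

text \<open>All relators have even length, so the parity of a word depends only on the group
  element. This excludes \<open>len (sg s * w) = len w\<close>.\<close>

lemma even_len_word: "even (len (word xs)) = even (length xs)"
proof -
  have *: "word_eq xs ys \<Longrightarrow> even (length xs) = even (length ys)" for xs ys
  proof (induction rule: word_eq.induct)
    case (rel s t)
    have "length (concat (replicate n [s, t])) = 2 * n" for n
      by (induction n) simp_all
    then show ?case by simp
  qed simp_all
  obtain ys where ys: "length ys = len (word xs)" "word xs = word ys"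
    using reduced_word by blast
  then show ?thesis
    using *[of xs ys] by (metis W.abs_eq_iff)
qed

lemma even_len_mult: "even (len (x * y)) \<longleftrightarrow> (even (len x) \<longleftrightarrow> even (len y))"
proof -
  obtain xs ys where "x = word xs" "y = word ys"
    using word_surj by metis
  then show ?thesis
    by (simp add: even_len_word flip: word_append)
qed

lemma len_sg [simp]: "len (sg s) = 1"
proof -
  have "len (sg s) \<le> 1"
    using len_word_le[of "[s]"] by (simp add: sg_eq)
  moreover have "odd (len (sg s))"
    using even_len_word[of "[s]"] by (simp add: sg_eq)
  ultimately show ?thesis
    by (cases "len (sg s)") auto
qed

lemma len_sg_mult: "len (sg s * w) = Suc (len w) \<or> len w = Suc (len (sg s * w))"
proof -
  have "len (sg s * w) \<le> Suc (len w)"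
    using len_mult_le[of "sg s" w] by simp
  moreover have "len w \<le> Suc (len (sg s * w))"
    using len_mult_le[of "sg s" "sg s * w"] by simp
  moreover have "even (len (sg s * w)) \<longleftrightarrow> odd (len w)"
    using even_len_mult[of "sg s" w] by simp
  ultimately show ?thesis
    by presburger
qed

subsection \<open>The action on the coordinate space\<close>

type_synonym vec = "int \<times> int \<times> int"

text \<open>A vector is given by the values of the three simple roots on it, so that \<open>fire s\<close> is the
  reflection in the simple root of \<open>s\<close>; the Cartan integers between \<open>s1\<close> and \<open>s2\<close> are 3 and 1.\<close>

fun fire :: "gen \<Rightarrow> vec \<Rightarrow> vec" where
  "fire G1 (x, y, z) = (- x, y + 3 * x, z)"
| "fire G2 (x, y, z) = (x + y, - y, z + y)"
| "fire G3 (x, y, z) = (x, y + z, - z)"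

fun sval :: "gen \<Rightarrow> vec \<Rightarrow> int" where
  "sval G1 (x, y, z) = x" | "sval G2 (x, y, z) = y" | "sval G3 (x, y, z) = z"

fun actw :: "gen list \<Rightarrow> vec \<Rightarrow> vec" where
  "actw [] c = c"
| "actw (s # xs) c = fire s (actw xs c)"

lemma actw_append: "actw (xs @ ys) c = actw xs (actw ys c)"
  by (induction xs) simp_all

lemma fire_fire [simp]: "fire s (fire s c) = c"
  by (cases s; cases c) simp_all

lemma actw_rel: "actw (concat (replicate (cox_mat s t) [s, t])) c = c"
  by (cases s; cases t; cases c) (simp_all add: eval_nat_numeral)

lemma actw_word_eq: "word_eq xs ys \<Longrightarrow> actw xs c = actw ys c"
proof (induction arbitrary: c rule: word_eq.induct)
  case (rel s t)
  show ?case by (simp add: actw_rel)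
qed (simp_all add: actw_append)

lift_definition act :: "W \<Rightarrow> vec \<Rightarrow> vec" is actw
  by (rule ext) (rule actw_word_eq)

lemma act_one [simp]: "act 1 c = c"
  by transfer simp

lemma act_mult: "act (x * y) c = act x (act y c)"
  by transfer (rule actw_append)

lemma act_sg [simp]: "act (sg s) c = fire s c"
  unfolding sg_eq by transfer simp

section \<open>Linear forms and the contragredient action\<close>

type_synonym form = "int \<times> int \<times> int"

fun feval :: "form \<Rightarrow> vec \<Rightarrow> int" where
  "feval (p, q, r) (x, y, z) = p * x + q * y + r * z"

fun pull :: "gen \<Rightarrow> form \<Rightarrow> form" where
  "pull G1 (p, q, r) = (3 * q - p, q, r)"
| "pull G2 (p, q, r) = (p, p - q + r, r)"
| "pull G3 (p, q, r) = (p, q, q - r)"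

fun pullw :: "gen list \<Rightarrow> form \<Rightarrow> form" where
  "pullw [] f = f"
| "pullw (s # xs) f = pullw xs (pull s f)"

lemma feval_pull: "feval (pull s f) c = feval f (fire s c)"
  by (cases s; cases f; cases c) (simp_all add: algebra_simps)

lemma feval_pullw: "feval (pullw xs f) c = feval f (actw xs c)"
  by (induction xs arbitrary: f) (simp_all add: feval_pull)

lemma feval_inject: "(\<And>c. feval f c = feval g c) \<Longrightarrow> f = g"
proof -
  assume *: "\<And>c. feval f c = feval g c"
  obtain p q r p' q' r' where "f = (p, q, r)" "g = (p', q', r')"
    by (metis prod_cases3)
  then show "f = g"
    using *[of "(1, 0, 0)"] *[of "(0, 1, 0)"] *[of "(0, 0, 1)"] by simp
qed

text \<open>This is \<open>f\<close> composed with the action of \<open>w\<close>, so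
  \<open>rt w (al s)\<close> is the simple root of \<open>s\<close> transformed by the inverse of
  \<open>w\<close>. Its sign will decide whether \<open>s\<close> is a left descent of
  \<open>w\<close>.\<close>

lift_definition rt :: "W \<Rightarrow> form \<Rightarrow> form" is pullw
proof (rule ext)
  fix xs ys f assume "word_eq xs ys"
  then show "pullw xs f = pullw ys f"
    by (intro feval_inject) (simp add: feval_pullw actw_word_eq)
qed

lemma feval_rt: "feval (rt w f) c = feval f (act w c)"
  by transfer (rule feval_pullw)

lemma rt_mult: "rt (x * y) f = rt y (rt x f)"
  by (rule feval_inject) (simp add: feval_rt act_mult)

lemma rt_one [simp]: "rt 1 f = f"
  by (rule feval_inject) (simp add: feval_rt)

lemma rt_sg [simp]: "rt (sg s) f = pull s f"
  by (rule feval_inject) (simp add: feval_rt feval_pull)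

fun al :: "gen \<Rightarrow> form" where
  "al G1 = (1, 0, 0)" | "al G2 = (0, 1, 0)" | "al G3 = (0, 0, 1)"

lemma feval_al: "feval (al s) c = sval s c"
  by (cases s; cases c) simp_all

fun neg :: "form \<Rightarrow> form" where
  "neg (p, q, r) = (- p, - q, - r)"

lemma neg_neg [simp]: "neg (neg f) = f"
  by (cases f) simp

lemma feval_neg: "feval (neg f) c = - feval f c"
  by (cases f; cases c) simp

lemma rt_neg: "rt w (neg f) = neg (rt w f)"
  by (rule feval_inject) (simp add: feval_rt feval_neg)

lemma pull_neg: "pull s (neg f) = neg (pull s f)"
  by (cases s; cases f) simp_all

lemma pull_al: "pull s (al s) = neg (al s)"
  by (cases s) simp_all

subsection \<open>Roots\<close>

definition finroots :: "(int \<times> int) set" where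
  "finroots = {(1, 0), (1, 1), (2, 1), (0, 1), (3, 1), (3, 2),
    (-1, 0), (-1, -1), (-2, -1), (0, -1), (-3, -1), (-3, -2)}"

text \<open>The real roots are the \<open>\<gamma> + k \<delta>\<close> with \<open>\<gamma>\<close> in the finite root system and
  \<open>\<delta> = (3, 2, 1)\<close>.\<close>

fun isroot :: "form \<Rightarrow> bool" where
  "isroot (p, q, r) \<longleftrightarrow> (p - 3 * r, q - 2 * r) \<in> finroots"

fun pos :: "form \<Rightarrow> bool" where
  "pos (p, q, r) \<longleftrightarrow> 0 \<le> p \<and> 0 \<le> q \<and> 0 \<le> r \<and> 0 < p + q + r"

lemma isroot_cases:
  assumes "isroot f"
  obtains k where "f = (3 * k + 1, 2 * k, k)" | k where "f = (3 * k + 1, 2 * k + 1, k)"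
    | k where "f = (3 * k + 2, 2 * k + 1, k)" | k where "f = (3 * k, 2 * k + 1, k)"
    | k where "f = (3 * k + 3, 2 * k + 1, k)" | k where "f = (3 * k + 3, 2 * k + 2, k)"
    | k where "f = (3 * k - 1, 2 * k, k)" | k where "f = (3 * k - 1, 2 * k - 1, k)"
    | k where "f = (3 * k - 2, 2 * k - 1, k)" | k where "f = (3 * k, 2 * k - 1, k)"
    | k where "f = (3 * k - 3, 2 * k - 1, k)" | k where "f = (3 * k - 3, 2 * k - 2, k)"
proof -
  obtain p q r where f: "f = (p, q, r)"
    by (metis prod_cases3)
  define g h where "g = p - 3 * r" and "h = q - 2 * r"
  have "(g, h) \<in> finroots" "f = (3 * r + g, 2 * r + h, r)"
    using assms f by (simp_all add: g_def h_def)
  then show thesis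
    using that[of r] unfolding finroots_def by (elim insertE emptyE) simp_all
qed

lemma isroot_al [simp]: "isroot (al s)"
  by (cases s) (simp_all add: finroots_def)

lemma isroot_pull: "isroot f \<Longrightarrow> isroot (pull s f)"
  by (erule isroot_cases; cases s; simp add: finroots_def)

lemma isroot_rt: "isroot f \<Longrightarrow> isroot (rt w f)"
proof -
  assume f: "isroot f"
  have "isroot (pullw xs f)" for xs
    using f by (induction xs arbitrary: f) (simp_all add: isroot_pull del: isroot.simps)
  then show ?thesis
    by transfer
qed

lemma root_pos_or_neg: "isroot f \<Longrightarrow> pos f \<noteq> pos (neg f)"
  by (erule isroot_cases; simp; presburger)

text \<open>\<open>pull s\<close> alters only the coefficient of \<open>al s\<close>. A positive
  root other than \<open>al s\<close> has another positive coefficient, which survives.\<close>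

lemma pos_pull: "isroot f \<Longrightarrow> pos f \<Longrightarrow> f \<noteq> al s \<Longrightarrow> pos (pull s f)"
  by (erule isroot_cases; cases s; simp; linarith?)

subsection \<open>Descents and signs of roots\<close>

fun alt :: "gen \<Rightarrow> gen \<Rightarrow> nat \<Rightarrow> gen list" where
  "alt s t 0 = []"
| "alt s t (Suc k) = s # alt t s k"

lemma alt_Suc_snoc: "alt s t (Suc k) = alt s t k @ [if even k then s else t]"
proof (induction k arbitrary: s t)
  case (Suc k)
  show ?case
    using Suc.IH[of t s] by simp
qed simp

lemma alt_add: "\<exists>ys. alt s t (m + k) = alt s t m @ ys \<and> length ys = k"
proof (induction k)
  case (Suc k)
  then show ?case
    by (metis add_Suc_right alt_Suc_snoc append.assoc length_append_singleton)
qed simp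

lemma length_alt [simp]: "length (alt s t k) = k"
  by (induction k arbitrary: s t) simp_all

lemma braid: "s \<noteq> t \<Longrightarrow> word (alt s t (cox_mat s t)) = word (alt t s (cox_mat s t))"
proof -
  have *: "x * y = 1 \<Longrightarrow> inverse y = x" for x y :: W
    by (metis W_inverse_inverse W_inverse_unique)
  have **: "word (concat (replicate (cox_mat s t) [s, t])) = 1"
    unfolding one_W_def W.abs_eq_iff by (rule word_eq.rel)
  assume "s \<noteq> t"
  then show ?thesis
  proof -
    have "\<exists>xs. concat (replicate (cox_mat s t) [s, t]) = alt s t (cox_mat s t) @ xs \<and>
        rev xs = alt t s (cox_mat s t)"
      using \<open>s \<noteq> t\<close>
      by (cases s; cases t) (simp_all add: eval_nat_numeral)
    then obtain xs where xs: "concat (replicate (cox_mat s t) [s, t]) = alt s t (cox_mat s t) @ xs"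
      "rev xs = alt t s (cox_mat s t)"
      by blast
    have "word (alt s t (cox_mat s t)) * word xs = 1"
      using ** xs(1) by (simp add: word_append)
    then have "inverse (word xs) = word (alt s t (cox_mat s t))"
      by (rule *)
    then show ?thesis
      using xs(2) by (simp add: inverse_W.abs_eq)
  qed
qed

fun lin :: "int \<Rightarrow> form \<Rightarrow> int \<Rightarrow> form \<Rightarrow> form" where
  "lin i (p, q, r) j (p', q', r') = (i * p + j * p', i * q + j * q', i * r + j * r')"

lemma feval_lin: "feval (lin i f j g) c = i * feval f c + j * feval g c"
  by (cases f; cases g; cases c) (simp add: algebra_simps)

lemma rt_lin: "rt w (lin i f j g) = lin i (rt w f) j (rt w g)"
  by (rule feval_inject) (simp add: feval_rt feval_lin)

lemma pos_lin: "pos f \<Longrightarrow> pos g \<Longrightarrow> 0 \<le> i \<Longrightarrow> 0 \<le> j \<Longrightarrow> 0 < i + j \<Longrightarrow> pos (lin i f j g)"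
proof -
  assume a: "pos f" "pos g" "0 \<le> i" "0 \<le> j" "0 < i + j"
  obtain p q r p' q' r' where [simp]: "f = (p, q, r)" "g = (p', q', r')"
    by (metis prod_cases3)
  have "0 < i * (p + q + r) + j * (p' + q' + r')"
  proof (cases "i = 0")
    case False
    then have "0 < i * (p + q + r)" "0 \<le> j * (p' + q' + r')"
      using a by simp_all
    then show ?thesis by linarith
  qed (use a in simp)
  then show ?thesis
    using a by (simp add: algebra_simps)
qed

lemma dihedral_pos:
  assumes "s \<noteq> t" "k < cox_mat s t"
  shows "\<exists>i j. 0 \<le> i \<and> 0 \<le> j \<and> 0 < i + j \<and> pullw (alt t s k) (al s) = lin i (al s) j (al t)"
proof -
  have "k \<in> {0, 1, 2, 3, 4, 5}"
    using assms by (cases s; cases t) auto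
  \<comment> \<open>Forms and vectors are both integer triples, so \<open>sval\<close> can read off
    the coefficients of \<open>al s\<close> and \<open>al t\<close>.\<close>
  then show ?thesis
    using assms
    by (intro exI[of _ "sval s (pullw (alt t s k) (al s))"] exI[of _ "sval t (pullw (alt t s k) (al s))"])
      (cases s; cases t; elim insertE emptyE; simp add: eval_nat_numeral)
qed

text \<open>Split off from \<open>w\<close> the longest alternating prefix in \<open>t\<close> and
  \<open>s\<close>. The remainder \<open>v\<close> has neither as a left descent, so its two roots
  are positive by induction, and \<open>rt w (al s)\<close> is a nonnegative combination of
  them.\<close>

theorem ascent_pos: "len w < len (sg s * w) \<Longrightarrow> pos (rt w (al s))"
proof (induction "len w" arbitrary: w s rule: less_induct)
  case less
  show ?case
  proof (cases "w = 1")
    case True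
    then show ?thesis
      by (cases s) simp_all
  next
    case False
    obtain xs where xs: "length xs = len w" "w = word xs"
      using reduced_word by blast
    with False obtain t ys where t: "xs = t # ys"
      by (cases xs) (auto simp: word_Nil)
    have w: "w = sg t * word ys" "len w = Suc (len (word ys))"
      using xs t len_word_le[of ys] len_sg_mult[of t "word ys"] by (auto simp: word_Cons)
    have st: "s \<noteq> t"
      using w less.prems by auto
    define A where "A = {k. \<exists>v. w = word (alt t s k) * v \<and> len w = k + len v}"
    have "1 \<in> A"
      using w by (auto simp: A_def word_Cons word_Nil intro!: exI[of _ "word ys"])
    have "A \<subseteq> {..len w}"
      by (auto simp: A_def)
    then have fin: "finite A"
      using finite_subset by blast
    define k where "k = Max A"
    have "k \<in> A" "1 \<le> k" and k_max: "\<And>j. j \<in> A \<Longrightarrow> j \<le> k"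
      using fin \<open>1 \<in> A\<close> by (auto simp: k_def intro: Max_in)
    then obtain v where v: "w = word (alt t s k) * v" "len w = k + len v"
      by (auto simp: A_def)
    \<comment> \<open>A longer prefix could be rewritten by the braid relation to start with
      \<open>s\<close>, and then \<open>sg s * w\<close> would be shorter than
      \<open>w\<close>.\<close>
    have "k < cox_mat s t"
    proof (rule ccontr)
      define m where "m = cox_mat s t"
      assume "\<not> ?thesis"
      then have "m \<le> k"
        by (simp add: m_def)
      then obtain zs where zs: "alt t s k = alt t s m @ zs" "length zs = k - m"
        using alt_add[of t s m "k - m"] by auto
      have "0 < m"
        by (cases s; cases t) (simp_all add: m_def)
      have "w = word (alt t s m) * (word zs * v)"
        using v(1) zs(1) by (simp add: word_append mult.assoc)
      also have "word (alt t s m) = word (alt s t m)"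
        using braid[OF st] by (simp add: m_def)
      also have "\<dots> = sg s * word (alt t s (m - 1))"
        using \<open>0 < m\<close> by (cases m) (simp_all add: word_Cons)
      finally have "w = sg s * (word (alt t s (m - 1)) * (word zs * v))"
        by (simp add: mult.assoc)
      then have "sg s * w = word (alt t s (m - 1)) * (word zs * v)"
        by simp
      moreover have "len (word (alt t s (m - 1)) * (word zs * v)) \<le> (m - 1) + ((k - m) + len v)"
        using len_word_le[of "alt t s (m - 1)"] len_word_le[of zs] zs(2)
          len_mult_le[of "word (alt t s (m - 1))" "word zs * v"] len_mult_le[of "word zs" v]
        by simp
      ultimately show False
        using less.prems v(2) \<open>m \<le> k\<close> \<open>0 < m\<close> by simp
    qed
    \<comment> \<open>\<open>x'\<close> is the letter that would continue the prefix, so maximality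
      of \<open>k\<close> forbids it as a descent of \<open>v\<close>. \<open>x\<close> is the last
      letter of the prefix; as a descent it would cancel and shorten \<open>w\<close>.\<close>
    define x x' where "x = (if even k then s else t)" and "x' = (if even k then t else s)"
    have "len v < len (sg x' * v)"
    proof (rule ccontr)
      assume "\<not> ?thesis"
      then have "len v = Suc (len (sg x' * v))"
        using len_sg_mult[of x' v] by linarith
      moreover have "w = word (alt t s (Suc k)) * (sg x' * v)"
        using v(1) by (simp add: alt_Suc_snoc word_append word_Cons word_Nil mult.assoc x'_def
            del: alt.simps)
      ultimately have "Suc k \<in> A"
        using v(2) by (auto simp: A_def)
      then show False
        using k_max by fastforce
    qed
    moreover have "len v < len (sg x * v)"
    proof (rule ccontr)
      assume "\<not> ?thesis"
      then have *: "len v = Suc (len (sg x * v))"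
        using len_sg_mult[of x v] by linarith
      obtain j where j: "k = Suc j"
        using \<open>1 \<le> k\<close> by (cases k) auto
      have "w = word (alt t s j) * (sg x * v)"
        using v(1) by (simp add: alt_Suc_snoc word_append word_Cons word_Nil mult.assoc x_def j
            del: alt.simps)
      then have "len w \<le> j + len (sg x * v)"
        using len_mult_le[of "word (alt t s j)" "sg x * v"] len_word_le[of "alt t s j"] by simp
      then show False
        using v(2) * j by simp
    qed
    ultimately have "len v < len (sg s * v)" "len v < len (sg t * v)"
      unfolding x_def x'_def by (simp_all split: if_splits)
    then have pos: "pos (rt v (al s))" "pos (rt v (al t))"
      using less.hyps[of v] v(2) \<open>1 \<le> k\<close> by simp_all
    obtain i j where ij: "0 \<le> i" "0 \<le> j" "0 < i + j"
        "pullw (alt t s k) (al s) = lin i (al s) j (al t)"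
      using dihedral_pos[OF st \<open>k < cox_mat s t\<close>] by blast
    have "rt w (al s) = lin i (rt v (al s)) j (rt v (al t))"
      using ij(4) by (simp add: v(1) rt_mult rt.abs_eq rt_lin)
    then show ?thesis
      using pos ij by (simp add: pos_lin)
  qed
qed

text \<open>The base point lies inside the fundamental alcove, and \<open>\<delta>\<close> takes the
  Coxeter number 6 on it. This is why translations move coordinates by multiples of 6.\<close>

definition cv :: "W \<Rightarrow> vec" where
  "cv w = act w (1, 1, 1)"

lemma cv_one: "cv 1 = (1, 1, 1)"
  by (simp add: cv_def)

lemma cv_sg [simp]: "cv (sg s * w) = fire s (cv w)"
  by (simp add: cv_def act_mult)

lemma sval_cv: "sval s (cv w) = feval (rt w (al s)) (1, 1, 1)"
  by (simp add: cv_def feval_rt feval_al)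

lemma sval_fire: "sval s (fire s c) = - sval s c"
  by (cases s; cases c) simp_all

lemma sval_cv_pos: "len w < len (sg s * w) \<Longrightarrow> 0 < sval s (cv w)"
  using ascent_pos[of w s] by (cases "rt w (al s)") (simp add: sval_cv)

lemma sval_cv_neg: "len (sg s * w) < len w \<Longrightarrow> sval s (cv w) < 0"
  using sval_cv_pos[of "sg s * w" s] by (simp add: sval_fire)

lemma len_less_iff: "len w < len (sg s * w) \<longleftrightarrow> 0 < sval s (cv w)"
  using sval_cv_pos[of w s] sval_cv_neg[of s w] len_sg_mult[of s w] by linarith

lemma len_greater_iff: "len (sg s * w) < len w \<longleftrightarrow> sval s (cv w) < 0"
  using sval_cv_pos[of w s] sval_cv_neg[of s w] len_sg_mult[of s w] by linarith

lemma sval_cv_nonzero: "sval s (cv w) \<noteq> 0"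
  using sval_cv_pos[of w s] sval_cv_neg[of s w] len_sg_mult[of s w] by linarith

lemma exists_descent: "w \<noteq> 1 \<Longrightarrow> \<exists>s. len (sg s * w) < len w"
proof -
  assume "w \<noteq> 1"
  obtain xs where xs: "length xs = len w" "w = word xs"
    using reduced_word by blast
  with \<open>w \<noteq> 1\<close> obtain t ys where "xs = t # ys"
    by (cases xs) (auto simp: word_Nil)
  then show ?thesis
    using xs len_word_le[of ys] by (intro exI[of _ t]) (simp add: word_Cons)
qed

lemma act_fixed: "act w (1, 1, 1) = (1, 1, 1) \<Longrightarrow> w = 1"
proof (rule ccontr)
  assume "act w (1, 1, 1) = (1, 1, 1)" "w \<noteq> 1"
  then obtain s where "sval s (cv w) < 0" "cv w = (1, 1, 1)"
    using exists_descent[of w] by (auto simp: len_greater_iff cv_def)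
  then show False
    by (cases s) simp_all
qed

lemma cv_inject: "cv x = cv y \<longleftrightarrow> x = y"
proof
  assume "cv x = cv y"
  then have "act (inverse x * y) (1, 1, 1) = act (inverse x * x) (1, 1, 1)"
    by (simp add: cv_def act_mult)
  then have "inverse x * y = 1"
    by (intro act_fixed) (simp add: W_left_inverse)
  then show "x = y"
    by (metis W_inverse_inverse W_inverse_unique)
qed simp

subsection \<open>Reflections\<close>

text \<open>The Gram matrix of the simple roots, with squared lengths 2, 6, 6: the entries of
  \<open>dual f\<close> are the inner products of \<open>f\<close> with the simple roots.
  \<open>lam\<close> is half the squared length.\<close>

fun dual :: "form \<Rightarrow> vec" where
  "dual (p, q, r) = (2 * p - 3 * q, 6 * q - 3 * p - 3 * r, 6 * r - 3 * q)"

fun lam :: "gen \<Rightarrow> int" where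
  "lam G1 = 1" | "lam G2 = 3" | "lam G3 = 3"

lemma dual_pull: "dual (pull s f) = fire s (dual f)"
  by (cases s; cases f) simp_all

lemma act_dual_rt: "act w (dual (rt w f)) = dual f"
  by (induction w arbitrary: f rule: W_induct) (simp_all add: rt_mult act_mult dual_pull)

text \<open>The reflection formula, multiplied by half the squared length of the root so that it
  stays integral.\<close>

lemma feval_fire: "lam s * feval f (fire s c) = lam s * feval f c - sval s c * feval f (dual (al s))"
  by (cases s; cases f; cases c) (simp_all add: algebra_simps)

lemma feval_al_dual: "feval (al s) (dual (al s)) = 2 * lam s"
  by (cases s) simp_all

lemma vec_eqI: "(\<And>f. feval f c = feval f c') \<Longrightarrow> c = c'"
proof -
  assume *: "\<And>f. feval f c = feval f c'"
  obtain p q r p' q' r' where "c = (p, q, r)" "c' = (p', q', r')"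
    by (metis prod_cases3)
  then show "c = c'"
    using *[of "(1, 0, 0)"] *[of "(0, 1, 0)"] *[of "(0, 0, 1)"] by simp
qed

text \<open>Invariance of the bilinear form shows that both simple roots have the same length. Then
  conjugation by \<open>g\<close> carries one reflection to the other, and equality in the group
  follows from equality at the base point.\<close>

lemma conj_simple: "rt g (al s) = al t \<Longrightarrow> sg s * g = g * sg t"
proof -
  assume g: "rt g (al s) = al t"
  have dual: "act g (dual (al t)) = dual (al s)"
    using act_dual_rt[of g "al s"] g by simp
  have "2 * lam t = feval (rt g (al s)) (dual (al t))"
    by (simp add: g feval_al_dual)
  also have "\<dots> = 2 * lam s"
    by (simp add: feval_rt dual feval_al_dual)
  finally have lam: "lam t = lam s"
    by simp
  have "act g (fire t c) = fire s (act g c)" for c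
  proof (rule vec_eqI)
    fix f
    have "lam s * feval f (act g (fire t c)) = lam t * feval (rt g f) (fire t c)"
      by (simp add: feval_rt lam)
    also have "\<dots> = lam s * feval f (act g c) - feval (rt g (al s)) c * feval f (dual (al s))"
      unfolding feval_fire g by (simp add: feval_rt lam dual feval_al)
    also have "\<dots> = lam s * feval f (fire s (act g c))"
      by (simp add: feval_fire feval_rt feval_al)
    finally show "feval f (act g (fire t c)) = feval f (fire s (act g c))"
      by (cases s) simp_all
  qed
  then have "cv (sg s * g) = cv (g * sg t)"
    by (simp add: cv_def act_mult)
  then show ?thesis
    by (rule iffD1[OF cv_inject])
qed

text \<open>The only positive root that the reflection in \<open>al a\<close> makes negative is
  \<open>al a\<close>. The letter \<open>a\<close> found here is the one deleted in the strong
  exchange condition.\<close>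

lemma word_sign_change:
  assumes "isroot f" "pos f" "\<not> pos (pullw xs f)"
  shows "\<exists>ys a zs. xs = ys @ a # zs \<and> pullw ys f = al a"
  using assms
proof (induction xs arbitrary: f)
  case (Cons a xs)
  show ?case
  proof (cases "f = al a")
    case True
    then show ?thesis
      by (intro exI[of _ "[]"]) auto
  next
    case False
    then have "pos (pull a f)" "isroot (pull a f)"
      using Cons.prems by (simp_all add: pos_pull isroot_pull)
    then obtain ys b zs where "xs = ys @ b # zs" "pullw ys (pull a f) = al b"
      using Cons.IH Cons.prems(3) by (metis pullw.simps(2))
    then show ?thesis
      by (intro exI[of _ "a # ys"]) auto
  qed
qed simp

lemma reflections_eq: "reflections = {u * sg s * inverse u | u s. True}"
  by (auto simp: reflections_def S_eq)

lemma reflection_pos_root: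
  assumes "t \<in> reflections"
  obtains u s where "t = u * sg s * inverse u" "pos (rt (inverse u) (al s))"
proof -
  obtain u s where u: "t = u * sg s * inverse u"
    using assms by (auto simp: reflections_eq)
  show thesis
  proof (cases "pos (rt (inverse u) (al s))")
    case False
    have "t = (u * sg s) * sg s * inverse (u * sg s)"
      by (simp add: u W_inverse_mult mult.assoc)
    moreover have "rt (inverse (u * sg s)) (al s) = neg (rt (inverse u) (al s))"
      by (simp add: W_inverse_mult rt_mult pull_al rt_neg)
    moreover have "pos (neg (rt (inverse u) (al s)))"
      using False root_pos_or_neg isroot_rt[OF isroot_al] by blast
    ultimately show thesis
      using that by metis
  qed (use that u in blast)
qed

text \<open>At the letter where the root changes sign, moving \<open>t\<close> through the prefix
  \<open>ys\<close> turns it into that letter, and the two cancel.\<close>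

lemma reflection_shortens:
  assumes t: "t = u * sg s * inverse u" and pos: "pos (rt (inverse u) (al s))"
    and npos: "\<not> pos (rt x (rt (inverse u) (al s)))"
  shows "len (t * x) < len x"
proof -
  obtain xs where xs: "length xs = len x" "x = word xs"
    using reduced_word by blast
  have "\<not> pos (pullw xs (rt (inverse u) (al s)))"
    using npos xs(2) by (simp add: rt.abs_eq)
  then obtain ys a zs where ys: "xs = ys @ a # zs" "pullw ys (rt (inverse u) (al s)) = al a"
    using word_sign_change[OF isroot_rt[OF isroot_al] pos] by blast
  then have "rt (inverse u * word ys) (al s) = al a"
    by (simp add: rt_mult rt.abs_eq)
  then have "sg s * (inverse u * word ys) = inverse u * word ys * sg a"
    by (rule conj_simple)
  then have "t * word ys = word ys * sg a"
    by (simp add: t mult.assoc) (metis W_right_inverse mult.assoc mult_1)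
  then have "t * x = word (ys @ zs)"
    by (simp add: xs(2) ys(1) word_append word_Cons flip: mult.assoc) (simp add: mult.assoc)
  then show ?thesis
    using len_word_le[of "ys @ zs"] xs(1) ys(1) by simp
qed

lemma reflection_less_iff:
  assumes t: "t = u * sg s * inverse u" and pos: "pos (rt (inverse u) (al s))"
  shows "len x < len (t * x) \<longleftrightarrow> pos (rt x (rt (inverse u) (al s)))"
proof
  assume "len x < len (t * x)"
  then show "pos (rt x (rt (inverse u) (al s)))"
    using reflection_shortens[OF t pos, of x] by linarith
next
  assume *: "pos (rt x (rt (inverse u) (al s)))"
  have "inverse u * t = sg s * inverse u" "t * t = 1"
    by (simp_all add: t mult.assoc W_left_inverse W_right_inverse)
      (simp_all add: W_left_inverse W_right_inverse flip: mult.assoc)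
  then have "rt (t * x) (rt (inverse u) (al s)) = neg (rt x (rt (inverse u) (al s)))"
    by (simp add: pull_al rt_neg flip: rt_mult mult.assoc) (simp add: rt_mult pull_al rt_neg)
  moreover have "\<not> pos (neg (rt x (rt (inverse u) (al s))))"
    using * root_pos_or_neg isroot_rt isroot_al by blast
  ultimately have "len (t * (t * x)) < len (t * x)"
    using reflection_shortens[OF t pos, of "t * x"] by simp
  then show "len x < len (t * x)"
    using \<open>t * t = 1\<close> by (simp flip: mult.assoc)
qed

text \<open>Conjugating \<open>t\<close> by \<open>sg r\<close> applies \<open>pull r\<close> to its
  positive root, which stays positive because \<open>t\<close> is not \<open>sg r\<close>. Both
  length comparisons are then governed by the sign of the same transformed root.\<close>

lemma bruhat_step:
  assumes "t \<in> reflections" "len x < len (t * x)" "t \<noteq> sg r"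
  shows "\<exists>t'\<in>reflections. sg r * (t * x) = t' * (sg r * x) \<and> len (sg r * x) < len (sg r * (t * x))"
proof -
  obtain u s where t: "t = u * sg s * inverse u" and pos: "pos (rt (inverse u) (al s))"
    using reflection_pos_root[OF assms(1)] by blast
  have "rt (inverse u) (al s) \<noteq> al r"
  proof
    assume "rt (inverse u) (al s) = al r"
    then have "sg s * inverse u = inverse u * sg r"
      by (rule conj_simple)
    then have "t = sg r"
      by (simp add: t mult.assoc) (metis W_right_inverse mult.assoc mult_1)
    then show False
      using assms(3) by simp
  qed
  then have pos': "pos (rt (inverse (sg r * u)) (al s))"
    using pos by (simp add: W_inverse_mult rt_mult pos_pull isroot_rt)
  have t': "sg r * t * sg r = (sg r * u) * sg s * inverse (sg r * u)"
    by (simp add: t W_inverse_mult mult.assoc)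
  have "pos (rt (sg r * x) (rt (inverse (sg r * u)) (al s)))"
  proof -
    have "sg r * (sg r * x) = x"
      by simp
    moreover have "rt (sg r * x) (rt (inverse (sg r * u)) (al s)) = rt (sg r * (sg r * x)) (rt (inverse u) (al s))"
      by (simp only: W_inverse_mult inverse_sg rt_mult)
    ultimately show ?thesis
      using assms(2) reflection_less_iff[OF t pos] by simp
  qed
  then have "len (sg r * x) < len ((sg r * t * sg r) * (sg r * x))"
    using reflection_less_iff[OF t' pos'] by blast
  moreover have "(sg r * t * sg r) * (sg r * x) = sg r * (t * x)"
    by (simp add: mult.assoc)
  moreover have "sg r * t * sg r \<in> reflections"
    unfolding t' reflections_eq by blast
  ultimately show ?thesis
    by metis
qed

lemma sg_reflection: "sg s \<in> reflections"
  unfolding reflections_eq by (auto intro!: exI[of _ 1])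

lemma bruhat_refl [simp]: "bruhat_le w w"
  by (simp add: bruhat_le_def)

lemma bruhat_trans: "bruhat_le x y \<Longrightarrow> bruhat_le y z \<Longrightarrow> bruhat_le x z"
  by (simp add: bruhat_le_def)

lemma bruhat_step_le: "t \<in> reflections \<Longrightarrow> len y < len (t * y) \<Longrightarrow> bruhat_le y (t * y)"
  unfolding bruhat_le_def by (rule r_into_rtranclp) auto

lemma bruhat_up: "len w < len (sg s * w) \<Longrightarrow> bruhat_le w (sg s * w)"
  by (rule bruhat_step_le[OF sg_reflection])

lemma bruhat_len: "bruhat_le y w \<Longrightarrow> y = w \<or> len y < len w"
  unfolding bruhat_le_def by (induction rule: rtranclp_induct) auto

text \<open>Controls the support when a Kazhdan-Lusztig element is multiplied by a generator.
  Reflections in the chain other than \<open>sg s\<close> are lifted by conjugation; when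
  \<open>sg s\<close> itself occurs, \<open>sg s * y\<close> is the next member of the
  chain.\<close>

lemma bruhat_lift:
  assumes "bruhat_le y w" "len w < len (sg s * w)"
  shows "bruhat_le (sg s * y) (sg s * w)"
  using assms(1) unfolding bruhat_le_def
proof (induction rule: converse_rtranclp_induct)
  case (step y y')
  then obtain t where t: "t \<in> reflections" "y' = t * y" "len y < len y'"
    by blast
  have IH: "bruhat_le (sg s * y') (sg s * w)" and y': "bruhat_le y' w"
    using step by (simp_all add: bruhat_le_def)
  have "bruhat_le (sg s * y) (sg s * w)"
  proof (cases "t = sg s")
    case True
    then show ?thesis
      using t y' bruhat_up[OF assms(2)] bruhat_trans by blast
  next
    case False
    then obtain t' where "t' \<in> reflections" "sg s * y' = t' * (sg s * y)"
        "len (sg s * y) < len (sg s * y')"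
      using bruhat_step[OF t(1) _ False, of y] t by auto
    then have "bruhat_le (sg s * y) (sg s * y')"
      using bruhat_step_le[of t' "sg s * y"] by simp
    then show ?thesis
      using IH bruhat_trans by blast
  qed
  then show ?case
    by (simp add: bruhat_le_def)
qed simp

section \<open>The Hecke algebra\<close>

subsection \<open>Laurent polynomials\<close>

abbreviation keys :: "('a \<Rightarrow>\<^sub>0 'b::zero) \<Rightarrow> 'a set" where
  "keys \<equiv> Poly_Mapping.keys"

abbreviation coeff :: "laurent \<Rightarrow> int \<Rightarrow> int" where
  "coeff \<equiv> Poly_Mapping.lookup"

lemma vpow_0 [simp]: "vpow 0 = 1"
  by (simp add: vpow_def)

lemma vpow_add: "vpow (i + j) = vpow i * vpow j"
  by (simp add: vpow_def mult_single)

lemma vpow_inverse [simp]: "vpow i * vpow (- i) = 1" "vpow (- i) * vpow i = 1"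
  by (simp_all flip: vpow_add)

lemma laurent_induct [case_names zero add]:
  assumes "P 0" "\<And>p k x. P p \<Longrightarrow> P (p + Poly_Mapping.single k x)"
  shows "P (p :: laurent)"
proof -
  have "finite K \<Longrightarrow> keys p \<subseteq> K \<Longrightarrow> P p" for K p
  proof (induction K arbitrary: p rule: finite_induct)
    case empty
    then show ?case using assms(1) by simp
  next
    case (insert k K)
    define q where "q = p - Poly_Mapping.single k (coeff p k)"
    have "keys q \<subseteq> K"
    proof
      fix x assume "x \<in> keys q"
      then have "coeff q x \<noteq> 0" "x \<noteq> k"
        by (auto simp: q_def in_keys_iff lookup_minus)
      then have "coeff p x \<noteq> 0"
        by (simp add: q_def lookup_minus lookup_single_not_eq)
      then show "x \<in> K"
        using insert.prems \<open>x \<noteq> k\<close> by (auto simp: in_keys_iff)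
    qed
    then have "P (q + Poly_Mapping.single k (coeff p k))"
      using insert.IH assms(2) by blast
    then show ?case
      by (simp add: q_def)
  qed
  then show ?thesis
    by (metis finite_keys subset_refl)
qed

lemma lookup_lbar: "coeff (lbar p) k = coeff p (- k)"
  by (simp add: lbar_def map_key.rep_eq[OF injI])

lemma lbar_zero [simp]: "lbar 0 = 0"
  by (rule poly_mapping_eqI) (simp add: lookup_lbar)

lemma lbar_single: "lbar (Poly_Mapping.single k x) = Poly_Mapping.single (- k) x"
  by (rule poly_mapping_eqI) (auto simp: lookup_lbar lookup_single when_def)

lemma lbar_add: "lbar (p + q) = lbar p + lbar q"
  by (rule poly_mapping_eqI) (simp add: lookup_lbar lookup_add)

lemma lbar_diff: "lbar (p - q) = lbar p - lbar q"
  by (rule poly_mapping_eqI) (simp add: lookup_lbar lookup_minus)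

lemma lbar_mult: "lbar (p * q) = lbar p * lbar q"
proof (induction p rule: laurent_induct)
  case (add p k x)
  have "lbar (Poly_Mapping.single k x * q) = lbar (Poly_Mapping.single k x) * lbar q"
    by (induction q rule: laurent_induct)
      (simp_all add: lbar_add lbar_single mult_single distrib_left)
  with add show ?case
    by (simp add: lbar_add distrib_right)
qed simp

lemma lbar_vpow [simp]: "lbar (vpow k) = vpow (- k)"
  by (simp add: vpow_def lbar_single)

lemma lbar_one [simp]: "lbar 1 = 1"
  using lbar_vpow[of 0] by simp

definition dle :: "int \<Rightarrow> laurent \<Rightarrow> bool" where
  "dle K p \<longleftrightarrow> (\<forall>k>K. coeff p k = 0)"

lemma dle_zero [simp]: "dle K 0"
  by (simp add: dle_def)

lemma dle_add: "dle K p \<Longrightarrow> dle K q \<Longrightarrow> dle K (p + q)"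
  by (simp add: dle_def lookup_add)

lemma dle_diff: "dle K p \<Longrightarrow> dle K q \<Longrightarrow> dle K (p - q)"
  by (simp add: dle_def lookup_minus)

lemma dle_sum: "(\<And>x. x \<in> A \<Longrightarrow> dle K (f x)) \<Longrightarrow> dle K (sum f A)"
  by (induction A rule: infinite_finite_induct) (simp_all add: dle_add)

lemma dle_mono: "dle K p \<Longrightarrow> K \<le> K' \<Longrightarrow> dle K' p"
  by (simp add: dle_def)

lemma dle_mult: "dle K p \<Longrightarrow> dle K' q \<Longrightarrow> dle (K + K') (p * q)"
  unfolding dle_def
proof (intro allI impI, rule ccontr)
  fix k assume *: "\<forall>k>K. coeff p k = 0" "\<forall>k>K'. coeff q k = 0" "K + K' < k" "coeff (p * q) k \<noteq> 0"
  then have "k \<in> keys (p * q)"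
    by (simp add: in_keys_iff)
  then obtain i j where ij: "k = i + j" "i \<in> keys p" "j \<in> keys q"
    using keys_mult by blast
  then have "\<not> K < i" "\<not> K' < j"
    using * by (auto simp: in_keys_iff)
  then show False
    using * ij(1) by simp
qed

lemma vneg_dle: "p \<in> vneg \<longleftrightarrow> dle (- 1) p"
proof -
  have "k < 0 \<longleftrightarrow> \<not> - 1 < k" for k :: int
    by linarith
  then show ?thesis
    unfolding vneg_def dle_def subset_eq by (auto simp: in_keys_iff)
qed

lemma dle_coeff: "dle K p \<Longrightarrow> K < k \<Longrightarrow> coeff p k = 0"
  by (simp add: dle_def)

lemma dle_vpow: "dle k (vpow k)"
  by (auto simp: dle_def vpow_def lookup_single when_def)

text \<open>Take the nonnegative powers of \<open>p\<close> and add the mirror images of the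
  positive ones. This changes coefficients of negative powers only.\<close>

lemma bar_invariant_part: "\<exists>m. lbar m = m \<and> p - m \<in> vneg"
proof (induction p rule: laurent_induct)
  case zero
  show ?case
    by (intro exI[of _ 0]) (simp add: vneg_dle)
next
  case (add p k x)
  obtain m where m: "lbar m = m" "dle (- 1) (p - m)"
    using add by (auto simp: vneg_dle)
  define n where "n = (if k < 0 then 0 else if k = 0 then Poly_Mapping.single 0 x
    else Poly_Mapping.single k x + Poly_Mapping.single (- k) x)"
  have "lbar n = n"
    by (simp add: n_def lbar_add lbar_single add.commute)
  moreover have "dle (- 1) (Poly_Mapping.single k x - n)"
    by (auto simp: n_def dle_def lookup_minus lookup_add lookup_single when_def)
  moreover have "p + Poly_Mapping.single k x - (m + n) = (p - m) + (Poly_Mapping.single k x - n)"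
    by simp
  ultimately show ?case
    using m by (metis dle_add lbar_add vneg_dle)
qed

lemma bar_invariant_vneg: "lbar p = p \<Longrightarrow> p \<in> vneg \<Longrightarrow> p = 0"
proof (rule poly_mapping_eqI)
  fix k assume p: "lbar p = p" "p \<in> vneg"
  then have "coeff p k = coeff p (- k)"
    by (metis lookup_lbar)
  moreover have "coeff p k = 0 \<or> coeff p (- k) = 0"
    using p(2) dle_coeff[of "- 1" p] by (cases "k < 0") (auto simp: vneg_dle)
  ultimately show "coeff p k = coeff 0 k"
    by auto
qed

subsection \<open>Linear maps\<close>

abbreviation cf :: "hecke \<Rightarrow> W \<Rightarrow> laurent" where
  "cf \<equiv> Poly_Mapping.lookup"

lemma lookup_scale [simp]: "cf (scale a h) w = a * cf h w"
  by (simp add: scale_def Poly_Mapping.map.rep_eq when_def)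

lemma lookup_T: "cf (T w) x = (if w = x then 1 else 0)"
  by (simp add: T_def lookup_single when_def)

lemma scale_add: "scale a (h + k) = scale a h + scale a k"
  by (rule poly_mapping_eqI) (simp add: lookup_add distrib_left)

lemma scale_sub: "scale a (h - k) = scale a h - scale a k"
  by (rule poly_mapping_eqI) (simp add: lookup_minus right_diff_distrib)

lemma scale_add_left: "scale (a + b) h = scale a h + scale b h"
  by (rule poly_mapping_eqI) (simp add: lookup_add distrib_right)

lemma scale_minus_left: "scale (- a) h = - scale a h"
  by (rule poly_mapping_eqI) simp

lemma scale_diff_left: "scale (a - b) h = scale a h - scale b h"
  by (rule poly_mapping_eqI) (simp add: lookup_minus left_diff_distrib)

lemma scale_scale [simp]: "scale a (scale b h) = scale (a * b) h"
  by (rule poly_mapping_eqI) (simp add: mult.assoc)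

lemma scale_one [simp]: "scale 1 h = h"
  by (rule poly_mapping_eqI) simp

lemma scale_zero_left [simp]: "scale 0 h = 0"
  by (rule poly_mapping_eqI) simp

lemma scale_zero_right [simp]: "scale a 0 = 0"
  by (rule poly_mapping_eqI) simp

lemma scale_sum: "scale a (sum f A) = (\<Sum>x\<in>A. scale a (f x))"
  by (rule poly_mapping_eqI) (simp add: lookup_sum sum_distrib_left)

definition lext :: "(W \<Rightarrow> hecke) \<Rightarrow> hecke \<Rightarrow> hecke" where
  "lext f h = (\<Sum>w\<in>keys h. scale (cf h w) (f w))"

lemma lext_superset:
  "finite A \<Longrightarrow> keys h \<subseteq> A \<Longrightarrow> lext f h = (\<Sum>w\<in>A. scale (cf h w) (f w))"
  unfolding lext_def by (rule sum.mono_neutral_left) (auto simp: in_keys_iff)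

lemma lext_add: "lext f (h + k) = lext f h + lext f k"
proof -
  let ?A = "keys h \<union> keys k"
  have "keys (h + k) \<subseteq> ?A"
    by (rule keys_add)
  then show ?thesis
    by (simp add: lext_superset[of ?A] lookup_add scale_add_left sum.distrib)
qed

lemma lext_scale: "lext f (scale a h) = scale a (lext f h)"
proof -
  have "keys (scale a h) \<subseteq> keys h"
    by (auto simp: in_keys_iff)
  then show ?thesis
    by (simp add: lext_superset[of "keys h"] scale_sum)
qed

lemma lext_T [simp]: "lext f (T w) = f w"
  by (simp add: lext_superset[of "{w}"] T_def)

definition hlin :: "(hecke \<Rightarrow> hecke) \<Rightarrow> bool" where
  "hlin F \<longleftrightarrow> (\<forall>h k. F (h + k) = F h + F k) \<and> (\<forall>a h. F (scale a h) = scale a (F h))"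

lemma hlin_lext [simp]: "hlin (lext f)"
  by (simp add: hlin_def lext_add lext_scale)

lemma hlin_add: "hlin F \<Longrightarrow> F (h + k) = F h + F k"
  and hlin_scale: "hlin F \<Longrightarrow> F (scale a h) = scale a (F h)"
  by (simp_all add: hlin_def)

lemma hlin_zero: "hlin F \<Longrightarrow> F 0 = 0"
  using hlin_scale[of F 0 0] by simp

lemma hlin_diff: "hlin F \<Longrightarrow> F (h - k) = F h - F k"
  by (metis add_diff_cancel diff_add_cancel hlin_add)

lemma hlin_sum: "hlin F \<Longrightarrow> F (sum f A) = (\<Sum>x\<in>A. F (f x))"
  by (induction A rule: infinite_finite_induct) (simp_all add: hlin_zero hlin_add)

lemma hlin_id [simp]: "hlin (\<lambda>h. h)"
  by (simp add: hlin_def)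

lemma hlin_comp: "hlin F \<Longrightarrow> hlin G \<Longrightarrow> hlin (\<lambda>h. F (G h))"
  by (simp add: hlin_def)

lemma hlin_plus: "hlin F \<Longrightarrow> hlin G \<Longrightarrow> hlin (\<lambda>h. F h + G h)"
  by (simp add: hlin_def scale_add algebra_simps)

lemma hlin_smult: "hlin F \<Longrightarrow> hlin (\<lambda>h. scale a (F h))"
  by (simp add: hlin_def scale_add mult.commute)

lemma hlin_Sum: "(\<And>x. x \<in> A \<Longrightarrow> hlin (F x)) \<Longrightarrow> hlin (\<lambda>h. \<Sum>x\<in>A. F x h)"
  by (simp add: hlin_def sum.distrib scale_sum)

lemma hecke_expand: "h = (\<Sum>w\<in>keys h. scale (cf h w) (T w))"
proof (rule poly_mapping_eqI)
  fix x
  have "(\<Sum>w\<in>keys h. cf h w * (if w = x then 1 else 0)) =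
      (\<Sum>w\<in>keys h. if w = x then cf h w else 0)"
    by (rule sum.cong) simp_all
  also have "\<dots> = cf h x"
    by (simp add: in_keys_iff)
  finally have "(\<Sum>w\<in>keys h. cf h w * (if w = x then 1 else 0)) = cf h x" .
  then show "cf h x = cf (\<Sum>w\<in>keys h. scale (cf h w) (T w)) x"
    by (simp only: lookup_sum lookup_scale lookup_T)
qed

lemma hlin_expand: "hlin F \<Longrightarrow> F h = lext (\<lambda>w. F (T w)) h"
proof -
  assume F: "hlin F"
  have "F h = F (\<Sum>w\<in>keys h. scale (cf h w) (T w))"
    using hecke_expand[of h] by (rule arg_cong)
  also have "\<dots> = lext (\<lambda>w. F (T w)) h"
    by (simp only: hlin_sum[OF F] hlin_scale[OF F] lext_def)
  finally show ?thesis .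
qed

lemma hlin_eqI:
  assumes "hlin F" "hlin G" "\<And>w. F (T w) = G (T w)"
  shows "F h = G h"
  by (simp only: hlin_expand[OF assms(1), of h] hlin_expand[OF assms(2), of h] assms(3))

subsection \<open>Existence and uniqueness of the multiplication\<close>

locale weighted =
  fixes L :: "W \<Rightarrow> int"
  assumes weight: "weight_function L" and L_pos: "w \<noteq> 1 \<Longrightarrow> 0 < L w"
begin

definition xi :: "gen \<Rightarrow> laurent" where
  "xi s = vpow (L (sg s)) - vpow (- L (sg s))"

lemma L_mult: "len (x * y) = len x + len y \<Longrightarrow> L (x * y) = L x + L y"
  using weight by (simp add: weight_function_def)

lemma L_sg_pos: "0 < L (sg s)"
  by (rule L_pos) (metis len_one len_sg zero_neq_one)

definition lmul :: "gen \<Rightarrow> hecke \<Rightarrow> hecke" where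
  "lmul s = lext (\<lambda>w. if len w < len (sg s * w) then T (sg s * w)
     else T (sg s * w) + scale (xi s) (T w))"

definition rmul :: "gen \<Rightarrow> hecke \<Rightarrow> hecke" where
  "rmul s = lext (\<lambda>w. if len w < len (w * sg s) then T (w * sg s)
     else T (w * sg s) + scale (xi s) (T w))"

lemma hlin_lmul [simp]: "hlin (lmul s)" and hlin_rmul [simp]: "hlin (rmul s)"
  by (simp_all add: lmul_def rmul_def)

lemmas lmul_lin = hlin_add[OF hlin_lmul] hlin_scale[OF hlin_lmul]
lemmas rmul_lin = hlin_add[OF hlin_rmul] hlin_scale[OF hlin_rmul]

lemma lmul_up: "len w < len (sg s * w) \<Longrightarrow> lmul s (T w) = T (sg s * w)"
  by (simp add: lmul_def)

lemma lmul_down: "len (sg s * w) < len w \<Longrightarrow> lmul s (T w) = T (sg s * w) + scale (xi s) (T w)"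
  by (simp add: lmul_def)

lemma rmul_up: "len w < len (w * sg s) \<Longrightarrow> rmul s (T w) = T (w * sg s)"
  by (simp add: rmul_def)

lemma rmul_down: "len (w * sg s) < len w \<Longrightarrow> rmul s (T w) = T (w * sg s) + scale (xi s) (T w)"
  by (simp add: rmul_def)

lemma sg_sg_right [simp]: "w * sg s * sg s = w"
  by (simp add: mult.assoc)

lemma len_mult_sg: "len (w * sg s) = Suc (len w) \<or> len w = Suc (len (w * sg s))"
  using len_sg_mult[of s "inverse w"] len_inverse[of "w * sg s"] by (simp add: W_inverse_mult)

text \<open>Passing from \<open>w\<close> to \<open>w * sg t\<close> makes the positive root
  \<open>rt w (al s)\<close> negative under \<open>pull t\<close>, so it must be
  \<open>al t\<close>.\<close>

lemma exchange_commute: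
  assumes "len w < len (sg s * w)" "len w < len (w * sg t)" "len (sg s * (w * sg t)) < len (w * sg t)"
  shows "sg s * w = w * sg t"
proof -
  have "pos (rt w (al s))"
    using assms(1) by (rule ascent_pos)
  moreover have "pos (neg (rt (w * sg t) (al s)))"
    using ascent_pos[of "sg s * (w * sg t)" s] assms(3) by (simp add: rt_mult pull_al rt_neg pull_neg)
  then have "\<not> pos (pull t (rt w (al s)))"
    using root_pos_or_neg[OF isroot_pull[OF isroot_rt[OF isroot_al]]] by (auto simp: rt_mult)
  ultimately have "rt w (al s) = al t"
    using pos_pull isroot_rt isroot_al by blast
  then show ?thesis
    by (rule conj_simple)
qed

lemma xi_conj: "len w < len (sg s * w) \<Longrightarrow> sg s * w = w * sg t \<Longrightarrow> xi s = xi t"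
proof -
  assume *: "len w < len (sg s * w)" "sg s * w = w * sg t"
  have "len (sg s * w) = len (sg s) + len w"
    using len_sg_mult[of s w] *(1) by auto
  then have "L (sg s) + L w = L w + L (sg t)"
    using L_mult[of "sg s" w] L_mult[of w "sg t"] *(2) by simp
  then show ?thesis
    by (simp add: xi_def)
qed

text \<open>If left and right multiplication do not change the length independently, the exchange
  argument gives \<open>sg s * w = w * sg t\<close>, and the two parameters agree because
  \<open>L\<close> is additive.\<close>

lemma lmul_rmul_T: "lmul s (rmul t (T w)) = rmul t (lmul s (T w))"
proof -
  have assoc: "sg s * w * sg t = sg s * (w * sg t)"
    by (simp add: mult.assoc)
  note l = len_sg_mult[of s w] len_mult_sg[of w t] len_sg_mult[of s "w * sg t"]
    len_mult_sg[of "sg s * w" t, unfolded assoc]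
  consider "len w < len (sg s * w)" "len w < len (w * sg t)"
    | "len w < len (sg s * w)" "len (w * sg t) < len w"
    | "len (sg s * w) < len w" "len w < len (w * sg t)"
    | "len (sg s * w) < len w" "len (w * sg t) < len w"
    using l by linarith
  then show ?thesis
  proof cases
    case 1
    show ?thesis
    proof (cases "len (sg s * (w * sg t)) < len (w * sg t)")
      case True
      have eq: "sg s * w = w * sg t"
        using exchange_commute 1 True by blast
      then have "xi s = xi t"
        using xi_conj 1(1) by blast
      moreover have "sg s * (w * sg t) = w"
        by (simp flip: eq)
      ultimately show ?thesis
        using 1 eq by (simp add: lmul_up lmul_down rmul_up rmul_down)
    next
      case False
      then show ?thesis
        using 1 l by (simp add: lmul_up rmul_up assoc)
    qed
  next
    case 2
    then have "len (w * sg t) < len (sg s * (w * sg t))" "len (sg s * (w * sg t)) < len (sg s * w)"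
      using l by linarith+
    with 2 show ?thesis
      by (simp add: lmul_up rmul_down lmul_lin assoc)
  next
    case 3
    then have "len (sg s * w) < len (sg s * (w * sg t))" "len (sg s * (w * sg t)) < len (w * sg t)"
      using l by linarith+
    with 3 show ?thesis
      by (simp add: lmul_down rmul_up rmul_lin assoc)
  next
    case 4
    show ?thesis
    proof (cases "len (sg s * (w * sg t)) < len (w * sg t)")
      case True
      then have "len (sg s * (w * sg t)) < len (sg s * w)"
        using l 4 by linarith
      with 4 True show ?thesis
        by (simp add: lmul_down rmul_down lmul_lin rmul_lin assoc scale_add algebra_simps)
    next
      case False
      \<comment> \<open>Passing to the shorter element \<open>w'\<close> turns two descents into two
        ascents, so that \<open>exchange_commute\<close> applies.\<close>
      define w' where "w' = sg s * w"
      have w: "w = sg s * w'" "sg s * (w * sg t) = w' * sg t"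
        by (simp_all add: w'_def mult.assoc)
      have 1: "len w' < len (sg s * w')"
        using 4(1) by (simp add: w'_def)
      moreover have 2: "len w' < len (w' * sg t)" "len (sg s * (w' * sg t)) < len (w' * sg t)"
        using 4 False l unfolding w'_def assoc by auto
      ultimately have *: "sg s * w' = w' * sg t"
        using exchange_commute by blast
      then have "xi s = xi t"
        using xi_conj 1 by blast
      have eq: "sg s * (w * sg t) = w"
        using * w by simp
      then have eq': "sg s * w = w * sg t"
        by (metis sg_sg_left)
      show ?thesis
        using 4 eq \<open>xi s = xi t\<close>
        by (simp add: lmul_down lmul_up rmul_down rmul_up lmul_lin rmul_lin scale_add eq')
    qed
  qed
qed

lemma lmul_rmul: "lmul s (rmul t h) = rmul t (lmul s h)"
  by (rule hlin_eqI[of "\<lambda>h. lmul s (rmul t h)" "\<lambda>h. rmul t (lmul s h)"])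
    (simp_all add: hlin_comp lmul_rmul_T)

fun lmulw :: "gen list \<Rightarrow> hecke \<Rightarrow> hecke" where
  "lmulw [] h = h"
| "lmulw (s # xs) h = lmul s (lmulw xs h)"

lemma hlin_lmulw [simp]: "hlin (lmulw xs)"
proof -
  have "hlin (\<lambda>h. lmulw xs h)"
    by (induction xs) (simp_all add: hlin_comp)
  then show ?thesis by simp
qed

lemma lmulw_T_one: "len (word xs) = length xs \<Longrightarrow> lmulw xs (T 1) = T (word xs)"
proof (induction xs)
  case (Cons s xs)
  have "len (word xs) = length xs"
    using Cons.prems len_word_le[of xs] len_sg_mult[of s "word xs"] by (auto simp: word_Cons)
  then show ?case
    using Cons by (simp add: word_Cons lmul_up)
qed (simp add: word_Nil)

text \<open>The maps commuting with all right multiplications are the left multiplications; such a map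
  is determined by its value at the unit.\<close>

definition rlin :: "(hecke \<Rightarrow> hecke) \<Rightarrow> bool" where
  "rlin F \<longleftrightarrow> hlin F \<and> (\<forall>t h. F (rmul t h) = rmul t (F h))"

lemma rlin_hlin: "rlin F \<Longrightarrow> hlin F"
  by (simp add: rlin_def)

lemma rlin_lmul [simp]: "rlin (lmul s)"
  by (simp add: rlin_def lmul_rmul)

lemma rlin_id [simp]: "rlin (\<lambda>h. h)"
  by (simp add: rlin_def)

lemma rlin_comp: "rlin F \<Longrightarrow> rlin G \<Longrightarrow> rlin (\<lambda>h. F (G h))"
  by (simp add: rlin_def hlin_comp)

lemma rlin_smult: "rlin F \<Longrightarrow> rlin (\<lambda>h. scale a (F h))"
  by (simp add: rlin_def hlin_smult rmul_lin)

lemma rlin_Sum: "(\<And>x. x \<in> A \<Longrightarrow> rlin (F x)) \<Longrightarrow> rlin (\<lambda>h. \<Sum>x\<in>A. F x h)"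
  by (simp add: rlin_def hlin_Sum hlin_sum[OF hlin_rmul])

lemma rlin_lmulw [simp]: "rlin (lmulw xs)"
proof -
  have "rlin (\<lambda>h. lmulw xs h)"
    by (induction xs) (simp_all add: rlin_comp)
  then show ?thesis by simp
qed

lemma rlin_eqI:
  assumes "rlin F" "rlin G" "F (T 1) = G (T 1)"
  shows "F h = G h"
proof (rule hlin_eqI[OF rlin_hlin[OF assms(1)] rlin_hlin[OF assms(2)]])
  show "F (T w) = G (T w)" for w
  proof (induction "len w" arbitrary: w rule: less_induct)
    case less
    show ?case
    proof (cases "w = 1")
      case False
      then have "inverse w \<noteq> 1"
        by (metis W_inverse_inverse W_inverse_one)
      then obtain s where "len (sg s * inverse w) < len (inverse w)"
        using exists_descent by blast
      then have s: "len (w * sg s) < len w"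
        using len_inverse[of "w * sg s"] by (simp add: W_inverse_mult)
      then have "rmul s (T (w * sg s)) = T w"
        using rmul_up[of "w * sg s" s] by (simp add: mult.assoc)
      then show ?thesis
        using less s assms(1,2) unfolding rlin_def by metis
    qed (use assms in simp)
  qed
qed

section \<open>The product defined by reduced words, and its uniqueness\<close>

definition red :: "W \<Rightarrow> gen list" where
  "red w = (SOME xs. length xs = len w \<and> w = word xs)"

lemma red: "length (red w) = len w" "word (red w) = w"
proof -
  have "length (red w) = len w \<and> w = word (red w)"
    unfolding red_def by (rule someI_ex) (rule reduced_word)
  then show "length (red w) = len w" "word (red w) = w"
    by simp_all
qed

lemma lmulw_red_T_one [simp]: "lmulw (red w) (T 1) = T w"
  by (simp add: lmulw_T_one red)

definition hmul :: "hecke \<Rightarrow> hecke \<Rightarrow> hecke" where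
  "hmul h k = lext (\<lambda>w. lmulw (red w) k) h"

lemma hmul_left_add: "hmul (h + h') k = hmul h k + hmul h' k"
  and hmul_left_scale: "hmul (scale a h) k = scale a (hmul h k)"
  by (simp_all add: hmul_def lext_add lext_scale)

lemma rlin_hmul [simp]: "rlin (hmul h)"
proof -
  have "rlin (\<lambda>k. \<Sum>w\<in>keys h. scale (cf h w) (lmulw (red w) k))"
    by (intro rlin_Sum rlin_smult) simp
  then show ?thesis
    by (simp add: hmul_def[abs_def] lext_def[abs_def])
qed

lemma hmul_T: "hmul (T w) k = lmulw (red w) k"
  by (simp add: hmul_def)

lemma hmul_one_right [simp]: "hmul h (T 1) = h"
  using hecke_expand[of h] by (simp add: hmul_def lext_def)

lemma rlin_hmul_eq: "rlin F \<Longrightarrow> F k = hmul (F (T 1)) k"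
  by (rule rlin_eqI) simp_all

lemma lmul_eq: "lmul s k = hmul (T (sg s)) k"
  using rlin_hmul_eq[OF rlin_lmul, of s k] lmul_up[of 1 s] by simp

text \<open>As functions of \<open>l\<close> both sides commute with all right multiplications, and
  they agree at \<open>T 1\<close>.\<close>

lemma hmul_assoc: "hmul (hmul h k) l = hmul h (hmul k l)"
  using rlin_hmul_eq[of "\<lambda>l. hmul h (hmul k l)" l] by (simp add: rlin_comp)

lemma hmul_one_left [simp]: "hmul (T 1) h = h"
  using rlin_hmul_eq[of "\<lambda>h. h" h] by simp

lemmas hlin_hmul [simp] = rlin_hlin[OF rlin_hmul]
lemmas hmul_lin = hlin_add[OF hlin_hmul] hlin_scale[OF hlin_hmul]

lemma is_hecke_mult_hmul: "is_hecke_mult L hmul"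
  unfolding is_hecke_mult_def S_eq
  by (auto simp: hmul_left_add hmul_left_scale hmul_lin hmul_assoc lmul_up lmul_down xi_def
      simp flip: lmul_eq)

text \<open>This identifies the \<open>THE\<close> in \<open>hecke_algebra\<close>. The products
  with generators are prescribed, and associativity extends them along reduced words.\<close>

lemma is_hecke_mult_unique: "is_hecke_mult L m \<Longrightarrow> m = hmul"
proof (intro ext)
  fix h k assume m: "is_hecke_mult L m"
  have lin1: "hlin (\<lambda>h. m h k)" and lin2: "hlin (m h)" for h k
    using m by (simp_all add: is_hecke_mult_def hlin_def)
  have sT: "m (T (sg s)) (T w) = lmul s (T w)" for s w
  proof -
    have "len w < len (sg s * w) \<or> len (sg s * w) < len w"
      using len_sg_mult[of s w] by linarith
    moreover have "sg s \<in> S"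
      by (simp add: S_eq)
    ultimately show ?thesis
      using m unfolding is_hecke_mult_def by (auto simp: lmul_up lmul_down xi_def)
  qed
  have s: "m (T (sg s)) k = lmul s k" for s k
    by (rule hlin_eqI) (simp_all add: lin2 sT)
  have "m (T (word xs)) k = lmulw xs k" if "len (word xs) = length xs" for xs
    using that
  proof (induction xs)
    case Nil
    then show ?case
      using m by (simp add: word_Nil is_hecke_mult_def)
  next
    case (Cons x xs)
    have l: "len (word xs) = length xs"
      using Cons.prems len_word_le[of xs] len_sg_mult[of x "word xs"] by (auto simp: word_Cons)
    then have "T (word (x # xs)) = m (T (sg x)) (T (word xs))"
      using Cons.prems by (simp add: s lmul_up word_Cons)
    moreover have "m (m (T (sg x)) (T (word xs))) k = m (T (sg x)) (m (T (word xs)) k)"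
      using m by (simp add: is_hecke_mult_def)
    ultimately show ?case
      using Cons.IH l by (simp add: s)
  qed
  note * = this
  have T: "m (T w) k = hmul (T w) k" for w
    using *[of "red w"] by (simp only: red hmul_T)
  have "hlin (\<lambda>h. hmul h k)"
    by (simp add: hlin_def hmul_left_add hmul_left_scale)
  then show "m h k = hmul h k"
    using T by (rule hlin_eqI[OF lin1])
qed

lemma hecke_algebra_mult: "mult (hecke_algebra L) = hmul"
proof -
  have "(THE m. is_hecke_mult L m) = hmul"
    by (rule the_equality) (fact is_hecke_mult_hmul is_hecke_mult_unique)+
  then show ?thesis
    by (simp add: hecke_algebra_def)
qed

subsection \<open>The bar involution\<close>

lemma xi_lmul: "lmul s (lmul s h) = h + scale (xi s) (lmul s h)"
proof (rule hlin_eqI[of "\<lambda>h. lmul s (lmul s h)" "\<lambda>h. h + scale (xi s) (lmul s h)"])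
  show "lmul s (lmul s (T w)) = T w + scale (xi s) (lmul s (T w))" for w
    using len_sg_mult[of s w]
    by (cases "len w < len (sg s * w)") (auto simp: lmul_up lmul_down lmul_lin scale_add)
qed (simp_all add: hlin_comp hlin_plus hlin_smult)

definition linv :: "gen \<Rightarrow> hecke \<Rightarrow> hecke" where
  "linv s h = lmul s h - scale (xi s) h"

lemma rlin_linv [simp]: "rlin (linv s)"
proof -
  have "hlin (linv s)"
    unfolding linv_def hlin_def by (simp add: lmul_lin scale_add scale_sub algebra_simps)
  moreover have "linv s (rmul t h) = rmul t (linv s h)" for t h
    by (simp add: linv_def lmul_rmul hlin_diff[OF hlin_rmul] rmul_lin)
  ultimately show ?thesis
    by (simp add: rlin_def)
qed

lemmas hlin_linv [simp] = rlin_hlin[OF rlin_linv]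

lemma lmul_linv [simp]: "lmul s (linv s h) = h"
  by (simp add: linv_def hlin_diff[OF hlin_lmul] lmul_lin xi_lmul)

lemma linv_lmul [simp]: "linv s (lmul s h) = h"
  by (simp add: linv_def xi_lmul)

abbreviation tinv :: "W \<Rightarrow> hecke" where
  "tinv w \<equiv> inv\<^bsub>hecke_algebra L\<^esub> (T w)"

lemma tinv_eqI: "hmul (T w) y = T 1 \<Longrightarrow> hmul y (T w) = T 1 \<Longrightarrow> tinv w = y"
proof -
  assume y: "hmul (T w) y = T 1" "hmul y (T w) = T 1"
  have one: "\<one>\<^bsub>hecke_algebra L\<^esub> = T 1" "carrier (hecke_algebra L) = UNIV"
    by (simp_all add: hecke_algebra_def)
  show ?thesis
    unfolding m_inv_def hecke_algebra_mult one
    by (rule the_equality) (use y in \<open>simp_all, metis hmul_assoc hmul_one_left hmul_one_right\<close>)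
qed

lemma T_invertible: "\<exists>y. hmul (T w) y = T 1 \<and> hmul y (T w) = T 1"
proof (induction "len w" arbitrary: w rule: less_induct)
  case less
  show ?case
  proof (cases "w = 1")
    case False
    then obtain s where s: "len (sg s * w) < len w"
      using exists_descent by blast
    obtain y where y: "hmul (T (sg s * w)) y = T 1" "hmul y (T (sg s * w)) = T 1"
      using less s by blast
    have T: "T w = hmul (T (sg s)) (T (sg s * w))"
      using lmul_up[of "sg s * w" s] s by (simp flip: lmul_eq)
    have ls: "linv s k = hmul (linv s (T 1)) k" for k
      by (rule rlin_hmul_eq) simp
    have "hmul (T w) (hmul y (linv s (T 1))) = T 1"
    proof -
      have "hmul (T (sg s * w)) (hmul y (linv s (T 1))) = linv s (T 1)"
        using y(1) by (simp flip: hmul_assoc)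
      then have "lmul s (hmul (T (sg s * w)) (hmul y (linv s (T 1)))) = T 1"
        by simp
      then show ?thesis
        by (simp only: T hmul_assoc lmul_eq)
    qed
    moreover have "hmul (hmul y (linv s (T 1))) (T w) = T 1"
    proof -
      have "hmul (linv s (T 1)) (T w) = T (sg s * w)"
        unfolding T by (simp flip: ls lmul_eq)
      then show ?thesis
        using y(2) by (simp add: hmul_assoc)
    qed
    ultimately show ?thesis
      by blast
  qed (use hmul_one_left in blast)
qed

lemma T_tinv [simp]: "hmul (T w) (tinv w) = T 1" "hmul (tinv w) (T w) = T 1"
  using T_invertible[of w] tinv_eqI by auto

lemma tinv_one [simp]: "tinv 1 = T 1"
  by (rule tinv_eqI) simp_all

definition tb :: "W \<Rightarrow> hecke" where
  "tb w = tinv (inverse w)"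

lemma tb_one [simp]: "tb 1 = T 1"
  by (simp add: tb_def)

lemma tb_up: "len w < len (sg s * w) \<Longrightarrow> tb (sg s * w) = linv s (tb w)"
proof -
  assume s: "len w < len (sg s * w)"
  have ls: "linv s k = hmul (linv s (T 1)) k" for k
    by (rule rlin_hmul_eq) simp
  have "hmul (T (inverse w)) (T (sg s)) = T (inverse w * sg s)"
  proof -
    have "len (inverse w) < len (inverse w * sg s)"
      using s len_inverse[of "sg s * w"] by (simp add: W_inverse_mult)
    then have "T (inverse w * sg s) = rmul s (T (inverse w))"
      by (simp add: rmul_up)
    also have "\<dots> = hmul (T (inverse w)) (rmul s (T 1))"
      using rlin_hmul[of "T (inverse w)"] by (simp add: rlin_def)
    also have "rmul s (T 1) = T (sg s)"
      using rmul_up[of 1 s] by simp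
    finally show ?thesis ..
  qed
  then have T: "T (inverse w * sg s) = hmul (T (inverse w)) (T (sg s))"
    by simp
  have "tinv (inverse w * sg s) = linv s (tinv (inverse w))"
  proof (rule tinv_eqI)
    show "hmul (T (inverse w * sg s)) (linv s (tinv (inverse w))) = T 1"
      unfolding T hmul_assoc by (simp flip: lmul_eq)
    have "hmul (linv s (tinv (inverse w))) (T (inverse w * sg s)) =
        hmul (linv s (T 1)) (hmul (hmul (tinv (inverse w)) (T (inverse w))) (T (sg s)))"
      by (subst ls) (simp only: T hmul_assoc)
    also have "\<dots> = linv s (lmul s (T 1))"
      by (simp add: lmul_eq flip: ls)
    finally show "hmul (linv s (tinv (inverse w))) (T (inverse w * sg s)) = T 1"
      by simp
  qed
  then show ?thesis
    by (simp add: tb_def W_inverse_mult)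
qed

lemma hbar_eq: "hbar L h = (\<Sum>w\<in>keys h. scale (lbar (cf h w)) (tb w))"
  by (simp add: hbar_def tb_def)

lemma hbar_superset:
  "finite A \<Longrightarrow> keys h \<subseteq> A \<Longrightarrow> hbar L h = (\<Sum>w\<in>A. scale (lbar (cf h w)) (tb w))"
  unfolding hbar_eq by (rule sum.mono_neutral_left) (auto simp: in_keys_iff)

lemma hbar_add: "hbar L (h + k) = hbar L h + hbar L k"
proof -
  let ?A = "keys h \<union> keys k"
  have "keys (h + k) \<subseteq> ?A"
    by (rule keys_add)
  then show ?thesis
    by (simp add: hbar_superset[of ?A] lookup_add lbar_add scale_add_left sum.distrib)
qed

lemma hbar_scale: "hbar L (scale a h) = scale (lbar a) (hbar L h)"
proof -
  have "keys (scale a h) \<subseteq> keys h"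
    by (auto simp: in_keys_iff)
  then show ?thesis
    by (simp add: hbar_superset[of "keys h"] scale_sum lbar_mult)
qed

lemma hbar_zero [simp]: "hbar L 0 = 0"
  by (simp add: hbar_eq)

lemma hbar_diff: "hbar L (h - k) = hbar L h - hbar L k"
  by (metis add_diff_cancel diff_add_cancel hbar_add)

lemma hbar_sum: "hbar L (sum f A) = (\<Sum>x\<in>A. hbar L (f x))"
  by (induction A rule: infinite_finite_induct) (simp_all add: hbar_add)

lemma hbar_T [simp]: "hbar L (T w) = tb w"
  by (simp add: hbar_superset[of "{w}"] T_def)

lemma lbar_xi: "lbar (xi s) = - xi s"
  by (simp add: xi_def lbar_diff)

lemma hbar_lmul_T: "hbar L (lmul s (T w)) = linv s (tb w)"
proof (cases "len w < len (sg s * w)")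
  case True
  then show ?thesis
    by (simp add: lmul_up tb_up)
next
  case False
  then have s: "len (sg s * w) < len w"
    using len_sg_mult[of s w] by linarith
  then have w: "tb w = linv s (tb (sg s * w))"
    using tb_up[of "sg s * w" s] by simp
  then have "tb (sg s * w) = lmul s (tb w)"
    by simp
  then show ?thesis
    using s by (simp add: lmul_down hbar_add hbar_scale lbar_xi linv_def scale_minus_left)
qed

lemma hbar_lmul: "hbar L (lmul s h) = linv s (hbar L h)"
proof -
  have "hbar L (lmul s h) = hbar L (\<Sum>w\<in>keys h. scale (cf h w) (lmul s (T w)))"
    by (subst hecke_expand[of h]) (simp only: hlin_sum[OF hlin_lmul] lmul_lin)
  also have "\<dots> = linv s (hbar L h)"
    by (simp add: hbar_sum hbar_scale hbar_lmul_T hbar_eq[of h] hlin_sum[OF hlin_linv]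
        hlin_scale[OF hlin_linv])
  finally show ?thesis .
qed

text \<open>Left multiplication by the Kazhdan-Lusztig element of \<open>s\<close>, which is
  \<open>T (sg s)\<close> plus \<open>vpow (- L (sg s))\<close> times the unit.\<close>

definition cmul :: "gen \<Rightarrow> hecke \<Rightarrow> hecke" where
  "cmul s h = lmul s h + scale (vpow (- L (sg s))) h"

lemma hlin_cmul [simp]: "hlin (cmul s)"
  by (simp add: cmul_def[abs_def] hlin_plus hlin_smult)

lemma hbar_cmul: "hbar L (cmul s h) = cmul s (hbar L h)"
  by (simp add: cmul_def hbar_add hbar_scale hbar_lmul linv_def xi_def scale_diff_left)

lemma cf_lmul: "cf (lmul s h) x = cf h (sg s * x) + (if len (sg s * x) < len x then xi s * cf h x else 0)"
proof -
  have "cf (lmul s (T w)) x = cf (T w) (sg s * x) +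
      (if len (sg s * x) < len x then xi s * cf (T w) x else 0)" for w
    using len_sg_mult[of s w]
    by (cases "len w < len (sg s * w)") (auto simp: lmul_up lmul_down lookup_add lookup_T)
  then have T: "cf (lmul s (T w)) x = cf (T w) (sg s * x) +
      (if len (sg s * x) < len x then xi s else 0) * cf (T w) x" for w
    by (simp add: mult.commute)
  have e: "(\<Sum>w\<in>keys h. cf h w * cf (T w) y) = cf h y" for y
    using arg_cong[OF hecke_expand[of h], of "\<lambda>k. cf k y"] by (simp add: lookup_sum)
  have "cf (lmul s h) x = (\<Sum>w\<in>keys h. cf h w * cf (lmul s (T w)) x)"
    using hlin_expand[OF hlin_lmul, of s h] by (simp add: lext_def lookup_sum)
  also have "\<dots> = (\<Sum>w\<in>keys h. cf h w * cf (T w) (sg s * x)) +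
      (if len (sg s * x) < len x then xi s else 0) * (\<Sum>w\<in>keys h. cf h w * cf (T w) x)"
    by (simp add: T sum.distrib distrib_left sum_distrib_left mult.left_commute)
  also have "\<dots> = cf h (sg s * x) + (if len (sg s * x) < len x then xi s else 0) * cf h x"
    by (simp only: e)
  finally show ?thesis
    by simp
qed

subsection \<open>The Kazhdan-Lusztig basis\<close>

lemma cf_linv: "cf (linv s h) x = cf h (sg s * x) - (if len x < len (sg s * x) then xi s * cf h x else 0)"
proof -
  have "(len (sg s * x) < len x) = (\<not> len x < len (sg s * x))"
    using len_sg_mult[of s x] by linarith
  then show ?thesis
    by (simp add: linv_def lookup_minus cf_lmul)
qed

text \<open>Triangularity with respect to length is weaker than with respect to the Bruhat order,
  but it suffices for the uniqueness argument.\<close>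

lemma tb_unitriangular: "cf (tb w) w = 1 \<and> (\<forall>y. cf (tb w) y \<noteq> 0 \<longrightarrow> y = w \<or> len y < len w)"
proof (induction "len w" arbitrary: w rule: less_induct)
  case less
  show ?case
  proof (cases "w = 1")
    case False
    then obtain s where s: "len (sg s * w) < len w"
      using exists_descent by blast
    define v where "v = sg s * w"
    have v: "w = sg s * v" "len v < len w" "len w = Suc (len v)"
      using s len_sg_mult[of s w] by (auto simp: v_def)
    have tb: "tb w = linv s (tb v)"
      using tb_up[of v s] v by simp
    have IH: "cf (tb v) v = 1" "\<And>y. cf (tb v) y \<noteq> 0 \<Longrightarrow> y = v \<or> len y < len v"
      using less v(2) by blast+
    have "cf (tb w) w = 1"
    proof -
      have "cf (tb v) w = 0"
        using IH(2)[of w] v(2) by fastforce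
      then show ?thesis
        using IH(1) v(1,3) unfolding tb cf_linv by simp
    qed
    moreover have "y = w \<or> len y < len w" if y: "cf (tb w) y \<noteq> 0" for y
    proof -
      consider "cf (tb v) (sg s * y) \<noteq> 0" | "cf (tb v) y \<noteq> 0"
        using y unfolding tb cf_linv by (cases "cf (tb v) (sg s * y) = 0") (simp_all split: if_splits)
      then show ?thesis
      proof cases
        case 1
        then have "sg s * y = v \<or> len (sg s * y) < len v"
          by (rule IH(2))
        then show ?thesis
        proof
          assume "sg s * y = v"
          then have "y = w"
            by (simp add: v(1) flip: \<open>sg s * y = v\<close>)
          then show ?thesis ..
        next
          assume "len (sg s * y) < len v"
          then show ?thesis
            using v(3) len_sg_mult[of s y] by linarith
        qed
      next
        case 2
        then show ?thesis
          using IH(2)[of y] v(2) by auto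
      qed
    qed
    ultimately show ?thesis
      by blast
  qed (simp add: lookup_T)
qed

text \<open>At a longest element in the support of the difference, unitriangularity makes the
  coefficient bar-invariant. It also lies in \<open>vneg\<close>, so it vanishes.\<close>

lemma KL_element_unique:
  assumes C: "is_KL_element L w C" and C': "is_KL_element L w C'"
  shows "C = C'"
proof (rule ccontr)
  define D where "D = C - C'"
  assume "C \<noteq> C'"
  then have ne: "keys D \<noteq> {}"
    by (auto simp: D_def poly_mapping_eq_iff fun_eq_iff in_keys_iff lookup_minus)
  obtain x where x: "x \<in> keys D" "\<And>u. u \<in> keys D \<Longrightarrow> len u \<le> len x"
  proof -
    have "Max (len ` keys D) \<in> len ` keys D"
      using ne by (intro Max_in) auto
    then obtain x where "x \<in> keys D" "len x = Max (len ` keys D)"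
      by auto
    then show thesis
      using that by simp
  qed
  have "hbar L D = D"
    using C C' by (simp add: D_def hbar_diff is_KL_element_def)
  moreover have "cf (hbar L D) x = (\<Sum>u\<in>keys D. lbar (cf D u) * cf (tb u) x)"
    by (simp add: hbar_eq lookup_sum)
  moreover have "\<dots> = lbar (cf D x) * cf (tb x) x"
  proof -
    have "lbar (cf D u) * cf (tb u) x = 0" if "u \<in> keys D - {x}" for u
      using tb_unitriangular[of u] x(2)[of u] that by fastforce
    then have "(\<Sum>u\<in>keys D - {x}. lbar (cf D u) * cf (tb u) x) = 0"
      by (intro sum.neutral) blast
    then show ?thesis
      using x(1) by (simp add: sum.remove[of _ x])
  qed
  ultimately have bar: "lbar (cf D x) = cf D x"
    using tb_unitriangular[of x] by simp
  have "x \<noteq> w"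
    using x(1) C C' by (auto simp: in_keys_iff D_def lookup_minus is_KL_element_def)
  then have "cf C x \<in> vneg" "cf C' x \<in> vneg"
    using C C' unfolding is_KL_element_def by (auto simp: vneg_dle split: if_splits)
  then have "cf D x \<in> vneg"
    by (simp add: D_def lookup_minus vneg_dle dle_diff)
  then have "cf D x = 0"
    using bar bar_invariant_vneg by blast
  then show False
    using x(1) by (simp add: in_keys_iff)
qed

lemma KL_element_support: "is_KL_element L w C \<Longrightarrow> cf C y \<noteq> 0 \<Longrightarrow> bruhat_le y w"
  unfolding is_KL_element_def by (metis bruhat_refl)

text \<open>The bar-invariant part of each offending coefficient is removed by subtracting a
  multiple of a shorter Kazhdan-Lusztig element, working downwards in length. \<open>n\<close>
  counts the levels already treated; \<open>n = len w\<close> covers all elements.\<close>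

lemma KL_reduce:
  assumes IH: "\<And>y. len y < len w \<Longrightarrow> \<exists>C. is_KL_element L y C"
    and X: "hbar L X = X" "cf X w = 1" "\<And>y. cf X y \<noteq> 0 \<Longrightarrow> bruhat_le y w"
  shows "\<exists>X. hbar L X = X \<and> cf X w = 1 \<and> (\<forall>y. cf X y \<noteq> 0 \<longrightarrow> bruhat_le y w) \<and>
    (\<forall>y. y \<noteq> w \<longrightarrow> len w - n \<le> len y \<longrightarrow> cf X y \<in> vneg)"
proof (induction n)
  case 0
  have "cf X y \<in> vneg" if "y \<noteq> w" "len w \<le> len y" for y
  proof -
    have "cf X y = 0"
      using X(3)[of y] bruhat_len[of y w] that by fastforce
    then show ?thesis
      by (simp add: vneg_dle)
  qed
  then show ?case
    using X by auto
next
  case (Suc n)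
  then obtain X where X: "hbar L X = X" "cf X w = 1" "\<And>y. cf X y \<noteq> 0 \<Longrightarrow> bruhat_le y w"
    "\<And>y. y \<noteq> w \<Longrightarrow> len w - n \<le> len y \<Longrightarrow> cf X y \<in> vneg"
    by blast
  define m where "m = len w - Suc n"
  define Y where "Y = {y \<in> keys X. len y = m \<and> y \<noteq> w}"
  have fin: "finite Y"
    by (simp add: Y_def)
  have less: "bruhat_le y w" "len y < len w" if "y \<in> Y" for y
    using X(3)[of y] bruhat_len[of y w] that by (auto simp: Y_def in_keys_iff)
  have "\<forall>y. \<exists>\<mu>. lbar \<mu> = \<mu> \<and> cf X y - \<mu> \<in> vneg"
    using bar_invariant_part by blast
  then obtain \<mu> where \<mu>: "\<And>y. lbar (\<mu> y) = \<mu> y" "\<And>y. cf X y - \<mu> y \<in> vneg"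
    by metis
  obtain C where C: "\<And>y. y \<in> Y \<Longrightarrow> is_KL_element L y (C y)"
    using IH less by metis
  define X' where "X' = X - (\<Sum>y\<in>Y. scale (\<mu> y) (C y))"
  have cfX': "cf X' x = cf X x - (\<Sum>y\<in>Y. \<mu> y * cf (C y) x)" for x
    by (simp add: X'_def lookup_minus lookup_sum)
  have C0: "cf (C y) x = 0" if "y \<in> Y" "m \<le> len x" "x \<noteq> y" for x y
    using KL_element_support[OF C[OF that(1)], of x] bruhat_len[of x y] that by (auto simp: Y_def)
  have "hbar L X' = X'"
  proof -
    have "hbar L (\<Sum>y\<in>Y. scale (\<mu> y) (C y)) = (\<Sum>y\<in>Y. scale (\<mu> y) (C y))"
      unfolding hbar_sum hbar_scale \<mu>(1) using C by (intro sum.cong) (simp_all add: is_KL_element_def)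
    then show ?thesis
      by (simp only: X'_def hbar_diff X(1))
  qed
  moreover have "cf X' w = 1"
  proof -
    have "(\<Sum>y\<in>Y. \<mu> y * cf (C y) w) = 0"
      using C0[of _ w] less by (intro sum.neutral) (auto simp: m_def Y_def)
    then show ?thesis
      by (simp add: cfX' X(2))
  qed
  moreover have "bruhat_le x w" if "cf X' x \<noteq> 0" for x
  proof (cases "cf X x = 0")
    case True
    then have "(\<Sum>y\<in>Y. \<mu> y * cf (C y) x) \<noteq> 0"
      using that by (simp add: cfX')
    then obtain y where "y \<in> Y" "\<mu> y * cf (C y) x \<noteq> 0"
      by (meson sum.neutral)
    then show ?thesis
      using KL_element_support[OF C] less bruhat_trans by fastforce
  qed (use X(3) in blast)
  moreover have "cf X' x \<in> vneg" if "x \<noteq> w" "m \<le> len x" for x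
  proof (cases "x \<in> Y")
    case True
    have "(\<Sum>y\<in>Y. \<mu> y * cf (C y) x) = \<mu> x * cf (C x) x"
    proof -
      have "(\<Sum>y\<in>Y - {x}. \<mu> y * cf (C y) x) = 0"
        using C0[OF _ that(2)] by (intro sum.neutral) auto
      then show ?thesis
        using True fin by (simp add: sum.remove[of Y x])
    qed
    moreover have "cf (C x) x = 1"
      using C[OF True] by (simp add: is_KL_element_def)
    ultimately show ?thesis
      using \<mu>(2)[of x] by (simp add: cfX')
  next
    case False
    have "(\<Sum>y\<in>Y. \<mu> y * cf (C y) x) = 0"
      using False C0[OF _ that(2)] by (intro sum.neutral) auto
    then have eq: "cf X' x = cf X x"
      by (simp add: cfX')
    show ?thesis
    proof (cases "len x = m")
      case True
      then have "cf X x = 0"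
        using False that(1) by (auto simp: Y_def in_keys_iff)
      then show ?thesis
        by (simp add: eq vneg_dle)
    next
      case False
      then have "len w - n \<le> len x"
        using that(2) by (simp add: m_def)
      then show ?thesis
        using X(4) that(1) by (simp add: eq)
    qed
  qed
  ultimately show ?case
    unfolding m_def by blast
qed

lemma cf_cmul: "cf (cmul s h) x = cf h (sg s * x) +
    (if len (sg s * x) < len x then vpow (L (sg s)) else vpow (- L (sg s))) * cf h x"
  by (simp add: cmul_def lookup_add cf_lmul xi_def algebra_simps)

lemma KL_element_exists: "\<exists>C. is_KL_element L w C"
proof (induction "len w" arbitrary: w rule: less_induct)
  case less
  have "\<exists>X. hbar L X = X \<and> cf X w = 1 \<and> (\<forall>y. cf X y \<noteq> 0 \<longrightarrow> bruhat_le y w)"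
  proof (cases "w = 1")
    case True
    then show ?thesis
      by (intro exI[of _ "T 1"]) (simp add: lookup_T)
  next
    case False
    then obtain s where s: "len (sg s * w) < len w"
      using exists_descent by blast
    define v where "v = sg s * w"
    have v: "w = sg s * v" "len v < len w"
      using s by (simp_all add: v_def)
    obtain C where C: "is_KL_element L v C"
      using less v(2) by blast
    have "hbar L (cmul s C) = cmul s C"
      using C by (simp add: hbar_cmul is_KL_element_def)
    moreover have "cf C w = 0"
      using KL_element_support[OF C, of w] bruhat_len[of w v] v(2) by auto
    then have "cf (cmul s C) w = 1"
      using C v by (simp add: cf_cmul is_KL_element_def)
    moreover have "bruhat_le y w" if "cf (cmul s C) y \<noteq> 0" for y
    proof -
      have "cf C (sg s * y) \<noteq> 0 \<or> cf C y \<noteq> 0"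
        using that by (auto simp: cf_cmul)
      then show ?thesis
      proof
        assume "cf C (sg s * y) \<noteq> 0"
        then have "bruhat_le (sg s * y) v"
          by (rule KL_element_support[OF C])
        then show ?thesis
          using bruhat_lift[of "sg s * y" v s] v by simp
      next
        assume "cf C y \<noteq> 0"
        then have "bruhat_le y v"
          by (rule KL_element_support[OF C])
        then show ?thesis
          using bruhat_up[of v s] v bruhat_trans by metis
      qed
    qed
    ultimately show ?thesis
      by blast
  qed
  then obtain X where "hbar L X = X" "cf X w = 1" "\<And>y. cf X y \<noteq> 0 \<Longrightarrow> bruhat_le y w"
    by blast
  from KL_reduce[OF less this, of "len w"] obtain X where X: "hbar L X = X" "cf X w = 1"
    "\<And>y. cf X y \<noteq> 0 \<Longrightarrow> bruhat_le y w" "\<And>y. y \<noteq> w \<Longrightarrow> cf X y \<in> vneg"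
    by auto
  then show ?case
    unfolding is_KL_element_def by metis
qed

lemma KL: "is_KL_element L w (KL L w)"
  unfolding KL_def using KL_element_exists KL_element_unique by (metis theI)

lemma KL_self [simp]: "cf (KL L w) w = 1"
  using KL by (simp add: is_KL_element_def)

lemma KL_support: "cf (KL L w) y \<noteq> 0 \<Longrightarrow> y = w \<or> len y < len w"
  using KL_element_support[OF KL] bruhat_len by blast

lemma KL_vneg: "y \<noteq> w \<Longrightarrow> dle (- 1) (cf (KL L w) y)"
  using KL[of w] unfolding is_KL_element_def by (auto simp: vneg_dle split: if_splits)

lemma KL_sg: "KL L (sg s) = cmul s (T 1)"
proof (rule KL_element_unique[OF KL])
  have 1: "sg s \<noteq> 1"
    by (metis len_one len_sg zero_neq_one)
  have "sg s * y = 1 \<longleftrightarrow> y = sg s" for y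
    by (metis mult_1_right sg_sg sg_sg_left)
  then have c: "cf (cmul s (T 1)) y = (if y = sg s then 1 else if y = 1 then vpow (- L (sg s)) else 0)" for y
    using 1 by (auto simp: cf_cmul lookup_T)
  show "is_KL_element L (sg s) (cmul s (T 1))"
    unfolding is_KL_element_def
  proof (intro conjI allI impI)
    show "hbar L (cmul s (T 1)) = cmul s (T 1)"
      by (simp add: hbar_cmul)
    show "cf (cmul s (T 1)) (sg s) = 1"
      by (simp add: c)
  next
    fix y assume y: "y \<noteq> sg s"
    have "bruhat_le 1 (sg s)"
      using bruhat_up[of 1 s] by simp
    moreover have "vpow (- L (sg s)) \<in> vneg"
      using dle_mono[OF dle_vpow, of "- L (sg s)" "- 1"] L_sg_pos[of s] by (simp add: vneg_dle)
    ultimately show "if bruhat_le y (sg s) then cf (cmul s (T 1)) y \<in> vneg else cf (cmul s (T 1)) y = 0"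
      using y by (auto simp: c vneg_dle)
  qed
qed

text \<open>Sends the standard basis to the Kazhdan-Lusztig basis, so that an element of type
  \<open>hecke\<close> also serves as a family of Kazhdan-Lusztig coordinates. \<open>kc\<close> is
  the inverse map.\<close>

definition kl :: "hecke \<Rightarrow> hecke" where
  "kl = lext (KL L)"

lemma hlin_kl [simp]: "hlin kl"
  by (simp add: kl_def)

lemma cf_kl: "cf (kl c) x = (\<Sum>z\<in>keys c. cf c z * cf (KL L z) x)"
  by (simp add: kl_def lext_def lookup_sum)

lemma cf_kl_top:
  assumes "\<And>z. cf c z \<noteq> 0 \<Longrightarrow> len z \<le> len x"
  shows "cf (kl c) x = cf c x"
proof -
  have "cf c z * cf (KL L z) x = 0" if "z \<in> keys c - {x}" for z
    using assms[of z] KL_support[of z x] that by (auto simp: in_keys_iff)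
  then have "(\<Sum>z\<in>keys c. cf c z * cf (KL L z) x) =
      (\<Sum>z\<in>keys c \<inter> {x}. cf c z * cf (KL L z) x)"
    by (intro sum.mono_neutral_right) auto
  then show ?thesis
    by (cases "x \<in> keys c") (simp_all add: cf_kl in_keys_iff)
qed

lemma kl_inj: "kl c = kl d \<Longrightarrow> c = d"
proof -
  have 0: "e = 0" if "kl e = 0" for e
  proof (rule ccontr)
    assume "e \<noteq> 0"
    then have "keys e \<noteq> {}"
      by (auto simp: poly_mapping_eq_iff fun_eq_iff in_keys_iff)
    then have "Max (len ` keys e) \<in> len ` keys e"
      by (intro Max_in) auto
    then obtain x where x: "x \<in> keys e" "len x = Max (len ` keys e)"
      by auto
    have "cf (kl e) x = cf e x"
      using x(2) by (intro cf_kl_top) (auto simp: in_keys_iff)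
    then show False
      using that x(1) by (simp add: in_keys_iff)
  qed
  assume "kl c = kl d"
  then have "kl (c - d) = 0"
    by (simp add: hlin_diff)
  then show "c = d"
    using 0 by fastforce
qed

lemma T_in_kl: "\<exists>c. T w = kl c"
proof (induction "len w" arbitrary: w rule: less_induct)
  case less
  define D where "D = KL L w - T w"
  have D: "len u < len w" if "u \<in> keys D" for u
    using that KL_support[of w u] by (auto simp: D_def in_keys_iff lookup_minus lookup_T split: if_splits)
  obtain c where c: "\<And>u. u \<in> keys D \<Longrightarrow> T u = kl (c u)"
    using less D by metis
  have "D = kl (\<Sum>u\<in>keys D. scale (cf D u) (c u))"
    by (subst hecke_expand[of D]) (simp add: hlin_sum[OF hlin_kl] hlin_scale[OF hlin_kl] c)
  then have "T w = kl (T w - (\<Sum>u\<in>keys D. scale (cf D u) (c u)))"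
    by (simp add: hlin_diff[OF hlin_kl] D_def) (simp add: kl_def)
  then show ?case
    by blast
qed

definition kc :: "hecke \<Rightarrow> hecke" where
  "kc h = (SOME c. h = kl c)"

lemma kl_kc [simp]: "kl (kc h) = h"
proof -
  obtain c where c: "\<And>w. T w = kl (c w)"
    using T_in_kl by metis
  have "h = kl (\<Sum>w\<in>keys h. scale (cf h w) (c w))"
    by (subst hecke_expand[of h]) (simp add: hlin_sum[OF hlin_kl] hlin_scale[OF hlin_kl] c)
  then show ?thesis
    unfolding kc_def by (metis (mono_tags, lifting) someI_ex)
qed

lemma kc_kl [simp]: "kc (kl c) = c"
  by (rule kl_inj) simp

lemma hlin_kc [simp]: "hlin kc"
  unfolding hlin_def by (metis hlin_add[OF hlin_kl] hlin_scale[OF hlin_kl] kc_kl kl_kc)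

lemma kc_KL [simp]: "kc (KL L w) = T w"
  using kc_kl[of "T w"] by (simp add: kl_def)

subsection \<open>Left ideals and leading coefficients\<close>

lemma hmul_KL_sg: "KL L (sg s) \<otimes>\<^bsub>hecke_algebra L\<^esub> h = cmul s h"
proof -
  have "hmul (KL L (sg s)) h = hmul (lmul s (T 1)) h + scale (vpow (- L (sg s))) (hmul (T 1) h)"
    by (simp only: KL_sg cmul_def hmul_left_add hmul_left_scale)
  also have "\<dots> = cmul s h"
    using lmul_up[of 1 s] by (simp add: cmul_def lmul_eq)
  finally show ?thesis
    by (simp add: hecke_algebra_mult)
qed

lemma left_le_cmul:
  assumes "cf (kc (cmul s (KL L w))) y \<noteq> 0"
  shows "left_le L y w"
proof -
  have "sg s \<in> S"
    by (simp add: S_eq)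
  moreover have "KL L (sg s) \<otimes>\<^bsub>hecke_algebra L\<^esub> KL L w =
      (\<Sum>z\<in>keys (kc (cmul s (KL L w))). scale (cf (kc (cmul s (KL L w))) z) (KL L z))"
    using kl_kc[of "cmul s (KL L w)"] by (simp only: hmul_KL_sg kl_def lext_def)
  ultimately have "left_arrow L y w"
    unfolding left_arrow_def using assms by blast
  then show ?thesis
    by (simp add: left_le_def)
qed

lemma left_le_refl [simp]: "left_le L w w"
  by (simp add: left_le_def)

lemma left_le_trans: "left_le L x y \<Longrightarrow> left_le L y z \<Longrightarrow> left_le L x z"
  by (simp add: left_le_def)

text \<open>The span of the \<open>KL L z\<close> with \<open>left_le L z y\<close>. It is a left
  ideal, so whatever is obtained from \<open>KL L y\<close> by left multiplication only involves
  such \<open>z\<close>.\<close>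

definition lideal :: "W \<Rightarrow> hecke set" where
  "lideal y = {h. \<forall>z. cf (kc h) z \<noteq> 0 \<longrightarrow> left_le L z y}"

lemma lideal_KL: "KL L y \<in> lideal y"
  by (simp add: lideal_def lookup_T)

lemma lideal_add: "h \<in> lideal y \<Longrightarrow> k \<in> lideal y \<Longrightarrow> h + k \<in> lideal y"
  unfolding lideal_def mem_Collect_eq hlin_add[OF hlin_kc] lookup_add by (metis add_0)

lemma lideal_scale: "h \<in> lideal y \<Longrightarrow> scale a h \<in> lideal y"
  unfolding lideal_def mem_Collect_eq hlin_scale[OF hlin_kc] lookup_scale by (metis mult_zero_right)

lemma lideal_zero: "0 \<in> lideal y"
  unfolding lideal_def mem_Collect_eq hlin_zero[OF hlin_kc] by simp

lemma lideal_lmul: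
  assumes "h \<in> lideal y"
  shows "lmul s h \<in> lideal y"
proof -
  have "cmul s h \<in> lideal y"
    unfolding lideal_def
  proof (intro CollectI allI impI)
    fix x assume x: "cf (kc (cmul s h)) x \<noteq> 0"
    define m where "m = kc h"
    have "h = (\<Sum>z\<in>keys m. scale (cf m z) (KL L z))"
      using kl_kc[of h] by (simp only: kl_def lext_def m_def)
    then have "cmul s h = (\<Sum>z\<in>keys m. scale (cf m z) (cmul s (KL L z)))"
      by (simp only: hlin_sum[OF hlin_cmul] hlin_scale[OF hlin_cmul])
    then have "cf (kc (cmul s h)) x = (\<Sum>z\<in>keys m. cf m z * cf (kc (cmul s (KL L z))) x)"
      by (simp only: hlin_sum[OF hlin_kc] hlin_scale[OF hlin_kc] lookup_sum lookup_scale)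
    then obtain z where "cf m z * cf (kc (cmul s (KL L z))) x \<noteq> 0"
      using x by (metis (no_types, lifting) sum.neutral)
    then have "cf m z \<noteq> 0" "cf (kc (cmul s (KL L z))) x \<noteq> 0"
      by auto
    then show "left_le L x y"
      using assms left_le_cmul left_le_trans unfolding lideal_def m_def by blast
  qed
  then have "cmul s h + scale (- vpow (- L (sg s))) h \<in> lideal y"
    using assms by (intro lideal_add lideal_scale)
  then show ?thesis
    by (simp add: cmul_def scale_minus_left)
qed

lemma lideal_lmulw: "h \<in> lideal y \<Longrightarrow> lmulw xs h \<in> lideal y"
  by (induction xs) (simp_all add: lideal_lmul)

text \<open>No element longer than \<open>sg s * w\<close> occurs in the expansion of
  \<open>cmul s (KL L w)\<close>, so the coefficient 1 at \<open>T (sg s * w)\<close> is also the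
  Kazhdan-Lusztig coordinate there.\<close>

lemma left_le_up:
  assumes "len w < len (sg s * w)"
  shows "left_le L (sg s * w) w"
proof (rule left_le_cmul)
  define m where "m = kc (cmul s (KL L w))"
  have m: "kl m = cmul s (KL L w)"
    by (simp add: m_def)
  have supp: "len z \<le> len (sg s * w)" if z: "cf m z \<noteq> 0" for z
  proof -
    have "finite (len ` keys m)" "len ` keys m \<noteq> {}"
      using z by (auto simp: in_keys_iff)
    then have "Max (len ` keys m) \<in> len ` keys m"
      by (rule Max_in)
    then obtain x where x: "x \<in> keys m" "len x = Max (len ` keys m)"
      by auto
    then have max: "len u \<le> len x" if "cf m u \<noteq> 0" for u
      using that by (simp add: in_keys_iff)
    have "cf (cmul s (KL L w)) x \<noteq> 0"
      using cf_kl_top[of m x] max x(1) by (simp add: m in_keys_iff)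
    then have "cf (KL L w) (sg s * x) \<noteq> 0 \<or> cf (KL L w) x \<noteq> 0"
      unfolding cf_cmul by (metis add_0 mult_zero_right)
    then have "len x \<le> len (sg s * w)"
    proof
      assume "cf (KL L w) (sg s * x) \<noteq> 0"
      then have "sg s * x = w \<or> len (sg s * x) < len w"
        by (rule KL_support)
      then have "len (sg s * x) \<le> len w"
        by (elim disjE) simp_all
      then show ?thesis
        using assms len_sg_mult[of s x] by linarith
    next
      assume "cf (KL L w) x \<noteq> 0"
      then have "x = w \<or> len x < len w"
        by (rule KL_support)
      then show ?thesis
        using assms by (elim disjE) simp_all
    qed
    then show ?thesis
      using max[OF z] by linarith
  qed
  have "cf (KL L w) (sg s * w) = 0"
    using KL_support[of w "sg s * w"] assms by fastforce
  then have "cf (kl m) (sg s * w) = 1"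
    by (simp add: m cf_cmul)
  then show "cf (kc (cmul s (KL L w))) (sg s * w) \<noteq> 0"
    using cf_kl_top[of m "sg s * w"] supp unfolding m_def by (metis zero_neq_one)
qed

text \<open>The matrices of \<open>F\<close> with respect to the standard and the Kazhdan-Lusztig basis have the same
  coefficients in the highest possible degree \<open>K\<close>, because the base change is unitriangular modulo
  negative powers of \<open>v\<close>.\<close>

theorem leading_coeff_left_le:
  assumes F: "hlin F" "\<And>h y. h \<in> lideal y \<Longrightarrow> F h \<in> lideal y"
    and bound: "\<And>u x. n < len x \<Longrightarrow> dle K (cf (F (T u)) x)"
    and x: "n < len x" "coeff (cf (F (T y)) x) K \<noteq> 0"
  shows "left_le L x y"
proof -
  define h where "h = F (KL L y)"
  define D where "D = KL L y - T y"
  define m where "m = kc h"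
  have D: "dle (- 1) (cf D u)" for u
    by (cases "u = y") (simp_all add: D_def lookup_minus lookup_T KL_vneg)
  have "h = F (T y + D)"
    by (simp add: h_def D_def)
  also have "\<dots> = F (T y) + F D"
    by (rule hlin_add[OF F(1)])
  finally have h: "cf h z = cf (F (T y)) z + cf (F D) z" for z
    by (simp add: lookup_add)
  have FD: "dle (K - 1) (cf (F D) z)" if z: "n < len z" for z
  proof -
    have "F D = (\<Sum>u\<in>keys D. scale (cf D u) (F (T u)))"
      using hlin_expand[OF F(1), of D] by (simp only: lext_def)
    then have "cf (F D) z = (\<Sum>u\<in>keys D. cf D u * cf (F (T u)) z)"
      by (simp only: lookup_sum lookup_scale)
    moreover have "dle (- 1 + K) (cf D u * cf (F (T u)) z)" for u
      by (rule dle_mult[OF D bound[OF z]])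
    ultimately show ?thesis
      by (simp add: dle_sum)
  qed
  have h_dle: "dle K (cf h z)" if z: "n < len z" for z
    unfolding h using bound[OF z] dle_mono[OF FD[OF z]] by (intro dle_add) simp_all
  \<comment> \<open>Downward induction on the length of \<open>z\<close>: \<open>cf m z\<close> and
    \<open>cf h z\<close> differ by contributions of strictly longer \<open>u\<close>, and each of
    these loses a degree to \<open>KL_vneg\<close>. Only longer elements enter, so a bound above
    length \<open>n\<close> is enough.\<close>
  have top: "dle K (cf m z) \<and> coeff (cf m z) K = coeff (cf h z) K" if "n < len z" for z
    using that
  proof (induction "Max (len ` keys m) - len z" arbitrary: z rule: less_induct)
    case less
    have eq: "cf h z = (\<Sum>u\<in>keys m. cf m u * cf (KL L u) z)"
      using cf_kl[of m z] by (simp add: m_def)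
    define R where "R = (\<Sum>u\<in>keys m - {z}. cf m u * cf (KL L u) z)"
    have "(\<Sum>u\<in>keys m. cf m u * cf (KL L u) z) = cf m z + R"
      by (cases "z \<in> keys m") (simp_all add: R_def sum.remove in_keys_iff)
    then have hz: "cf h z = cf m z + R"
      by (simp only: eq)
    have "dle (K - 1) R"
      unfolding R_def
    proof (rule dle_sum)
      fix u assume u: "u \<in> keys m - {z}"
      show "dle (K - 1) (cf m u * cf (KL L u) z)"
      proof (cases "cf (KL L u) z = 0")
        case False
        then have zu: "len z < len u"
          using KL_support[of u z] u by blast
        have "len u \<le> Max (len ` keys m)"
          using u by simp
        then have "dle K (cf m u)"
          using less(1)[of u] less(2) zu by linarith
        moreover have "dle (- 1) (cf (KL L u) z)"
          using u by (intro KL_vneg) blast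
        ultimately show ?thesis
          using dle_mult[of K _ "- 1"] by fastforce
      qed simp
    qed
    moreover have "cf m z = cf h z - R"
      by (simp add: hz)
    ultimately show ?case
      using h_dle[OF less(2)] by (simp add: dle_diff dle_mono lookup_minus dle_coeff)
  qed
  have "coeff (cf h x) K = coeff (cf (F (T y)) x) K"
    using dle_coeff[OF FD[OF x(1)], of K] by (simp add: h lookup_add)
  then have "coeff (cf m x) K \<noteq> 0"
    using top[OF x(1)] x(2) by simp
  then have "cf m x \<noteq> 0"
    by (metis lookup_zero)
  moreover have "h \<in> lideal y"
    unfolding h_def by (rule F(2)[OF lideal_KL])
  ultimately show ?thesis
    by (simp add: lideal_def m_def)
qed

end

subsection \<open>Symbolic computation in the standard basis\<close>

text \<open>A triple \<open>(k, p, q)\<close> stands for the affine function \<open>k + p * P + q * Q\<close> of two integer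
  parameters \<open>P, Q \<ge> 0\<close>, where \<open>P\<close> may in addition have an upper bound. Group elements are
  represented by their coordinate vectors, and a monomial with exponent \<open>(i, j)\<close> is
  \<open>v ^ (i * L s1 + j * L s2)\<close>.\<close>

type_synonym aff = "int \<times> int \<times> int"
type_synonym pnt = "aff \<times> aff \<times> aff"
type_synonym mono = "(int \<times> int) \<times> int"
type_synonym trm = "pnt \<times> mono"

fun aff_add :: "aff \<Rightarrow> aff \<Rightarrow> aff" where
  "aff_add (k, p, q) (k', p', q') = (k + k', p + p', q + q')"

fun aff_scale :: "int \<Rightarrow> aff \<Rightarrow> aff" where
  "aff_scale n (k, p, q) = (n * k, n * p, n * q)"

fun aff_eval :: "int \<Rightarrow> int \<Rightarrow> aff \<Rightarrow> int" where
  "aff_eval P Q (k, p, q) = k + p * P + q * Q"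

fun pnt_eval :: "int \<Rightarrow> int \<Rightarrow> pnt \<Rightarrow> vec" where
  "pnt_eval P Q (x, y, z) = (aff_eval P Q x, aff_eval P Q y, aff_eval P Q z)"

fun fire_pnt :: "gen \<Rightarrow> pnt \<Rightarrow> pnt" where
  "fire_pnt G1 (x, y, z) = (aff_scale (- 1) x, aff_add y (aff_scale 3 x), z)"
| "fire_pnt G2 (x, y, z) = (aff_add x y, aff_scale (- 1) y, aff_add z y)"
| "fire_pnt G3 (x, y, z) = (x, aff_add y z, aff_scale (- 1) z)"

fun sval_pnt :: "gen \<Rightarrow> pnt \<Rightarrow> aff" where
  "sval_pnt G1 (x, y, z) = x" | "sval_pnt G2 (x, y, z) = y" | "sval_pnt G3 (x, y, z) = z"

lemma aff_eval_add: "aff_eval P Q (aff_add f g) = aff_eval P Q f + aff_eval P Q g"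
  by (cases f; cases g) (simp add: algebra_simps)

lemma aff_eval_scale: "aff_eval P Q (aff_scale n f) = n * aff_eval P Q f"
  by (cases f) (simp add: algebra_simps)

lemma pnt_eval_fire [simp]: "pnt_eval P Q (fire_pnt s x) = fire s (pnt_eval P Q x)"
  by (cases s; cases x) (simp_all add: aff_eval_add aff_eval_scale)

lemma aff_eval_sval_pnt [simp]: "aff_eval P Q (sval_pnt s x) = sval s (pnt_eval P Q x)"
  by (cases s; cases x) simp_all

fun in_box :: "int option \<Rightarrow> int \<Rightarrow> int \<Rightarrow> bool" where
  "in_box None P Q \<longleftrightarrow> 0 \<le> P \<and> 0 \<le> Q"
| "in_box (Some m) P Q \<longleftrightarrow> 0 \<le> P \<and> P \<le> m \<and> 0 \<le> Q"

text \<open>With \<open>P\<close> confined to an interval, positivity is tested at its two ends;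
  there the coefficient of \<open>P\<close> may be negative.\<close>

fun aff_pos :: "int option \<Rightarrow> aff \<Rightarrow> bool" where
  "aff_pos None (k, p, q) \<longleftrightarrow> 0 \<le> q \<and> 0 \<le> p \<and> 0 < k"
| "aff_pos (Some m) (k, p, q) \<longleftrightarrow> 0 \<le> q \<and> 0 < k \<and> 0 < k + p * m"

lemma aff_pos: "aff_pos b f \<Longrightarrow> in_box b P Q \<Longrightarrow> 0 < aff_eval P Q f"
proof (cases b)
  case None
  assume "aff_pos b f" "in_box b P Q"
  with None show ?thesis
    by (cases f) (simp add: add_pos_nonneg)
next
  case (Some m)
  assume a: "aff_pos b f" "in_box b P Q"
  obtain k p q where f: "f = (k, p, q)"
    by (cases f)
  have "0 < k + p * P"
  proof (cases "0 \<le> p")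
    case True
    then have "0 \<le> p * P"
      using a(2) Some by simp
    then show ?thesis
      using a(1) Some f by simp
  next
    case False
    then have "p * m \<le> p * P"
      using a(2) Some by (intro mult_left_mono_neg) simp_all
    then show ?thesis
      using a(1) Some f by simp
  qed
  moreover have "0 \<le> q * Q"
    using a Some f by simp
  ultimately show ?thesis
    by (simp add: f)
qed

definition aff_neg :: "int option \<Rightarrow> aff \<Rightarrow> bool" where
  "aff_neg b f \<longleftrightarrow> aff_pos b (aff_scale (- 1) f)"

lemma aff_neg: "aff_neg b f \<Longrightarrow> in_box b P Q \<Longrightarrow> aff_eval P Q f < 0"
  using aff_pos[of b "aff_scale (- 1) f" P Q] by (simp add: aff_neg_def aff_eval_scale)

fun exp_add :: "int \<times> int \<Rightarrow> int \<times> int \<Rightarrow> int \<times> int" where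
  "exp_add (i, j) (i', j') = (i + i', j + j')"

fun mono_mult :: "mono \<Rightarrow> mono \<Rightarrow> mono" where
  "mono_mult (e, c) (e', c') = (exp_add e e', c * c')"

fun gexp :: "gen \<Rightarrow> int \<times> int" where
  "gexp G1 = (1, 0)" | "gexp G2 = (0, 1)" | "gexp G3 = (0, 1)"

fun exp_neg :: "int \<times> int \<Rightarrow> int \<times> int" where
  "exp_neg (i, j) = (- i, - j)"

fun seq_opt :: "'a list option list \<Rightarrow> 'a list option" where
  "seq_opt [] = Some []"
| "seq_opt (None # xs) = None"
| "seq_opt (Some x # xs) = map_option ((@) x) (seq_opt xs)"

text \<open>Returns \<open>None\<close> unless the sign of the root is constant on the whole family.
  A successful computation is therefore valid for all parameter values.\<close>

fun step_trm :: "int option \<Rightarrow> gen \<Rightarrow> trm \<Rightarrow> trm list option" where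
  "step_trm b s (p, m) =
    (if aff_pos b (sval_pnt s p) then Some [(fire_pnt s p, m)]
     else if aff_neg b (sval_pnt s p) then
       Some [(fire_pnt s p, m), (p, mono_mult (gexp s, 1) m), (p, mono_mult (exp_neg (gexp s), - 1) m)]
     else None)"

definition lmul_trms :: "int option \<Rightarrow> gen \<Rightarrow> trm list \<Rightarrow> trm list option" where
  "lmul_trms b s ts = seq_opt (map (step_trm b s) ts)"

fun lmulw_trms :: "int option \<Rightarrow> gen list \<Rightarrow> trm list \<Rightarrow> trm list option" where
  "lmulw_trms b [] ts = Some ts"
| "lmulw_trms b (s # xs) ts = Option.bind (lmulw_trms b xs ts) (lmul_trms b s)"

definition scale_trms :: "mono \<Rightarrow> trm list \<Rightarrow> trm list" where
  "scale_trms m = map (apsnd (mono_mult m))"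

fun comb_trms :: "int option \<Rightarrow> (gen list \<times> mono) list \<Rightarrow> trm list \<Rightarrow> trm list option" where
  "comb_trms b us ts = seq_opt (map (\<lambda>(u, m). map_option (scale_trms m) (lmulw_trms b u ts)) us)"

fun ins_trm :: "trm \<Rightarrow> trm list \<Rightarrow> trm list" where
  "ins_trm t [] = [t]"
| "ins_trm (p, e, c) ((p', e', c') # ts) =
    (if p = p' \<and> e = e' then (p, e, c + c') # ts else (p', e', c') # ins_trm (p, e, c) ts)"

definition collect_trms :: "trm list \<Rightarrow> trm list" where
  "collect_trms ts = filter (\<lambda>(p, e, c). c \<noteq> 0) (foldr ins_trm ts [])"

text \<open>Moves a term to the minimal representative of its coset and multiplies by the value of
  the character for each descent removed. This preserves the image under the operator
  \<open>G\<close>, not the term itself. The number bounds the recursion.\<close>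

fun proj_trm :: "int option \<Rightarrow> gen list \<Rightarrow> (gen \<Rightarrow> mono) \<Rightarrow> nat \<Rightarrow> trm \<Rightarrow> trm list option" where
  "proj_trm b J ch 0 t = None"
| "proj_trm b J ch (Suc n) (p, m) =
    (case find (\<lambda>s. aff_neg b (sval_pnt s p)) J of
       Some s \<Rightarrow> proj_trm b J ch n (fire_pnt s p, mono_mult (ch s) m)
     | None \<Rightarrow> if list_all (\<lambda>s. aff_pos b (sval_pnt s p)) J then Some [(p, m)] else None)"

definition el :: "vec \<Rightarrow> W" where
  "el c = (THE w. cv w = c)"

lemma el_cv [simp]: "el (cv w) = w"
  unfolding el_def by (rule the_equality) (simp_all add: cv_inject)

definition points :: "int \<Rightarrow> int \<Rightarrow> trm list \<Rightarrow> bool" where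
  "points P Q ts \<longleftrightarrow> (\<forall>(p, m)\<in>set ts. \<exists>w. cv w = pnt_eval P Q p)"

lemma points_append [simp]: "points P Q (ts @ us) \<longleftrightarrow> points P Q ts \<and> points P Q us"
  and points_Nil [simp]: "points P Q []"
  and points_Cons [simp]: "points P Q ((p, m) # ts) \<longleftrightarrow> (\<exists>w. cv w = pnt_eval P Q p) \<and> points P Q ts"
  by (auto simp: points_def)

context weighted
begin

text \<open>The two sides of the braid relation of length three contain the generators 2 + 1 and 1 +
  2 times. The coordinates confirm that both words are reduced, so their weights can be
  compared.\<close>

lemma L_sg_23: "L (sg G2) = L (sg G3)"
proof -
  have b: "word [G2, G3, G2] = word [G3, G2, G3]"
    using braid[of G2 G3] by (simp add: eval_nat_numeral)
  have "len (sg G2 * w) = len (sg G2) + len w" if "len w < len (sg G2 * w)" for w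
    using that len_sg_mult[of G2 w] by (simp del: sg.simps)
  moreover have "len (sg G3 * w) = len (sg G3) + len w" if "len w < len (sg G3 * w)" for w
    using that len_sg_mult[of G3 w] by (simp del: sg.simps)
  moreover have "cv 1 = (1, 1, 1)"
    by (rule cv_one)
  ultimately have "L (word [G2, G3, G2]) = L (sg G2) + (L (sg G3) + (L (sg G2) + L 1))"
      "L (word [G3, G2, G3]) = L (sg G3) + (L (sg G2) + (L (sg G3) + L 1))"
    by (simp_all only: word_Cons word_Nil L_mult len_less_iff cv_sg fire.simps sval.simps)
  with b show ?thesis
    by simp
qed

fun wt :: "int \<times> int \<Rightarrow> int" where
  "wt (i, j) = i * L (sg G1) + j * L (sg G2)"

lemma wt_gexp: "wt (gexp s) = L (sg s)"
  using L_sg_23 by (cases s) (simp_all del: sg.simps)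

lemma wt_add: "wt (exp_add e e') = wt e + wt e'"
  by (cases e; cases e') (simp add: algebra_simps)

lemma wt_neg: "wt (exp_neg e) = - wt e"
  by (cases e) (simp add: algebra_simps)

fun lmono :: "mono \<Rightarrow> laurent" where
  "lmono (e, c) = Poly_Mapping.single (wt e) c"

lemma lmono_mult: "lmono (mono_mult m m') = lmono m * lmono m'"
  by (cases m; cases m') (simp add: mult_single wt_add)

lemma lmono_gexp: "lmono (gexp s, 1) + lmono (exp_neg (gexp s), - 1) = xi s"
  by (simp add: xi_def vpow_def wt_gexp wt_neg single_uminus)

fun trms :: "int \<Rightarrow> int \<Rightarrow> trm list \<Rightarrow> hecke" where
  "trms P Q [] = 0"
| "trms P Q ((p, m) # ts) = scale (lmono m) (T (el (pnt_eval P Q p))) + trms P Q ts"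

lemma trms_append: "trms P Q (ts @ us) = trms P Q ts + trms P Q us"
  by (induction ts) (auto simp: add.assoc)

lemma trms_scale: "trms P Q (scale_trms m ts) = scale (lmono m) (trms P Q ts)"
proof (induction ts)
  case (Cons t ts)
  then show ?case
    by (cases t) (simp add: scale_trms_def scale_add lmono_mult)
qed (simp add: scale_trms_def)

lemma points_scale [simp]: "points P Q (scale_trms m ts) = points P Q ts"
  by (induction ts) (auto simp: scale_trms_def)

lemma step_trm:
  assumes "step_trm b s (p, m) = Some us" "in_box b P Q" "cv w = pnt_eval P Q p"
  shows "trms P Q us = scale (lmono m) (lmul s (T w)) \<and> points P Q us"
proof -
  have el: "el (pnt_eval P Q p) = w" "el (fire s (pnt_eval P Q p)) = sg s * w"
    by (simp_all flip: assms(3) cv_sg)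
  have ex: "\<exists>u. cv u = fire s (pnt_eval P Q p)"
    by (rule exI[of _ "sg s * w"]) (simp add: assms(3))
  have sval: "sval s (cv w) = aff_eval P Q (sval_pnt s p)"
    by (simp add: assms(3))
  consider "aff_pos b (sval_pnt s p)" | "\<not> aff_pos b (sval_pnt s p)" "aff_neg b (sval_pnt s p)"
    using assms(1) by fastforce
  then show ?thesis
  proof cases
    case 1
    then have "lmul s (T w) = T (sg s * w)"
      by (intro lmul_up) (simp add: len_less_iff sval aff_pos[OF _ assms(2)] del: aff_eval_sval_pnt)
    then show ?thesis
      using 1 assms(1) ex by (auto simp: el)
  next
    case 2
    then have "lmul s (T w) = T (sg s * w) + scale (xi s) (T w)"
      by (intro lmul_down) (simp add: len_greater_iff sval aff_neg[OF _ assms(2)] del: aff_eval_sval_pnt)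
    moreover have "us = [(fire_pnt s p, m), (p, mono_mult (gexp s, 1) m), (p, mono_mult (exp_neg (gexp s), - 1) m)]"
      using 2 assms(1) by simp
    ultimately show ?thesis
      using ex assms(3) unfolding lmono_gexp[symmetric]
      by (auto simp: el lmono_mult scale_add scale_add_left mult.commute simp del: lmono.simps)
  qed
qed

lemma lmul_trms:
  assumes "lmul_trms b s ts = Some us" "in_box b P Q" "points P Q ts"
  shows "trms P Q us = lmul s (trms P Q ts) \<and> points P Q us"
  using assms(1,3) unfolding lmul_trms_def
proof (induction ts arbitrary: us)
  case (Cons t ts)
  obtain p m where t: "t = (p, m)"
    by (cases t)
  obtain w where w: "cv w = pnt_eval P Q p"
    using Cons.prems(2) by (auto simp: t)
  obtain u1 where u1: "step_trm b s (p, m) = Some u1"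
    using Cons.prems(1) by (cases "step_trm b s (p, m)") (simp_all add: t del: step_trm.simps)
  obtain u2 where u2: "seq_opt (map (step_trm b s) ts) = Some u2" "us = u1 @ u2"
    using Cons.prems(1) u1 by (auto simp: t simp del: step_trm.simps)
  have "trms P Q u2 = lmul s (trms P Q ts) \<and> points P Q u2"
    by (rule Cons.IH[OF u2(1)]) (use Cons.prems(2) in \<open>simp add: t\<close>)
  moreover have "el (pnt_eval P Q p) = w"
    by (simp flip: w)
  ultimately show ?case
    using step_trm[OF u1 assms(2) w]
    by (simp add: u2(2) t trms_append lmul_lin)
qed (simp add: hlin_zero)

lemma lmulw_trms:
  assumes "lmulw_trms b xs ts = Some us" "in_box b P Q" "points P Q ts"
  shows "trms P Q us = lmulw xs (trms P Q ts) \<and> points P Q us"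
  using assms(1)
proof (induction xs arbitrary: us)
  case (Cons s xs)
  then obtain vs where vs: "lmulw_trms b xs ts = Some vs" "lmul_trms b s vs = Some us"
    by (auto simp: bind_eq_Some_conv)
  then show ?case
    using lmul_trms[OF vs(2) assms(2)] Cons.IH[OF vs(1)] by simp
qed (use assms(3) in simp)

definition comb :: "(gen list \<times> mono) list \<Rightarrow> hecke \<Rightarrow> hecke" where
  "comb us h = (\<Sum>(u, m)\<leftarrow>us. scale (lmono m) (lmulw u h))"

lemma comb_Cons: "comb ((u, m) # us) h = scale (lmono m) (lmulw u h) + comb us h"
  and comb_Nil: "comb [] h = 0"
  by (simp_all add: comb_def)

lemma rlin_comb [simp]: "rlin (comb us)"
proof -
  have "hlin (comb us)"
  proof (induction us)
    case (Cons u us)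
    then show ?case
      by (cases u) (simp add: hlin_def comb_Cons hlin_add[OF hlin_lmulw] hlin_scale[OF hlin_lmulw]
          scale_add algebra_simps)
  qed (simp add: hlin_def comb_Nil)
  moreover have "comb us (rmul t h) = rmul t (comb us h)" for t h
  proof (induction us)
    case (Cons u us)
    have "lmulw xs (rmul t h) = rmul t (lmulw xs h)" for xs
      using rlin_lmulw[of xs] by (simp add: rlin_def)
    then show ?case
      by (cases u) (simp add: comb_Cons rmul_lin Cons)
  qed (simp add: comb_Nil hlin_zero)
  ultimately show ?thesis
    by (simp add: rlin_def)
qed

lemmas hlin_comb [simp] = rlin_hlin[OF rlin_comb]

lemma lideal_comb: "h \<in> lideal y \<Longrightarrow> comb us h \<in> lideal y"
proof (induction us)
  case (Cons u us)
  then show ?case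
    by (cases u) (simp add: comb_Cons lideal_add lideal_scale lideal_lmulw)
qed (simp add: comb_Nil lideal_zero)

lemma comb_trms:
  assumes "comb_trms b us ts = Some vs" "in_box b P Q" "points P Q ts"
  shows "trms P Q vs = comb us (trms P Q ts) \<and> points P Q vs"
  using assms(1)
proof (induction us arbitrary: vs)
  case (Cons um us)
  obtain u m where um: "um = (u, m)"
    by (cases um)
  obtain v1 where v1: "lmulw_trms b u ts = Some v1"
    using Cons.prems by (cases "lmulw_trms b u ts") (simp_all add: um)
  obtain v2 where v2: "comb_trms b us ts = Some v2" "vs = scale_trms m v1 @ v2"
    using Cons.prems v1 by (auto simp: um)
  show ?case
    using Cons.IH[OF v2(1)] lmulw_trms[OF v1 assms(2,3)]
    by (simp add: um v2(2) trms_append trms_scale comb_Cons)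
qed (simp add: comb_Nil)

lemma ins_trm: "trms P Q (ins_trm t ts) = trms P Q [t] + trms P Q ts"
proof (induction t ts rule: ins_trm.induct)
  case (2 p e c p' e' c' ts)
  then show ?case
    by (cases "p = p' \<and> e = e'")
      (auto simp: single_add scale_add_left algebra_simps)
qed simp

lemma trms_collect: "trms P Q (collect_trms ts) = trms P Q ts"
proof -
  have "trms P Q (filter (\<lambda>(p, e, c). c \<noteq> 0) us) = trms P Q us" for us
    by (induction us) auto
  moreover have "trms P Q (foldr ins_trm ts []) = trms P Q ts"
  proof (induction ts)
    case (Cons t ts)
    then show ?case
      by (cases t) (simp add: ins_trm)
  qed simp
  ultimately show ?thesis
    by (simp add: collect_trms_def)
qed

end

subsection \<open>Minimal coset representatives\<close>

lemma cv_word: "cv (word u * w) = actw u (cv w)"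
  by (induction u) (simp_all add: word_Nil word_Cons mult.assoc)

lemma cv_word_one: "cv (word u) = actw u (1, 1, 1)"
  using cv_word[of u 1] by (simp add: cv_one)

text \<open>A finite parabolic subgroup given by one reduced word for each element. All conditions
  can be checked by evaluation; \<open>ascent\<close> says that each word only increases lengths
  when applied to an element with no left descent in \<open>J\<close>.\<close>

locale parabolic =
  fixes J :: "gen list" and ws :: "gen list list"
  assumes Nil_ws: "[] \<in> set ws"
    and suffix: "s # u \<in> set ws \<Longrightarrow> s \<in> set J \<and> u \<in> set ws"
    and ascent: "s # u \<in> set ws \<Longrightarrow> (\<forall>t\<in>set J. 0 < sval t c) \<Longrightarrow> 0 < sval s (actw u c)"
    and closed: "s \<in> set J \<Longrightarrow> u \<in> set ws \<Longrightarrow> \<exists>u'\<in>set ws. actw (s # u) (1, 1, 1) = actw u' (1, 1, 1)"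
    and distinct_ws: "distinct (map (\<lambda>u. actw u (1, 1, 1)) ws)"
begin

text \<open>The minimal representatives of the cosets of the parabolic subgroup acting from the
  left.\<close>

definition dom :: "W \<Rightarrow> bool" where
  "dom w \<longleftrightarrow> (\<forall>s\<in>set J. 0 < sval s (cv w))"

lemma len_word_dom: "u \<in> set ws \<Longrightarrow> dom z \<Longrightarrow> len (word u * z) = length u + len z"
proof (induction u)
  case (Cons s u)
  have "0 < sval s (cv (word u * z))"
    using ascent[OF Cons.prems(1)] Cons.prems(2) by (simp add: cv_word dom_def)
  then have "len (word u * z) < len (sg s * (word u * z))"
    by (simp only: len_less_iff)
  then show ?case
    using Cons suffix[of s u] len_sg_mult[of s "word u * z"] by (simp add: word_Cons mult.assoc)
qed (simp add: word_Nil)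

lemma set_ws: "u \<in> set ws \<Longrightarrow> set u \<subseteq> set J"
proof (induction u)
  case (Cons s u)
  then show ?case
    using suffix[of s u] by simp
qed simp

lemma closed_word: "set v \<subseteq> set J \<Longrightarrow> u \<in> set ws \<Longrightarrow> \<exists>u'\<in>set ws. word v * word u = word u'"
proof (induction v)
  case (Cons s v)
  then obtain u1 where u1: "u1 \<in> set ws" "word v * word u = word u1"
    by auto
  obtain u2 where u2: "u2 \<in> set ws" "actw (s # u1) (1, 1, 1) = actw u2 (1, 1, 1)"
    using closed[OF _ u1(1), of s] Cons.prems(1) by auto
  have "word (s # u1) = word u2"
    using u2(2) by (simp only: cv_inject[symmetric] cv_word_one)
  then show ?case
    using u2(1) u1(2) by (auto simp: word_Cons mult.assoc)
qed (auto simp: word_Nil)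

lemma decompose: "\<exists>u\<in>set ws. \<exists>z. dom z \<and> w = word u * z"
proof (induction "len w" arbitrary: w rule: less_induct)
  case less
  show ?case
  proof (cases "dom w")
    case True
    then show ?thesis
      using Nil_ws by (intro bexI[of _ "[]"] exI[of _ w]) (simp_all add: word_Nil)
  next
    case False
    then obtain s where s: "s \<in> set J" "sval s (cv w) < 0"
      unfolding dom_def using sval_cv_nonzero by (metis linorder_neqE_linordered_idom)
    then obtain u z where u: "u \<in> set ws" "dom z" "sg s * w = word u * z"
      using less[of "sg s * w"] by (auto simp: len_greater_iff simp del: sg.simps)
    obtain u' where u': "u' \<in> set ws" "word [s] * word u = word u'"
      using closed_word[of "[s]" u] s(1) u(1) by auto
    have "w = sg s * (word u * z)"
      by (simp flip: u(3))
    also have "\<dots> = word u' * z"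
      by (simp add: word_Cons word_Nil mult.assoc flip: u'(2))
    finally show ?thesis
      using u' u(2) by blast
  qed
qed

text \<open>Write \<open>z'\<close> as an element \<open>r\<close> of the subgroup times
  \<open>z\<close>. If the word of \<open>r\<close> were nonempty, its first letter would be a
  descent of \<open>z'\<close>.\<close>

lemma decompose_unique:
  assumes "dom z" "dom z'" "u \<in> set ws" "u' \<in> set ws" "word u * z = word u' * z'"
  shows "z = z' \<and> u = u'"
proof -
  have inv: "word (rev v) * word v = 1" for v
    using word_eq_rev_append[of v] by (simp add: one_W_def W.abs_eq_iff flip: word_append)
  have "set (rev u') \<subseteq> set J"
    using set_ws[OF assms(4)] by simp
  then obtain r where r: "r \<in> set ws" "word (rev u') * word u = word r"
    using closed_word[OF _ assms(3)] by metis
  have "z' = word (rev u') * (word u' * z')"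
    by (simp add: inv flip: mult.assoc)
  also have "\<dots> = word r * z"
    by (simp add: assms(5)[symmetric] r(2)[symmetric] mult.assoc)
  finally have z': "z' = word r * z" .
  have "r = []"
  proof (cases r)
    case (Cons s v)
    then have "s \<in> set J" "0 < sval s (actw v (cv z))"
      using suffix[of s v] ascent[of s v "cv z"] r(1) assms(1) by (auto simp: dom_def)
    moreover have "cv z' = fire s (actw v (cv z))"
      by (simp add: z' cv_word Cons)
    ultimately show ?thesis
      using assms(2) by (auto simp: dom_def sval_fire)
  qed
  then have eq: "z = z'"
    by (simp add: z' word_Nil)
  then have "word u = word u'"
    using assms(5) by (simp add: W_right_cancel)
  then have "actw u (1, 1, 1) = actw u' (1, 1, 1)"
    by (simp only: cv_word_one[symmetric])
  then show ?thesis
    using distinct_ws eq assms(3,4) by (auto simp: distinct_map inj_on_def)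
qed

end

subsection \<open>Operators attached to a parabolic subgroup\<close>

fun chw :: "(gen \<Rightarrow> mono) \<Rightarrow> gen list \<Rightarrow> mono" where
  "chw ch [] = ((0, 0), 1)"
| "chw ch (s # u) = mono_mult (ch s) (chw ch u)"

text \<open>The sum of ch(u) T_u over the subgroup, a scalar multiple of the idempotent of the
  character. For the character \<open>T s\<close> to \<open>v ^ L s\<close> it is a power of
  \<open>v\<close> times the Kazhdan-Lusztig element of the longest element.\<close>

definition idem :: "gen list list \<Rightarrow> (gen \<Rightarrow> mono) \<Rightarrow> (gen list \<times> mono) list" where
  "idem ws ch = map (\<lambda>u. (u, chw ch u)) ws"

definition one_pnt :: pnt where
  "one_pnt = ((1, 0, 0), (1, 0, 0), (1, 0, 0))"

definition eigen_check :: "gen list list \<Rightarrow> (gen \<Rightarrow> mono) \<Rightarrow> gen \<Rightarrow> bool" where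
  "eigen_check ws ch s \<longleftrightarrow>
    (case comb_trms None (idem ws ch) [(one_pnt, ((0, 0), 1))] of None \<Rightarrow> False | Some g \<Rightarrow>
    (case Option.bind (lmul_trms None s [(one_pnt, ((0, 0), 1))]) (comb_trms None (idem ws ch)) of None \<Rightarrow> False | Some g' \<Rightarrow>
      collect_trms (g' @ scale_trms (mono_mult ((0, 0), - 1) (ch s)) g) = []))"

text \<open>The value of the operator at a family \<open>p\<close>, written as \<open>G\<close> of a
  combination of minimal representatives. The recursion bound 10 exceeds the seven calls that at
  most six descents require.\<close>

definition column :: "gen list \<Rightarrow> gen list list \<Rightarrow> (gen \<Rightarrow> mono) \<Rightarrow> (gen list \<times> mono) list \<Rightarrow> mono list \<Rightarrow>
    int option \<Rightarrow> pnt \<Rightarrow> trm list option" where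
  "column J ws ch xs gs b p =
    Option.bind (comb_trms b (idem ws ch) [(p, ((0, 0), 1))]) (\<lambda>g.
    Option.bind (comb_trms b xs g) (\<lambda>h.
    map_option collect_trms (seq_opt (map (proj_trm b J ch 10) (h @ map (Pair p) gs)))))"

text \<open>The componentwise bound by \<open>N\<close> is a degree bound for all positive weights
  simultaneously. The common sign \<open>\<sigma>\<close> at the top exponent prevents cancellation
  between symbolic terms that may denote the same element.\<close>

definition column_check :: "gen list \<Rightarrow> gen list list \<Rightarrow> (gen \<Rightarrow> mono) \<Rightarrow> (gen list \<times> mono) list \<Rightarrow> mono list \<Rightarrow>
    int \<times> int \<Rightarrow> int \<Rightarrow> int option \<times> pnt \<times> pnt list \<Rightarrow> bool" where
  "column_check J ws ch xs gs N \<sigma> = (\<lambda>(b, p, ts). case column J ws ch xs gs b p of None \<Rightarrow> False | Some us \<Rightarrow>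
     list_all (\<lambda>(q, e, c). fst e \<le> fst N \<and> snd e \<le> snd N \<and> (e = N \<longrightarrow> 0 < \<sigma> * c)) us \<and>
     list_all (\<lambda>t. list_ex (\<lambda>(q, e, c). q = t \<and> e = N) us) ts)"

context weighted
begin

lemma lmono_one [simp]: "lmono ((0, 0), 1) = 1"
  using vpow_0 by (simp add: vpow_def)

lemma cf_lmulw_support: "cf (lmulw xs h) x \<noteq> 0 \<Longrightarrow> \<exists>y. cf h y \<noteq> 0 \<and> len x \<le> len y + length xs"
proof (induction xs arbitrary: x)
  case (Cons s xs)
  have "cf (lmulw xs h) (sg s * x) \<noteq> 0 \<or> cf (lmulw xs h) x \<noteq> 0"
    using Cons.prems unfolding lmulw.simps cf_lmul by (metis add_0 mult_zero_right)
  then obtain x' where x': "cf (lmulw xs h) x' \<noteq> 0" "len x \<le> Suc (len x')"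
    using len_sg_mult[of s x] by (metis le_SucI le_refl less_or_eq_imp_le lessI)
  show ?case
    using Cons.IH[OF x'(1)] x'(2) by fastforce
qed auto

lemma cf_comb_support:
  assumes "cf (comb us h) x \<noteq> 0" "\<forall>(u, m)\<in>set us. length u \<le> n"
  shows "\<exists>y. cf h y \<noteq> 0 \<and> len x \<le> len y + n"
  using assms
proof (induction us)
  case (Cons um us)
  obtain u m where um: "um = (u, m)"
    by (cases um)
  show ?case
  proof (cases "cf (lmulw u h) x = 0")
    case True
    then have "cf (comb us h) x \<noteq> 0"
      using Cons.prems(1) by (simp add: um comb_Cons lookup_add)
    then show ?thesis
      using Cons.IH Cons.prems(2) by simp
  next
    case False
    have "length u \<le> n"
      using Cons.prems(2) by (simp add: um)
    then show ?thesis
      using cf_lmulw_support[OF False] by (meson add_left_mono le_trans)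
  qed
qed (simp add: comb_Nil)

end

text \<open>\<open>top\<close> bounds the degree of the character on the subgroup, and the bounds on
  word lengths limit how far the operator can spread the support.\<close>

locale parabolic_operator = weighted L + parabolic J ws
  for L J ws +
  fixes ch :: "gen \<Rightarrow> mono" and xs :: "(gen list \<times> mono) list" and gs :: "mono list"
    and N :: "int \<times> int" and \<sigma> top :: int
  assumes eigen: "s \<in> set J \<Longrightarrow> eigen_check ws ch s"
    and top: "u \<in> set ws \<Longrightarrow> wt (fst (chw ch u)) \<le> top"
    and length_ws: "u \<in> set ws \<Longrightarrow> length u \<le> 6"
    and length_xs: "(u, m) \<in> set xs \<Longrightarrow> length u \<le> 6"
begin

definition G :: "hecke \<Rightarrow> hecke" where
  "G = comb (idem ws ch)"

definition F :: "hecke \<Rightarrow> hecke" where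
  "F h = G (comb xs (G h) + scale (\<Sum>m\<leftarrow>gs. lmono m) h)"

lemma rlin_G [simp]: "rlin G"
  by (simp add: G_def)

lemmas hlin_G [simp] = rlin_hlin[OF rlin_G]

lemma hlin_F [simp]: "hlin F"
proof -
  have "hlin (\<lambda>h. comb xs (G h) + scale (\<Sum>m\<leftarrow>gs. lmono m) h)"
    by (intro hlin_plus hlin_smult hlin_comp[of "comb xs" G]) simp_all
  then have "hlin (\<lambda>h. G (comb xs (G h) + scale (\<Sum>m\<leftarrow>gs. lmono m) h))"
    by (rule hlin_comp[OF hlin_G])
  then show ?thesis
    by (simp only: F_def[abs_def])
qed

lemma lideal_F: "h \<in> lideal y \<Longrightarrow> F h \<in> lideal y"
  by (simp add: F_def G_def lideal_comb lideal_add lideal_scale)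

text \<open>Both sides commute with right multiplications, so it suffices to compare them at
  \<open>T 1\<close>; that comparison is the finite calculation of \<open>eigen_check\<close>, with
  both parameters set to 0.\<close>

lemma G_lmul:
  assumes "s \<in> set J"
  shows "G (lmul s h) = scale (lmono (ch s)) (G h)"
proof (rule rlin_eqI[of "\<lambda>h. G (lmul s h)" "\<lambda>h. scale (lmono (ch s)) (G h)"])
  let ?one = "[(one_pnt, ((0, 0), 1))] :: trm list"
  have one: "cv 1 = pnt_eval 0 0 one_pnt"
    by (simp add: one_pnt_def cv_one)
  have pts: "points 0 0 ?one"
    using one by (auto simp: points_def)
  have T1: "trms 0 0 ?one = T 1"
    by (simp flip: one del: lmono.simps)
  have box: "in_box None 0 0"
    by simp
  obtain g where g: "comb_trms None (idem ws ch) ?one = Some g"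
    using eigen[OF assms] by (auto simp: eigen_check_def split: option.splits)
  obtain l where l: "lmul_trms None s ?one = Some l"
    using eigen[OF assms] by (cases "lmul_trms None s ?one") (auto simp: eigen_check_def split: option.splits)
  obtain g' where g': "comb_trms None (idem ws ch) l = Some g'"
    "collect_trms (g' @ scale_trms (mono_mult ((0, 0), - 1) (ch s)) g) = []"
    using eigen[OF assms] g l by (auto simp: eigen_check_def split: option.splits)
  have l': "trms 0 0 l = lmul s (T 1)" "points 0 0 l"
    using lmul_trms[OF l box pts] by (simp_all only: T1)
  have "0 = trms 0 0 (g' @ scale_trms (mono_mult ((0, 0), - 1) (ch s)) g)"
    using trms_collect[of 0 0 "g' @ scale_trms (mono_mult ((0, 0), - 1) (ch s)) g"] g'(2) by simp
  also have "\<dots> = trms 0 0 g' + scale (lmono (mono_mult ((0, 0), - 1) (ch s))) (trms 0 0 g)"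
    by (simp only: trms_append trms_scale)
  also have "lmono (mono_mult ((0, 0), - 1) (ch s)) = - lmono (ch s)"
  proof -
    have "lmono ((0, 0), - 1) = - 1"
      using lmono_one by (simp add: single_uminus)
    then show ?thesis
      by (simp only: lmono_mult mult_minus1)
  qed
  also have "trms 0 0 g' = G (lmul s (T 1))"
    using comb_trms[OF g'(1) box l'(2)] by (simp only: l'(1) G_def)
  also have "trms 0 0 g = G (T 1)"
    using comb_trms[OF g box pts] by (simp only: T1 G_def)
  finally show "G (lmul s (T 1)) = scale (lmono (ch s)) (G (T 1))"
    by (simp add: scale_minus_left)
qed (simp_all add: rlin_comp rlin_smult)

lemma G_lmulw: "set u \<subseteq> set J \<Longrightarrow> G (lmulw u h) = scale (lmono (chw ch u)) (G h)"
proof (induction u)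
  case (Cons s u)
  then show ?case
    by (simp add: G_lmul lmono_mult del: lmono.simps)
qed (simp del: lmono.simps)

lemma lmulw_T_dom:
  assumes "u \<in> set ws" "dom z"
  shows "lmulw u (T z) = T (word u * z)"
  using assms(1)
proof (induction u)
  case (Cons s u)
  have u: "u \<in> set ws"
    using suffix[OF Cons.prems] by blast
  have "len (word u * z) < len (sg s * (word u * z))"
    using len_word_dom[OF u assms(2)] len_word_dom[OF Cons.prems assms(2)] by (simp add: word_Cons mult.assoc)
  then show ?case
    by (simp add: Cons.IH[OF u] lmul_up word_Cons mult.assoc)
qed (simp add: word_Nil)

text \<open>Reduces every column of the matrix of \<open>F\<close> to the column of a minimal
  representative, at the cost of a monomial.\<close>

lemma F_word:
  assumes "u \<in> set ws" "dom z"
  shows "F (T (word u * z)) = scale (lmono (chw ch u)) (F (T z))"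
proof -
  have "F (T (word u * z)) = F (lmulw u (T z))"
    by (simp only: lmulw_T_dom[OF assms])
  also have "\<dots> = scale (lmono (chw ch u)) (F (T z))"
    unfolding F_def hlin_add[OF hlin_G] hlin_scale[OF hlin_G] hlin_scale[OF hlin_comb] scale_add
      G_lmulw[OF set_ws[OF assms(1)]] scale_scale by (simp only: mult.commute)
  finally show ?thesis .
qed

lemma cf_G:
  assumes "dom z"
  shows "cf (G (T z)) x = (\<Sum>u\<leftarrow>ws. if word u * z = x then lmono (chw ch u) else 0)"
proof -
  have "set us \<subseteq> set ws \<Longrightarrow> cf (comb (idem us ch) (T z)) x =
      (\<Sum>u\<leftarrow>us. if word u * z = x then lmono (chw ch u) else 0)" for us
  proof (induction us)
    case (Cons u us)
    then show ?case
      by (simp add: idem_def comb_Cons lookup_add lmulw_T_dom[OF _ assms] lookup_T)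
  qed (simp add: idem_def comb_Nil)
  then show ?thesis
    by (simp add: G_def)
qed

lemma dle_lmono: "dle (wt (fst m)) (lmono m)"
  by (cases m) (auto simp: dle_def lookup_single when_def)

lemma dle_cf_G:
  assumes "dom z"
  shows "dle top (cf (G (T z)) x)"
proof -
  have "set us \<subseteq> set ws \<Longrightarrow> dle top (\<Sum>u\<leftarrow>us. if word u * z = x then lmono (chw ch u) else 0)" for us
  proof (induction us)
    case (Cons u us)
    then have "dle top (lmono (chw ch u))"
      using dle_mono[OF dle_lmono top[of u]] by simp
    then show ?case
      using Cons by (simp add: dle_add)
  qed simp
  then show ?thesis
    by (simp add: cf_G[OF assms])
qed

lemma cf_G_dom:
  assumes "dom z" "dom z'" "u \<in> set ws"
  shows "cf (G (T z')) (word u * z) = (if z' = z then lmono (chw ch u) else 0)"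
proof -
  have *: "word u' * z' = word u * z \<longleftrightarrow> z' = z \<and> u' = u" if "u' \<in> set ws" for u'
    using decompose_unique[OF assms(2,1) that assms(3)] by blast
  have "(\<Sum>u'\<leftarrow>ws. if word u' * z' = word u * z then lmono (chw ch u') else 0) =
      (\<Sum>u'\<leftarrow>ws. if z' = z \<and> u' = u then lmono (chw ch u') else 0)"
    by (rule arg_cong[where f = sum_list], rule map_cong) (simp_all add: *)
  also have "\<dots> = (if z' = z then lmono (chw ch u) else 0)"
  proof -
    have "distinct ws"
      using distinct_ws by (simp add: distinct_map)
    then have "(\<Sum>u'\<leftarrow>ws. if z' = z \<and> u' = u then lmono (chw ch u') else 0) =
        (\<Sum>u'\<in>set ws. if z' = z \<and> u' = u then lmono (chw ch u') else 0)"
      by (rule sum_list_distinct_conv_sum_set)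
    also have "\<dots> = (\<Sum>u'\<in>set ws. if u' = u then (if z' = z then lmono (chw ch u') else 0) else 0)"
      by (rule sum.cong) auto
    finally show ?thesis
      using assms(3) by (simp add: sum.delta)
  qed
  finally show ?thesis
    by (simp add: cf_G[OF assms(2)])
qed

lemma proj_trm:
  assumes "proj_trm b J ch n (p, m) = Some us" "in_box b P Q" "cv w = pnt_eval P Q p"
  shows "G (trms P Q us) = G (scale (lmono m) (T w)) \<and> points P Q us \<and> (\<forall>(q, k)\<in>set us. dom (el (pnt_eval P Q q)))"
  using assms(1,3)
proof (induction n arbitrary: p m w)
  case (Suc n)
  have el: "el (pnt_eval P Q p) = w"
    by (simp flip: Suc.prems(2))
  show ?case
  proof (cases "find (\<lambda>s. aff_neg b (sval_pnt s p)) J")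
    case None
    then have all: "list_all (\<lambda>s. aff_pos b (sval_pnt s p)) J" and us: "us = [(p, m)]"
      using Suc.prems(1) by (auto split: if_splits)
    have "dom w"
      unfolding dom_def
    proof
      fix s assume "s \<in> set J"
      then have "aff_pos b (sval_pnt s p)"
        using all by (simp add: list_all_iff)
      from aff_pos[OF this assms(2)] show "0 < sval s (cv w)"
        by (simp add: Suc.prems(2))
    qed
    moreover have "\<exists>u. cv u = pnt_eval P Q p"
      using Suc.prems(2) by blast
    ultimately show ?thesis
      by (simp add: us el)
  next
    case (Some s)
    then have s: "s \<in> set J" "aff_neg b (sval_pnt s p)"
      by (auto simp: find_Some_iff)
    have rec: "proj_trm b J ch n (fire_pnt s p, mono_mult (ch s) m) = Some us"
      using Suc.prems(1) Some by simp
    have cv: "cv (sg s * w) = pnt_eval P Q (fire_pnt s p)"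
      by (simp add: Suc.prems(2))
    have "sval s (cv w) < 0"
      using aff_neg[OF s(2) assms(2)] by (simp add: Suc.prems(2))
    then have "len (sg s * w) < len (sg s * (sg s * w))"
      by (simp add: len_greater_iff)
    then have "T w = lmul s (T (sg s * w))"
      using lmul_up[of "sg s * w" s] by simp
    then have "G (T w) = scale (lmono (ch s)) (G (T (sg s * w)))"
      by (simp only: G_lmul[OF s(1)])
    then have "G (scale (lmono m) (T w)) = G (scale (lmono (mono_mult (ch s) m)) (T (sg s * w)))"
      by (simp only: hlin_scale[OF hlin_G] lmono_mult scale_scale mult.commute)
    then show ?thesis
      using Suc.IH[OF rec cv] by simp
  qed
qed simp

lemma proj_trms:
  assumes "seq_opt (map (proj_trm b J ch n) ts) = Some us" "in_box b P Q" "points P Q ts"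
  shows "G (trms P Q us) = G (trms P Q ts) \<and> points P Q us \<and> (\<forall>(q, k)\<in>set us. dom (el (pnt_eval P Q q)))"
  using assms(1,3)
proof (induction ts arbitrary: us)
  case (Cons t ts)
  obtain p m where t: "t = (p, m)"
    by (cases t)
  obtain w where w: "cv w = pnt_eval P Q p"
    using Cons.prems(2) by (auto simp: t)
  obtain u1 where u1: "proj_trm b J ch n (p, m) = Some u1"
    using Cons.prems(1) by (cases "proj_trm b J ch n (p, m)") (simp_all add: t)
  obtain u2 where u2: "seq_opt (map (proj_trm b J ch n) ts) = Some u2" "us = u1 @ u2"
    using Cons.prems(1) u1 by (auto simp: t)
  have "points P Q ts"
    using Cons.prems(2) by (simp add: t)
  moreover have "el (pnt_eval P Q p) = w"
    by (simp flip: w)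
  ultimately show ?case
    using Cons.IH[OF u2(1)] proj_trm[OF u1 assms(2) w]
    by (auto simp: u2(2) t trms_append hlin_add[OF hlin_G])
qed simp

lemma set_ins_trm: "fst ` set (ins_trm t ts) = insert (fst t) (fst ` set ts)"
  by (induction t ts rule: ins_trm.induct) auto

lemma set_collect_trms: "fst ` set (collect_trms ts) \<subseteq> fst ` set ts"
proof -
  have "fst ` set (foldr ins_trm ts []) = fst ` set ts"
    by (induction ts) (simp_all add: set_ins_trm)
  moreover have "fst ` set (collect_trms ts) \<subseteq> fst ` set (foldr ins_trm ts [])"
    unfolding collect_trms_def set_filter by (intro image_mono) blast
  ultimately show ?thesis
    by blast
qed

lemma column:
  assumes "column J ws ch xs gs b p = Some us" "in_box b P Q" "cv z = pnt_eval P Q p"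
  shows "F (T z) = G (trms P Q us) \<and> (\<forall>(q, k)\<in>set us. dom (el (pnt_eval P Q q)))"
proof -
  obtain g h r where g: "comb_trms b (idem ws ch) [(p, ((0, 0), 1))] = Some g"
    and h: "comb_trms b xs g = Some h"
    and r: "seq_opt (map (proj_trm b J ch 10) (h @ map (Pair p) gs)) = Some r"
    and us: "us = collect_trms r"
    using assms(1) by (auto simp: column_def bind_eq_Some_conv simp del: comb_trms.simps)
  have el: "el (pnt_eval P Q p) = z"
    by (simp flip: assms(3))
  have ex: "\<exists>w. cv w = pnt_eval P Q p"
    using assms(3) by blast
  have "points P Q [(p, ((0, 0), 1))]"
    using ex by simp
  from comb_trms[OF g assms(2) this] have g': "trms P Q g = G (T z)" "points P Q g"
    by (simp_all add: el G_def del: lmono.simps)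
  have h': "trms P Q h = comb xs (G (T z))" "points P Q h"
    using comb_trms[OF h assms(2) g'(2)] by (simp_all add: g'(1))
  have gs': "trms P Q (map (Pair p) ms) = scale (\<Sum>m\<leftarrow>ms. lmono m) (T z)" "points P Q (map (Pair p) ms)" for ms
    using ex by (induction ms) (simp_all add: el scale_add_left del: lmono.simps)
  have pts: "points P Q (h @ map (Pair p) gs)"
    using h'(2) gs'(2) by simp
  have "G (trms P Q r) = G (trms P Q (h @ map (Pair p) gs))" and dom: "\<forall>(q, k)\<in>set r. dom (el (pnt_eval P Q q))"
    using proj_trms[OF r assms(2) pts] by simp_all
  then have "G (trms P Q us) = F (T z)"
    by (simp only: us trms_collect trms_append h'(1) gs'(1) F_def)
  moreover have "\<forall>(q, k)\<in>set us. dom (el (pnt_eval P Q q))"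
  proof (clarify)
    fix q k assume "(q, k) \<in> set us"
    then have "q \<in> fst ` set us"
      by (rule image_eqI[rotated]) simp
    then have "q \<in> fst ` set r"
      using set_collect_trms[of r] unfolding us by (rule subsetD[rotated])
    then show "dom (el (pnt_eval P Q q))"
      using dom by auto
  qed
  ultimately show ?thesis
    by simp
qed

context
  fixes b p ts P Q z
  assumes check: "column_check J ws ch xs gs N \<sigma> (b, p, ts)"
    and box: "in_box b P Q" and cv: "cv z = pnt_eval P Q p"
begin

lemma column_terms:
  obtains us where "F (T z) = G (trms P Q us)" "\<And>q k. (q, k) \<in> set us \<Longrightarrow> dom (el (pnt_eval P Q q))"
    "\<And>q e c. (q, e, c) \<in> set us \<Longrightarrow> fst e \<le> fst N \<and> snd e \<le> snd N \<and> (e = N \<longrightarrow> 0 < \<sigma> * c)"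
    "\<And>t. t \<in> set ts \<Longrightarrow> \<exists>c. (t, N, c) \<in> set us"
proof -
  obtain us where us: "column J ws ch xs gs b p = Some us"
    using check by (auto simp: column_check_def split: option.splits)
  have "list_all (\<lambda>(q, e, c). fst e \<le> fst N \<and> snd e \<le> snd N \<and> (e = N \<longrightarrow> 0 < \<sigma> * c)) us"
    "list_all (\<lambda>t. list_ex (\<lambda>(q, e, c). q = t \<and> e = N) us) ts"
    using check us by (simp_all add: column_check_def)
  then have "\<And>q e c. (q, e, c) \<in> set us \<Longrightarrow> fst e \<le> fst N \<and> snd e \<le> snd N \<and> (e = N \<longrightarrow> 0 < \<sigma> * c)"
    "\<And>t. t \<in> set ts \<Longrightarrow> \<exists>c. (t, N, c) \<in> set us"
    unfolding list_all_iff list_ex_iff by fast+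
  then show thesis
    using that[of us] column[OF us box cv] by fast
qed

lemma wt_mono: "fst e \<le> fst N \<Longrightarrow> snd e \<le> snd N \<Longrightarrow> wt e \<le> wt N"
  using L_sg_pos by (cases e; cases N) (simp add: add_mono mult_right_mono less_imp_le del: sg.simps)

lemma wt_eq: "fst e \<le> fst N \<Longrightarrow> snd e \<le> snd N \<Longrightarrow> wt e = wt N \<longleftrightarrow> e = N"
proof
  assume e: "fst e \<le> fst N" "snd e \<le> snd N" "wt e = wt N"
  obtain i j i' j' where ij: "e = (i, j)" "N = (i', j')"
    by (cases e; cases N)
  have pos: "0 < L (sg G1)" "0 < L (sg G2)"
    by (rule L_sg_pos)+
  have "(i' - i) * L (sg G1) + (j' - j) * L (sg G2) = 0"
    using e(3) by (simp add: ij algebra_simps)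
  moreover have "0 \<le> (i' - i) * L (sg G1)" "0 \<le> (j' - j) * L (sg G2)"
    using e(1,2) pos by (simp_all add: ij less_imp_le del: sg.simps)
  ultimately have "(i' - i) * L (sg G1) = 0" "(j' - j) * L (sg G2) = 0"
    by linarith+
  then show "e = N"
    using pos by (simp add: ij del: sg.simps)
qed simp

lemma dle_cf_F: "dle (wt N + top) (cf (F (T z)) x)"
proof -
  obtain us where us: "F (T z) = G (trms P Q us)" "\<And>q k. (q, k) \<in> set us \<Longrightarrow> dom (el (pnt_eval P Q q))"
    "\<And>q e c. (q, e, c) \<in> set us \<Longrightarrow> fst e \<le> fst N \<and> snd e \<le> snd N \<and> (e = N \<longrightarrow> 0 < \<sigma> * c)"
    using column_terms by metis
  have "set vs \<subseteq> set us \<Longrightarrow> dle (wt N + top) (cf (G (trms P Q vs)) x)" for vs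
  proof (induction vs)
    case (Cons v vs)
    obtain q e c where v: "v = (q, e, c)"
      by (cases v) auto
    have "(q, e, c) \<in> set us"
      using Cons.prems by (simp add: v)
    then have d: "dom (el (pnt_eval P Q q))" and e: "wt e \<le> wt N"
      using us(2,3) wt_mono by blast+
    have "dle (wt e + top) (lmono (e, c) * cf (G (T (el (pnt_eval P Q q)))) x)"
      using dle_lmono[of "(e, c)"] by (intro dle_mult dle_cf_G[OF d]) simp
    then have "dle (wt N + top) (lmono (e, c) * cf (G (T (el (pnt_eval P Q q)))) x)"
      by (rule dle_mono) (use e in simp)
    moreover have "dle (wt N + top) (cf (G (trms P Q vs)) x)"
      using Cons by simp
    ultimately show ?case
      by (simp add: v hlin_add[OF hlin_G] hlin_scale[OF hlin_G] lookup_add dle_add del: lmono.simps)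
  qed (simp add: hlin_zero)
  then show ?thesis
    by (simp add: us(1))
qed

lemma coeff_cf_F:
  assumes t: "t \<in> set ts" and z': "cv z' = pnt_eval P Q t" and u: "u \<in> set ws" "snd (chw ch u) \<noteq> 0"
  shows "dom z' \<and> coeff (cf (F (T z)) (word u * z')) (wt N + wt (fst (chw ch u))) \<noteq> 0"
proof -
  obtain us where us: "F (T z) = G (trms P Q us)" "\<And>q k. (q, k) \<in> set us \<Longrightarrow> dom (el (pnt_eval P Q q))"
    "\<And>q e c. (q, e, c) \<in> set us \<Longrightarrow> fst e \<le> fst N \<and> snd e \<le> snd N \<and> (e = N \<longrightarrow> 0 < \<sigma> * c)"
    "\<And>t. t \<in> set ts \<Longrightarrow> \<exists>c. (t, N, c) \<in> set us"
    using column_terms by metis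
  obtain c0 where c0: "(t, N, c0) \<in> set us"
    using us(4) t by blast
  have z'_el: "el (pnt_eval P Q t) = z'"
    by (simp flip: z')
  have d: "dom z'"
    using us(2)[OF c0] by (simp add: z'_el)
  \<comment> \<open>The total coefficient of the terms with exponent \<open>N\<close> that denote
    \<open>z'\<close>. By uniqueness of the coset decomposition only terms at \<open>z'\<close>
    reach the row of \<open>word u * z'\<close>, and among them only exponent \<open>N\<close>
    attains the top degree.\<close>
  define \<kappa> where "\<kappa> vs = (\<Sum>(q, e, c)\<leftarrow>vs. if el (pnt_eval P Q q) = z' \<and> e = N then c else 0)" for vs :: "trm list"
  obtain e1 c1 where chu: "chw ch u = (e1, c1)"
    by (cases "chw ch u")
  have "set vs \<subseteq> set us \<Longrightarrow> coeff (cf (G (trms P Q vs)) (word u * z')) (wt N + wt e1) = \<kappa> vs * c1" for vs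
  proof (induction vs)
    case (Cons v vs)
    obtain q e c where v: "v = (q, e, c)"
      by (cases v) auto
    have qe: "(q, e, c) \<in> set us"
      using Cons.prems by (simp add: v)
    then have dq: "dom (el (pnt_eval P Q q))" and e: "wt e = wt N \<longleftrightarrow> e = N"
      using us(2,3) wt_eq by blast+
    have "coeff (lmono (e, c) * cf (G (T (el (pnt_eval P Q q)))) (word u * z')) (wt N + wt e1) =
        (if el (pnt_eval P Q q) = z' \<and> e = N then c * c1 else 0)"
      unfolding cf_G_dom[OF d dq u(1)] using e by (auto simp: chu mult_single lookup_single when_def)
    moreover have "\<kappa> (v # vs) = (if el (pnt_eval P Q q) = z' \<and> e = N then c else 0) + \<kappa> vs"
      by (simp add: \<kappa>_def v)
    moreover have "coeff (cf (G (trms P Q vs)) (word u * z')) (wt N + wt e1) = \<kappa> vs * c1"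
      using Cons by simp
    ultimately show ?case
      by (simp add: v hlin_add[OF hlin_G] hlin_scale[OF hlin_G] lookup_add distrib_right del: lmono.simps)
  qed (simp add: hlin_zero \<kappa>_def)
  then have "coeff (cf (F (T z)) (word u * z')) (wt N + wt e1) = \<kappa> us * c1"
    by (simp add: us(1))
  moreover have "\<kappa> us \<noteq> 0"
  proof -
    have nonneg: "set vs \<subseteq> set us \<Longrightarrow> 0 \<le> \<sigma> * \<kappa> vs" for vs
    proof (induction vs)
      case (Cons v vs)
      obtain q e c where v: "v = (q, e, c)"
        by (cases v) auto
      have "e = N \<Longrightarrow> 0 < \<sigma> * c"
        using us(3)[of q e c] Cons.prems by (simp add: v)
      then show ?case
        using Cons by (auto simp: \<kappa>_def v distrib_left)
    qed (simp add: \<kappa>_def)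
    obtain vs1 vs2 where split: "us = vs1 @ (t, N, c0) # vs2"
      using c0 by (meson split_list)
    have "\<kappa> us = \<kappa> vs1 + c0 + \<kappa> vs2"
      by (simp add: split \<kappa>_def z'_el)
    moreover have "0 < \<sigma> * c0"
      using us(3)[OF c0] by simp
    ultimately have "0 < \<sigma> * \<kappa> us"
    proof -
      have "0 \<le> \<sigma> * \<kappa> vs1" "0 \<le> \<sigma> * \<kappa> vs2"
        by (intro nonneg; auto simp: split)+
      then show ?thesis
        using \<open>\<kappa> us = \<kappa> vs1 + c0 + \<kappa> vs2\<close> \<open>0 < \<sigma> * c0\<close> by (simp only: distrib_left)
    qed
    then show ?thesis
      by auto
  qed
  ultimately show ?thesis
    using d u(2) by (simp add: chu)
qed

end

text \<open>The degree has three sources: \<open>wt N\<close> from the column check, and one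
  \<open>top\<close> each from the coset factors of row and column. An element \<open>u\<close> of
  character degree \<open>top\<close> makes the entry between \<open>word u * z\<close> and
  \<open>word u * z'\<close> attain it.\<close>

theorem operator_left_le:
  assumes check: "list_all (column_check J ws ch xs gs N \<sigma>) pats"
    and cover: "\<And>z. dom z \<Longrightarrow> n < len z \<Longrightarrow>
      \<exists>(b, p, ts)\<in>set pats. \<exists>P Q. in_box b P Q \<and> cv z = pnt_eval P Q p"
    and pat: "(b, p, ts) \<in> set pats" "in_box b P Q" "cv z = pnt_eval P Q p" "dom z"
    and target: "t \<in> set ts" "cv z' = pnt_eval P Q t"
    and u: "u \<in> set ws" "wt (fst (chw ch u)) = top" "snd (chw ch u) \<noteq> 0"
    and long: "n + 24 < len (word u * z')"
  shows "left_le L (word u * z') (word u * z)"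
proof (rule leading_coeff_left_le[of F "n + 24" "wt N + top + top"])
  have chk: "column_check J ws ch xs gs N \<sigma> (b, p, ts)" if "(b, p, ts) \<in> set pats" for b p ts
    using check that by (simp add: list_all_iff)
  show "coeff (cf (F (T (word u * z))) (word u * z')) (wt N + top + top) \<noteq> 0"
  proof -
    have "coeff (cf (F (T z)) (word u * z')) (wt N + top) \<noteq> 0"
      using coeff_cf_F[OF chk[OF pat(1)] pat(2,3) target u(1,3)] by (simp add: u(2))
    moreover have "lmono (chw ch u) = Poly_Mapping.single top (snd (chw ch u))"
      by (cases "chw ch u") (use u(2) in simp)
    moreover have "coeff (Poly_Mapping.single k c * q) (j + k) = c * coeff q j" for k c j and q :: laurent
    proof (induction q rule: laurent_induct)
      case (add q i x)
      then show ?case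
        by (simp add: distrib_left lookup_add mult_single lookup_single when_def add.commute[of k])
    qed simp
    ultimately show ?thesis
      using u(3) by (simp only: F_word[OF u(1) pat(4)] lookup_scale mult_eq_0_iff not_False_eq_True simp_thms)
  qed
  fix w x assume x: "n + 24 < len x"
  obtain v y where vy: "v \<in> set ws" "dom y" "w = word v * y"
    using decompose by blast
  show "dle (wt N + top + top) (cf (F (T w)) x)"
  proof (cases "n < len y")
    case True
    then obtain b p ts P Q where *: "(b, p, ts) \<in> set pats" "in_box b P Q" "cv y = pnt_eval P Q p"
      using cover[OF vy(2)] by blast
    have "dle (wt N + top) (cf (F (T y)) x)"
      by (rule dle_cf_F[OF chk[OF *(1)] *(2,3)])
    moreover have "dle top (lmono (chw ch v))"
      by (rule dle_mono[OF dle_lmono top[OF vy(1)]])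
    ultimately have "dle (top + (wt N + top)) (lmono (chw ch v) * cf (F (T y)) x)"
      by (intro dle_mult)
    then show ?thesis
      by (simp add: vy(3) F_word[OF vy(1,2)] algebra_simps)
  next
    case False
    \<comment> \<open>The three factors have length at most 6 each, so \<open>F\<close> moves the
      support of a short \<open>y\<close> by at most 18 and misses every row longer than
      \<open>n + 24\<close>.\<close>
    have idem: "\<forall>(v, m)\<in>set (idem ws ch). length v \<le> 6"
      using length_ws by (auto simp: idem_def)
    have xs: "\<forall>(v, m)\<in>set xs. length v \<le> 6"
      using length_xs by auto
    have "cf (F (T y)) x = 0"
    proof (rule ccontr)
      assume "cf (F (T y)) x \<noteq> 0"
      then have "cf (comb (idem ws ch) (comb xs (G (T y)) + scale (\<Sum>m\<leftarrow>gs. lmono m) (T y))) x \<noteq> 0"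
        by (simp only: F_def G_def not_False_eq_True)
      then obtain x1 where x1: "cf (comb xs (G (T y)) + scale (\<Sum>m\<leftarrow>gs. lmono m) (T y)) x1 \<noteq> 0" "len x \<le> len x1 + 6"
        using cf_comb_support[OF _ idem] by blast
      have "len x1 \<le> len y + 12"
      proof (cases "cf (comb xs (G (T y))) x1 = 0")
        case True
        then have "cf (T y) x1 \<noteq> 0"
          using x1(1) by (metis add_0 lookup_add lookup_scale mult_zero_right)
        then show ?thesis
          by (simp add: lookup_T split: if_splits)
      next
        case False
        then obtain x2 where x2: "cf (G (T y)) x2 \<noteq> 0" "len x1 \<le> len x2 + 6"
          using cf_comb_support[OF _ xs] by blast
        then obtain x3 where x3: "cf (T y) x3 \<noteq> 0" "len x2 \<le> len x3 + 6"
          unfolding G_def using cf_comb_support[OF _ idem] by blast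
        have "x3 = y"
          using x3(1) by (simp add: lookup_T split: if_splits)
        then show ?thesis
          using x2(2) x3(2) by simp
      qed
      then show False
        using x x1(2) False by simp
    qed
    then show ?thesis
      by (simp add: vy(3) F_word[OF vy(1,2)])
  qed
qed (use long lideal_F in \<open>auto\<close>)

end

subsection \<open>The three operators\<close>

definition ws12 :: "gen list list" where
  "ws12 = [[], [G1], [G2, G1], [G1, G2, G1], [G2, G1, G2, G1], [G1, G2, G1, G2, G1],
    [G2], [G1, G2], [G2, G1, G2], [G1, G2, G1, G2], [G2, G1, G2, G1, G2], [G1, G2, G1, G2, G1, G2]]"

definition ws23 :: "gen list list" where
  "ws23 = [[], [G2], [G3, G2], [G2, G3, G2], [G3], [G2, G3]]"

interpretation p12: parabolic "[G1, G2]" ws12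
proof
  fix s u c assume su: "s # u \<in> set ws12"
  then show "s \<in> set [G1, G2] \<and> u \<in> set ws12"
    by (auto simp: ws12_def)
  assume c: "\<forall>t\<in>set [G1, G2]. 0 < sval t c"
  obtain x y z where "c = (x, y, z)"
    by (cases c)
  with c show "0 < sval s (actw u c)"
    using su by (auto simp: ws12_def)
next
  fix s u assume "s \<in> set [G1, G2]" "u \<in> set ws12"
  then show "\<exists>u'\<in>set ws12. actw (s # u) (1, 1, 1) = actw u' (1, 1, 1)"
    by (auto simp: ws12_def)
qed (auto simp: ws12_def)

interpretation p23: parabolic "[G2, G3]" ws23
proof
  fix s u c assume su: "s # u \<in> set ws23"
  then show "s \<in> set [G2, G3] \<and> u \<in> set ws23"
    by (auto simp: ws23_def)
  assume c: "\<forall>t\<in>set [G2, G3]. 0 < sval t c"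
  obtain x y z where "c = (x, y, z)"
    by (cases c)
  with c show "0 < sval s (actw u c)"
    using su by (auto simp: ws23_def)
next
  fix s u assume "s \<in> set [G2, G3]" "u \<in> set ws23"
  then show "\<exists>u'\<in>set ws23. actw (s # u) (1, 1, 1) = actw u' (1, 1, 1)"
    by (auto simp: ws23_def)
qed (auto simp: ws23_def)

text \<open>The index character and the character that maps \<open>T s1\<close> to \<open>v ^ L s1\<close> and \<open>T s2\<close> to
  \<open>- v ^ (- L s2)\<close>.\<close>

fun idx :: "gen \<Rightarrow> mono" where
  "idx G1 = ((1, 0), 1)" | "idx G2 = ((0, 1), 1)" | "idx G3 = ((0, 1), 1)"

fun eps :: "gen \<Rightarrow> mono" where
  "eps G1 = ((1, 0), 1)" | "eps G2 = ((0, - 1), - 1)" | "eps G3 = ((0, - 1), - 1)"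

lemma eigen12: "list_all (eigen_check ws12 idx) [G1, G2]" "list_all (eigen_check ws12 eps) [G1, G2]"
  by code_simp+

lemma eigen23: "list_all (eigen_check ws23 idx) [G2, G3]"
  by code_simp

text \<open>Two coordinates determine a point because 3 x + 2 y + z = 6 on the orbit. Here they are
  x and y; \<open>pt23\<close> uses x + y and y, and \<open>pt23'\<close> uses x + y and z, as suits
  the walls in the chamber of \<open>s2\<close> and \<open>s3\<close>.\<close>

definition pt12 :: "aff \<Rightarrow> aff \<Rightarrow> pnt" where
  "pt12 f g = (f, g, aff_add (6, 0, 0) (aff_add (aff_scale (- 3) f) (aff_scale (- 2) g)))"

definition pt23 :: "aff \<Rightarrow> aff \<Rightarrow> pnt" where
  "pt23 e g = pt12 (aff_add e (aff_scale (- 1) g)) g"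

definition pt23' :: "aff \<Rightarrow> aff \<Rightarrow> pnt" where
  "pt23' e h = pt23 e (aff_add h (aff_add (aff_scale 3 e) (- 6, 0, 0)))"

definition firew :: "gen list \<Rightarrow> pnt \<Rightarrow> pnt" where
  "firew u p = foldr fire_pnt u p"

text \<open>Each entry is a family of minimal coset representatives, in two parameters, on which all
  descents that occur in the computation are constant: the generic family and strips along the walls of
  the chamber of the parabolic subgroup and, for \<open>base23\<close>, along the lines \<open>c1 + c2 = 6 * i\<close>. The
  coordinates are never divisible by 6, so bounded parameters range over five consecutive numbers.\<close>

definition base12 :: "(int option \<times> aff \<times> aff) list" where
  "base12 = [(None, (13, 1, 0), (19, 0, 1)), (Some 4, (1, 1, 0), (30, 0, 1)), (Some 4, (7, 1, 0), (30, 0, 1)),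
    (Some 4, (30, 0, 1), (1, 1, 0)), (Some 4, (30, 0, 1), (7, 1, 0)), (Some 4, (30, 0, 1), (13, 1, 0))]"

definition base23 :: "(int option \<times> pnt) list" where
  "base23 = [(Some 4, pt23 (- 11, 1, 0) (100, 0, 1)), (Some 4, pt23 (- 5, 1, 0) (100, 0, 1)),
    (Some 4, pt23 (1, 1, 0) (100, 0, 1)), (Some 4, pt23 (7, 1, 0) (100, 0, 1)),
    (Some 4, pt23 (13, 1, 0) (100, 0, 1)), (Some 4, pt23' (100, 0, 1) (1, 1, 0)),
    (Some 4, pt23' (100, 0, 1) (7, 1, 0)), (None, pt23' (19, 1, 0) (13, 0, 1)),
    (Some 4, pt23 (- 100, 0, - 1) (1, 1, 0)), (Some 4, pt23 (- 100, 0, - 1) (7, 1, 0)),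
    (None, pt23 (- 13, - 1, 0) (13, 0, 1))]"

text \<open>Two generators of the coroot lattice and their negatives, scaled by the level 6. In
  these coordinates a coroot is given by its values on the first two simple roots.\<close>

definition dirs :: "(int \<times> int) list" where
  "dirs = [(0, 6), (0, - 6), (6, - 6), (- 6, 6)]"

definition shifts :: "int option \<Rightarrow> aff \<Rightarrow> aff \<Rightarrow> (aff \<times> aff) list" where
  "shifts b f g = filter (\<lambda>(f, g). aff_pos b f \<and> aff_pos b g)
     (map (\<lambda>d. (aff_add f (fst d, 0, 0), aff_add g (snd d, 0, 0))) dirs)"

definition pats0 :: "(int option \<times> pnt \<times> pnt list) list" where
  "pats0 = map (\<lambda>(b, f, g). (b, pt12 f g, map (\<lambda>(f, g). pt12 f g) (shifts b f g))) base12"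

text \<open>Mutually inverse glide reflections of the strip 0 < y < 6. The first sends (x, y) to (x
  + y, 6 - y), so its square is the translation by (6, 0).\<close>

definition glides1 :: "gen list list" where
  "glides1 = [[G3, G2, G1, G2, G1], [G1, G2, G1, G2, G3]]"

definition pats1 :: "(int option \<times> pnt \<times> pnt list) list" where
  "pats1 = map (\<lambda>(b, f, g). (b, pt12 f g, if g = (1, 1, 0) then map (\<lambda>u. firew u (pt12 f g)) glides1 else [])) base12"

text \<open>Mutually inverse glide reflections of the strip 0 < x + y < 6, exchanging the values x +
  y and 6 - (x + y).\<close>

definition glides2 :: "gen list list" where
  "glides2 = [[G1, G2, G3], [G3, G2, G1]]"

definition pats2 :: "(int option \<times> pnt \<times> pnt list) list" where
  "pats2 = map (\<lambda>(b, p). (b, p, if p = pt23 (1, 1, 0) (100, 0, 1) then map (\<lambda>u. firew u p) glides2 else [])) base23"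

text \<open>The second terms of the operators, and the scalars in \<open>check1\<close> and \<open>check2\<close>, are chosen
  so that they cancel all entries of too high degree.\<close>

definition op0 :: "(gen list \<times> mono) list" where
  "op0 = [([G3], ((0, 0), 1))]"

definition op1 :: "(gen list \<times> mono) list" where
  "op1 = [([G3, G2, G1, G2, G3], ((0, 0), 1)), ([G3], ((- 1, 3), - 1))]"

definition op2 :: "(gen list \<times> mono) list" where
  "op2 = [([G1, G2, G1], ((0, 0), 1)), ([G1], ((1, - 1), - 1))]"

lemma check0: "list_all (column_check [G1, G2] ws12 idx op0 [] (4, 3) 1) pats0"
  by code_simp

lemma check1: "list_all (column_check [G1, G2] ws12 eps op1 [((1, 4), 1), ((- 1, 4), 1)] (3, 1) (- 1)) pats1"
  by code_simp

lemma check2: "list_all (column_check [G2, G3] ws23 idx op2 [((2, 1), 1), ((2, - 1), 1)] (1, 3) (- 1)) pats2"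
  by code_simp

subsection \<open>Coordinates\<close>

text \<open>The six forms are the positive finite roots. A value divisible by 6 would put the point
  on a reflecting hyperplane; at the base point the values are 1, 1, 2, 3, 4, 5.\<close>

lemma cv_forms:
  "\<exists>x y z. cv w = (x, y, z) \<and> 3 * x + 2 * y + z = 6 \<and> \<not> 6 dvd x \<and> \<not> 6 dvd y \<and> \<not> 6 dvd x + y \<and>
    \<not> 6 dvd 2 * x + y \<and> \<not> 6 dvd 3 * x + y \<and> \<not> 6 dvd 3 * x + 2 * y"
proof (induction w rule: W_induct)
  case one
  show ?case
    by (simp add: cv_one)
next
  case (step s w)
  then obtain x y z where w: "cv w = (x, y, z)" and l: "3 * x + 2 * y + z = 6"
    and r: "\<not> 6 dvd x" "\<not> 6 dvd y" "\<not> 6 dvd x + y" "\<not> 6 dvd 2 * x + y" "\<not> 6 dvd 3 * x + y" "\<not> 6 dvd 3 * x + 2 * y"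
    by blast
  have z: "z = 6 - 3 * x - 2 * y"
    using l by simp
  show ?case
  proof (cases s)
    case G1
    have "\<not> 6 dvd - x" "\<not> 6 dvd y + 3 * x" "\<not> 6 dvd - x + (y + 3 * x)" "\<not> 6 dvd 2 * - x + (y + 3 * x)"
      "\<not> 6 dvd 3 * - x + (y + 3 * x)" "\<not> 6 dvd 3 * - x + 2 * (y + 3 * x)"
      using r by (simp_all add: algebra_simps)
    then show ?thesis
      using l by (simp add: G1 cv_sg w del: sg.simps)
  next
    case G2
    have "\<not> 6 dvd x + y" "\<not> 6 dvd - y" "\<not> 6 dvd (x + y) + - y" "\<not> 6 dvd 2 * (x + y) + - y"
      "\<not> 6 dvd 3 * (x + y) + - y" "\<not> 6 dvd 3 * (x + y) + 2 * - y"
      using r by (simp_all add: algebra_simps)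
    then show ?thesis
      using l by (simp add: G2 cv_sg w del: sg.simps)
  next
    case G3
    have "\<not> 6 dvd y + z" "\<not> 6 dvd x + (y + z)" "\<not> 6 dvd 2 * x + (y + z)"
      "\<not> 6 dvd 3 * x + (y + z)" "\<not> 6 dvd 3 * x + 2 * (y + z)"
      unfolding z using r by presburger+
    then show ?thesis
      using r(1) l by (simp add: G3 cv_sg w del: sg.simps)
  qed
qed

lemma cv_level: "cv w = (x, y, z) \<Longrightarrow> z = 6 - 3 * x - 2 * y"
  using cv_forms[of w] by fastforce

lemma cv_residues:
  assumes "cv w = (x, y, z)"
  shows "x mod 6 \<noteq> 0" "y mod 6 \<noteq> 0" "(x + y) mod 6 \<noteq> 0" "z mod 6 \<noteq> 0"
proof -
  have r: "\<not> 6 dvd x" "\<not> 6 dvd y" "\<not> 6 dvd x + y" "\<not> 6 dvd 3 * x + 2 * y" and z: "z = 6 - (3 * x + 2 * y)"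
    using cv_forms[of w] assms by auto
  show "x mod 6 \<noteq> 0" "y mod 6 \<noteq> 0" "(x + y) mod 6 \<noteq> 0"
    using r by presburger+
  show "z mod 6 \<noteq> 0"
    using r(4) unfolding z by presburger
qed

lemma finite_bounded_cv: "finite {w. \<exists>x y z. cv w = (x, y, z) \<and> \<bar>x\<bar> \<le> M \<and> \<bar>y\<bar> \<le> M}"
proof -
  have "cv ` {w. \<exists>x y z. cv w = (x, y, z) \<and> \<bar>x\<bar> \<le> M \<and> \<bar>y\<bar> \<le> M} \<subseteq>
      (\<lambda>(x, y). (x, y, 6 - 3 * x - 2 * y)) ` ({- M..M} \<times> {- M..M})"
  proof (clarify)
    fix w x y z x' y' z' assume w: "cv w = (x', y', z')" "\<bar>x'\<bar> \<le> M" "\<bar>y'\<bar> \<le> M" and xyz: "(x, y, z) = cv w"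
    then have "z = 6 - 3 * x - 2 * y" "x = x'" "y = y'"
      using cv_level[of w x y z] by auto
    then show "(x, y, z) \<in> (\<lambda>(x, y). (x, y, 6 - 3 * x - 2 * y)) ` ({- M..M} \<times> {- M..M})"
      using w by (intro image_eqI[of _ _ "(x, y)"]) auto
  qed
  then have "finite (cv ` {w. \<exists>x y z. cv w = (x, y, z) \<and> \<bar>x\<bar> \<le> M \<and> \<bar>y\<bar> \<le> M})"
    by (rule finite_subset) simp
  then show ?thesis
    by (rule finite_imageD) (simp add: inj_on_def cv_inject)
qed

text \<open>Together with \<open>coordinate_bound\<close> this exchanges long elements for distant
  points: only finitely many elements satisfy a bound of either kind.\<close>

lemma len_bound: "\<exists>n. \<forall>w x y z. cv w = (x, y, z) \<longrightarrow> n < len w \<longrightarrow> M < \<bar>x\<bar> \<or> M < \<bar>y\<bar>"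
proof -
  let ?A = "{w. \<exists>x y z. cv w = (x, y, z) \<and> \<bar>x\<bar> \<le> M \<and> \<bar>y\<bar> \<le> M}"
  have "len w \<le> Max (len ` ?A)" if "w \<in> ?A" for w
    using that finite_bounded_cv[of M] by (intro Max_ge) auto
  then show ?thesis
    by (intro exI[of _ "Max (len ` ?A)"]) (fastforce simp: not_less)
qed

lemma gen_UNIV: "UNIV = {G1, G2, G3}"
  using gen.exhaust by blast

lemma coordinate_bound: "\<exists>M::int. \<forall>w x y z. cv w = (x, y, z) \<longrightarrow> M < \<bar>x\<bar> \<or> M < \<bar>y\<bar> \<longrightarrow> n < len w"
proof -
  let ?A = "{w. len w \<le> n}"
  have "?A \<subseteq> word ` {xs. set xs \<subseteq> UNIV \<and> length xs \<le> n}"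
    using reduced_word by fastforce
  moreover have "finite {xs :: gen list. set xs \<subseteq> UNIV \<and> length xs \<le> n}"
    by (rule finite_lists_length_le) (simp add: gen_UNIV)
  ultimately have fin: "finite ?A"
    by (rule finite_subset[OF _ finite_imageI])
  let ?f = "\<lambda>w. case cv w of (x, y, z) \<Rightarrow> max \<bar>x\<bar> \<bar>y\<bar>"
  have *: "?f w \<le> Max (?f ` ?A)" if "len w \<le> n" for w
    using that fin by (intro Max_ge) auto
  have "n < len w" if "cv w = (x, y, z)" "Max (?f ` ?A) < \<bar>x\<bar> \<or> Max (?f ` ?A) < \<bar>y\<bar>" for w x y z
  proof (rule ccontr)
    assume "\<not> n < len w"
    then have "max \<bar>x\<bar> \<bar>y\<bar> \<le> Max (?f ` ?A)"
      using *[of w] that(1) by simp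
    then show False
      using that(2) by linarith
  qed
  then show ?thesis
    by blast
qed

lemma cv_pt12:
  assumes "cv w = (x, y, z)" "x = aff_eval P Q f" "y = aff_eval P Q g"
  shows "cv w = pnt_eval P Q (pt12 f g)"
  using cv_level[OF assms(1)] by (simp add: assms pt12_def aff_eval_add aff_eval_scale)

lemma cover12I:
  "(b, f, g) \<in> set base12 \<Longrightarrow> in_box b P Q \<Longrightarrow> x = aff_eval P Q f \<Longrightarrow> y = aff_eval P Q g \<Longrightarrow>
    \<exists>(b, f, g)\<in>set base12. \<exists>P Q. in_box b P Q \<and> x = aff_eval P Q f \<and> y = aff_eval P Q g"
  by blast

lemma cover12:
  assumes "cv w = (x, y, z)" "0 < x" "0 < y" "30 \<le> x \<or> 30 \<le> y"
  shows "\<exists>(b, f, g)\<in>set base12. \<exists>P Q. in_box b P Q \<and> x = aff_eval P Q f \<and> y = aff_eval P Q g"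
proof -
  have r: "x mod 6 \<noteq> 0" "y mod 6 \<noteq> 0"
    using cv_residues[OF assms(1)] by blast+
  then have ne: "x \<noteq> 6" "x \<noteq> 12" "y \<noteq> 6" "y \<noteq> 12" "y \<noteq> 18"
    by auto
  have x: "x \<le> 5 \<or> 7 \<le> x \<and> x \<le> 11 \<or> 13 \<le> x"
    using ne(1,2) by linarith
  have y: "y \<le> 5 \<or> 7 \<le> y \<and> y \<le> 11 \<or> 13 \<le> y \<and> y \<le> 17 \<or> 19 \<le> y"
    using ne(3-5) by linarith
  consider "13 \<le> x" "19 \<le> y" | "x \<le> 5" "30 \<le> y" | "7 \<le> x" "x \<le> 11" "30 \<le> y"
    | "y \<le> 5" "30 \<le> x" | "7 \<le> y" "y \<le> 11" "30 \<le> x" | "13 \<le> y" "y \<le> 17" "30 \<le> x"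
    using x y assms(4) by linarith
  then show ?thesis
  proof cases
    case 1
    then show ?thesis
      using assms(2,3) by (intro cover12I[of "None" "(13, 1, 0)" "(19, 0, 1)" "x - 13" "y - 19"]) (simp_all add: base12_def)
  next
    case 2
    then show ?thesis
      using assms(2,3) by (intro cover12I[of "Some 4" "(1, 1, 0)" "(30, 0, 1)" "x - 1" "y - 30"]) (simp_all add: base12_def)
  next
    case 3
    then show ?thesis
      using assms(2,3) by (intro cover12I[of "Some 4" "(7, 1, 0)" "(30, 0, 1)" "x - 7" "y - 30"]) (simp_all add: base12_def)
  next
    case 4
    then show ?thesis
      using assms(2,3) by (intro cover12I[of "Some 4" "(30, 0, 1)" "(1, 1, 0)" "y - 1" "x - 30"]) (simp_all add: base12_def)
  next
    case 5
    then show ?thesis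
      using assms(2,3) by (intro cover12I[of "Some 4" "(30, 0, 1)" "(7, 1, 0)" "y - 7" "x - 30"]) (simp_all add: base12_def)
  next
    case 6
    then show ?thesis
      using assms(2,3) by (intro cover12I[of "Some 4" "(30, 0, 1)" "(13, 1, 0)" "y - 13" "x - 30"]) (simp_all add: base12_def)
  qed
qed

lemma cv_pt23:
  assumes "cv w = (x, y, z)" "x + y = aff_eval P Q e" "y = aff_eval P Q g"
  shows "cv w = pnt_eval P Q (pt23 e g)"
  unfolding pt23_def by (rule cv_pt12[OF assms(1)]) (use assms(2,3) in \<open>simp_all add: aff_eval_add aff_eval_scale\<close>)

lemma cv_pt23':
  assumes "cv w = (x, y, z)" "x + y = aff_eval P Q e" "z = aff_eval P Q h"
  shows "cv w = pnt_eval P Q (pt23' e h)"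
proof -
  have "y = aff_eval P Q h + 3 * aff_eval P Q e - 6"
    using cv_level[OF assms(1)] assms(2,3) by linarith
  then show ?thesis
    unfolding pt23'_def by (intro cv_pt23[OF assms(1,2)]) (simp add: aff_eval_add aff_eval_scale)
qed

lemma cover23I:
  "(b, p) \<in> set base23 \<Longrightarrow> in_box b P Q \<Longrightarrow> cv w = pnt_eval P Q p \<Longrightarrow>
    \<exists>(b, p)\<in>set base23. \<exists>P Q. in_box b P Q \<and> cv w = pnt_eval P Q p"
  by blast

lemma cover23:
  assumes "cv w = (x, y, z)" "0 < y" "0 < z" "400 < \<bar>x\<bar> \<or> 400 < \<bar>y\<bar>"
  shows "\<exists>(b, p)\<in>set base23. \<exists>P Q. in_box b P Q \<and> cv w = pnt_eval P Q p"
proof -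
  define e where "e = x + y"
  have z: "z = 6 - 3 * e + y"
    using cv_level[OF assms(1)] by (simp add: e_def)
  have r: "e mod 6 \<noteq> 0" "y mod 6 \<noteq> 0" "z mod 6 \<noteq> 0"
    using cv_residues[OF assms(1)] by (simp_all add: e_def)
  then have e_ne: "e \<noteq> - 12" "e \<noteq> - 6" "e \<noteq> 0" "e \<noteq> 6" "e \<noteq> 12" "e \<noteq> 18"
    and ne: "y \<noteq> 6" "y \<noteq> 12" "z \<noteq> 6" "z \<noteq> 12"
    by auto
  \<comment> \<open>Far from the origin, a point near one of the lines must be far along it. The
    threshold 400 leaves room for the starting value 100 of the unbounded parameters.\<close>
  have y100: "- 20 \<le> e \<Longrightarrow> e \<le> 20 \<Longrightarrow> 100 \<le> y"
    and e100: "19 \<le> e \<Longrightarrow> z \<le> 11 \<Longrightarrow> 100 \<le> e"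
    and e100': "e \<le> - 13 \<Longrightarrow> y \<le> 11 \<Longrightarrow> e \<le> - 100"
    using assms(2-4) z e_def by linarith+
  note p = cv_pt23[OF assms(1), folded e_def] and p' = cv_pt23'[OF assms(1), folded e_def]
  have "e \<le> - 13 \<or> - 11 \<le> e \<and> e \<le> - 7 \<or> - 5 \<le> e \<and> e \<le> - 1 \<or> 1 \<le> e \<and> e \<le> 5 \<or> 7 \<le> e \<and> e \<le> 11 \<or>
      13 \<le> e \<and> e \<le> 17 \<or> 19 \<le> e"
    using e_ne by presburger
  moreover have "y \<le> 5 \<or> 7 \<le> y \<and> y \<le> 11 \<or> 13 \<le> y" "z \<le> 5 \<or> 7 \<le> z \<and> z \<le> 11 \<or> 13 \<le> z"
    using ne by linarith+
  ultimately consider "- 11 \<le> e" "e \<le> - 7" | "- 5 \<le> e" "e \<le> - 1" | "1 \<le> e" "e \<le> 5" | "7 \<le> e" "e \<le> 11" | "13 \<le> e" "e \<le> 17"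
    | "19 \<le> e" "z \<le> 5" | "19 \<le> e" "7 \<le> z" "z \<le> 11" | "19 \<le> e" "13 \<le> z"
    | "e \<le> - 13" "y \<le> 5" | "e \<le> - 13" "7 \<le> y" "y \<le> 11" | "e \<le> - 13" "13 \<le> y"
    by argo
  then show ?thesis
  proof cases
    case 1
    then show ?thesis
      using y100 assms(2,3) by (intro cover23I[of "Some 4" "pt23 (- 11, 1, 0) (100, 0, 1)" "e + 11" "y - 100", OF _ _ p]) (simp_all add: base23_def)
  next
    case 2
    then show ?thesis
      using y100 assms(2,3) by (intro cover23I[of "Some 4" "pt23 (- 5, 1, 0) (100, 0, 1)" "e + 5" "y - 100", OF _ _ p]) (simp_all add: base23_def)
  next
    case 3
    then show ?thesis
      using y100 assms(2,3) by (intro cover23I[of "Some 4" "pt23 (1, 1, 0) (100, 0, 1)" "e - 1" "y - 100", OF _ _ p]) (simp_all add: base23_def)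
  next
    case 4
    then show ?thesis
      using y100 assms(2,3) by (intro cover23I[of "Some 4" "pt23 (7, 1, 0) (100, 0, 1)" "e - 7" "y - 100", OF _ _ p]) (simp_all add: base23_def)
  next
    case 5
    then show ?thesis
      using y100 assms(2,3) by (intro cover23I[of "Some 4" "pt23 (13, 1, 0) (100, 0, 1)" "e - 13" "y - 100", OF _ _ p]) (simp_all add: base23_def)
  next
    case 6
    then show ?thesis
      using e100 assms(2,3) by (intro cover23I[of "Some 4" "pt23' (100, 0, 1) (1, 1, 0)" "z - 1" "e - 100", OF _ _ p']) (simp_all add: base23_def)
  next
    case 7
    then show ?thesis
      using e100 assms(2,3) by (intro cover23I[of "Some 4" "pt23' (100, 0, 1) (7, 1, 0)" "z - 7" "e - 100", OF _ _ p']) (simp_all add: base23_def)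
  next
    case 8
    then show ?thesis
      using  assms(2,3) by (intro cover23I[of "None" "pt23' (19, 1, 0) (13, 0, 1)" "e - 19" "z - 13", OF _ _ p']) (simp_all add: base23_def)
  next
    case 9
    then show ?thesis
      using e100' assms(2,3) by (intro cover23I[of "Some 4" "pt23 (- 100, 0, - 1) (1, 1, 0)" "y - 1" "- 100 - e", OF _ _ p]) (simp_all add: base23_def)
  next
    case 10
    then show ?thesis
      using e100' assms(2,3) by (intro cover23I[of "Some 4" "pt23 (- 100, 0, - 1) (7, 1, 0)" "y - 7" "- 100 - e", OF _ _ p]) (simp_all add: base23_def)
  next
    case 11
    then show ?thesis
      using  assms(2,3) by (intro cover23I[of "None" "pt23 (- 13, - 1, 0) (13, 0, 1)" "- 13 - e" "y - 13", OF _ _ p]) (simp_all add: base23_def)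
  qed
qed

lemma pnt_eval_firew: "pnt_eval P Q (firew u p) = actw u (pnt_eval P Q p)"
  by (induction u) (simp_all add: firew_def)

lemma len_word_ge: "len z \<le> length v + len (word v * z)"
proof (induction v)
  case (Cons s v)
  have "len (word v * z) \<le> Suc (len (sg s * (word v * z)))"
    using len_sg_mult[of s "word v * z"] by linarith
  with Cons show ?case
    by (simp add: word_Cons mult.assoc)
qed (simp add: word_Nil)

abbreviation w12 :: W where
  "w12 \<equiv> word [G1, G2, G1, G2, G1, G2]"

abbreviation w23 :: W where
  "w23 \<equiv> word [G2, G3, G2]"

subsection \<open>Translations and glide reflections\<close>

text \<open>A bounded coordinate runs over the five numbers between consecutive multiples of 6, so a
  shift by 6 keeps the whole family positive or makes it negative throughout. Unbounded coordinates
  start high enough to allow any shift.\<close>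

lemma shifts_complete:
  assumes "(b, f, g) \<in> set base12" "(d, d') \<in> set dirs" "in_box b P Q"
    "0 < aff_eval P Q f + d" "0 < aff_eval P Q g + d'"
  shows "(aff_add f (d, 0, 0), aff_add g (d', 0, 0)) \<in> set (shifts b f g)"
proof -
  have "aff_pos b (aff_add f (d, 0, 0)) \<and> aff_pos b (aff_add g (d', 0, 0))"
    using assms unfolding base12_def dirs_def by auto
  then show ?thesis
    using assms(2) by (force simp: shifts_def)
qed

text \<open>The bound \<open>M\<close> is chosen before \<open>L\<close>: the thresholds concern
  only lengths and coordinates, which do not involve the weights.\<close>

theorem w12_shift:
  "\<exists>M. \<forall>L x y z d d' w w' z'. weighted L \<longrightarrow> cv w = (x, y, z) \<longrightarrow> cv w' = (x + d, y + d', z') \<longrightarrow>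
    0 < x \<longrightarrow> 0 < y \<longrightarrow> 0 < x + d \<longrightarrow> 0 < y + d' \<longrightarrow> M \<le> x \<or> M \<le> y \<longrightarrow> (d, d') \<in> set dirs \<longrightarrow>
    left_le L (w12 * w') (w12 * w)"
proof -
  obtain n where n: "\<And>w x y z. cv w = (x, y, z) \<Longrightarrow> n < len w \<Longrightarrow> 30 < \<bar>x\<bar> \<or> 30 < \<bar>y\<bar>"
    using len_bound[of 30] by blast
  \<comment> \<open>\<open>n + 30\<close> is the threshold \<open>n + 24\<close> for the rows plus
    the six letters by which \<open>w12\<close> might shorten an element.\<close>
  obtain M where M: "\<And>w x y z. cv w = (x, y, z) \<Longrightarrow> M < \<bar>x\<bar> \<or> M < \<bar>y\<bar> \<Longrightarrow> n + 30 < len w"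
    using coordinate_bound[of "n + 30"] by blast
  have "left_le L (w12 * w') (w12 * w)"
    if L: "weighted L" and w: "cv w = (x, y, z)" and w': "cv w' = (x + d, y + d', z')"
      and pos: "0 < x" "0 < y" "0 < x + d" "0 < y + d'" and big: "max 30 M + 7 \<le> x \<or> max 30 M + 7 \<le> y"
      and d: "(d, d') \<in> set dirs"
    for L x y z d d' w w' z'
  proof -
    interpret weighted L
      by (rule L)
    interpret parabolic_operator L "[G1, G2]" ws12 idx op0 "[]" "(4, 3)" 1 "wt (3, 3)"
    proof
      have pos: "0 < L (sg G1)" "0 < L (sg G2)"
        by (rule L_sg_pos)+
      show "wt (fst (chw idx u)) \<le> wt (3, 3)" if "u \<in> set ws12" for u
        using that pos by (auto simp: ws12_def simp del: sg.simps)
      show "eigen_check ws12 idx s" if "s \<in> set [G1, G2]" for s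
        using eigen12(1) that by (auto simp: list_all_iff)
    qed (auto simp: ws12_def op0_def)
    obtain b f g P Q where b: "(b, f, g) \<in> set base12" "in_box b P Q" "x = aff_eval P Q f" "y = aff_eval P Q g"
      using cover12[OF w pos(1,2)] big by fastforce
    show ?thesis
    proof (rule operator_left_le[OF check0, of n b "pt12 f g" "map (\<lambda>(f, g). pt12 f g) (shifts b f g)" P Q])
      show "\<exists>(b, p, ts)\<in>set pats0. \<exists>P Q. in_box b P Q \<and> cv z = pnt_eval P Q p" if z: "p12.dom z" "n < len z" for z
      proof -
        obtain x y u where c: "cv z = (x, y, u)"
          by (cases "cv z")
        have "0 < x" "0 < y"
          using z(1) by (simp_all add: p12.dom_def c)
        moreover have "30 \<le> x \<or> 30 \<le> y"
          using n[OF c z(2)] calculation by linarith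
        ultimately obtain b f g P Q where b: "(b, f, g) \<in> set base12" "in_box b P Q" "x = aff_eval P Q f" "y = aff_eval P Q g"
          using cover12[OF c] by blast
        then have "(b, pt12 f g, map (\<lambda>(f, g). pt12 f g) (shifts b f g)) \<in> set pats0"
          by (force simp: pats0_def)
        then show ?thesis
          using b(2) cv_pt12[OF c b(3,4)] by blast
      qed
      show "(b, pt12 f g, map (\<lambda>(f, g). pt12 f g) (shifts b f g)) \<in> set pats0"
        using b(1) by (force simp: pats0_def)
      show "cv w = pnt_eval P Q (pt12 f g)"
        by (rule cv_pt12[OF w b(3,4)])
      show "p12.dom w"
        using pos by (simp add: p12.dom_def w)
      show "pt12 (aff_add f (d, 0, 0)) (aff_add g (d', 0, 0)) \<in> set (map (\<lambda>(f, g). pt12 f g) (shifts b f g))"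
        using shifts_complete[OF b(1) d b(2)] pos(3,4) b(3,4) by force
      show "cv w' = pnt_eval P Q (pt12 (aff_add f (d, 0, 0)) (aff_add g (d', 0, 0)))"
        by (rule cv_pt12[OF w']) (simp_all add: aff_eval_add b(3,4))
      show "n + 24 < len (w12 * w')"
      proof -
        have "\<bar>d\<bar> \<le> 6" "\<bar>d'\<bar> \<le> 6"
          using d by (auto simp: dirs_def)
        then have "n + 30 < len w'"
          using M[OF w'] big by linarith
        then show ?thesis
          using len_word_ge[of w' "[G1, G2, G1, G2, G1, G2]"] by simp
      qed
    qed (use b(2) in \<open>auto simp: ws12_def\<close>)
  qed
  then show ?thesis
    by (intro exI[of _ "max 30 M + 7"]) blast
qed

text \<open>\<open>eps\<close> has degree a * L s1 - b * L s2 on a word with a letters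
  \<open>G1\<close> and b letters \<open>G2\<close>. It is largest on alternating words beginning
  and ending with \<open>G1\<close>, with degrees L s1, 2 L s1 - L s2 and 3 L s1 - 2 L s2. The
  middle one is the mean of the others, so one of the two extremes is maximal.\<close>

definition eps_top :: "(W \<Rightarrow> int) \<Rightarrow> gen list" where
  "eps_top L = (if L (sg G2) \<le> L (sg G1) then [G1, G2, G1, G2, G1] else [G1])"

theorem eps_glide:
  "\<exists>M. \<forall>L x y z w u. weighted L \<longrightarrow> cv w = (x, y, z) \<longrightarrow> 0 < y \<longrightarrow> y < 6 \<longrightarrow> M \<le> x \<longrightarrow> u \<in> set glides1 \<longrightarrow>
    left_le L (word (eps_top L) * (word u * w)) (word (eps_top L) * w)"
proof -
  obtain n where n: "\<And>w x y z. cv w = (x, y, z) \<Longrightarrow> n < len w \<Longrightarrow> 30 < \<bar>x\<bar> \<or> 30 < \<bar>y\<bar>"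
    using len_bound[of 30] by blast
  obtain M where M: "\<And>w x y z. cv w = (x, y, z) \<Longrightarrow> M < \<bar>x\<bar> \<or> M < \<bar>y\<bar> \<Longrightarrow> n + 40 < len w"
    using coordinate_bound[of "n + 40"] by blast
  have "left_le L (word (eps_top L) * (word u * w)) (word (eps_top L) * w)"
    if L: "weighted L" and w: "cv w = (x, y, z)" and pos: "0 < y" "y < 6" and big: "max 30 M + 7 \<le> x"
      and u: "u \<in> set glides1" for L x y z w u
  proof -
    interpret weighted L
      by (rule L)
    have L_pos: "0 < L (sg G1)" "0 < L (sg G2)"
      by (rule L_sg_pos)+
    define top where "top = max (wt (1, 0)) (wt (3, - 2))"
    interpret parabolic_operator L "[G1, G2]" ws12 eps op1 "[((1, 4), 1), ((- 1, 4), 1)]" "(3, 1)" "- 1" top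
    proof
      show "wt (fst (chw eps u)) \<le> top" if "u \<in> set ws12" for u
        using that L_pos by (auto simp: ws12_def top_def max_def simp del: sg.simps)
      show "eigen_check ws12 eps s" if "s \<in> set [G1, G2]" for s
        using eigen12(2) that by (auto simp: list_all_iff)
    qed (auto simp: ws12_def op1_def)
    let ?p = "pt12 (30, 0, 1) (1, 1, 0)"
    have cv: "cv w = pnt_eval (y - 1) (x - 30) ?p"
      by (rule cv_pt12[OF w]) simp_all
    show ?thesis
    proof (rule operator_left_le[OF check1, of n "Some 4" ?p "map (\<lambda>u. firew u ?p) glides1" "y - 1" "x - 30" _ "firew u ?p"])
      show "\<exists>(b, p, ts)\<in>set pats1. \<exists>P Q. in_box b P Q \<and> cv z = pnt_eval P Q p" if z: "p12.dom z" "n < len z" for z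
      proof -
        obtain x y u where c: "cv z = (x, y, u)"
          by (cases "cv z")
        have "0 < x" "0 < y"
          using z(1) by (simp_all add: p12.dom_def c)
        moreover have "30 \<le> x \<or> 30 \<le> y"
          using n[OF c z(2)] calculation by linarith
        ultimately obtain b f g P Q where b: "(b, f, g) \<in> set base12" "in_box b P Q" "x = aff_eval P Q f" "y = aff_eval P Q g"
          using cover12[OF c] by blast
        then have "\<exists>ts. (b, pt12 f g, ts) \<in> set pats1"
          unfolding pats1_def by force
        then show ?thesis
          using b(2) cv_pt12[OF c b(3,4)] by blast
      qed
      show "(Some 4, ?p, map (\<lambda>u. firew u ?p) glides1) \<in> set pats1"
        by (simp add: pats1_def base12_def)
      show "in_box (Some 4) (y - 1) (x - 30)"
        using pos big by simp
      show "p12.dom w"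
        using pos big by (simp add: p12.dom_def w)
      show "firew u ?p \<in> set (map (\<lambda>u. firew u ?p) glides1)"
        using u by simp
      show "cv (word u * w) = pnt_eval (y - 1) (x - 30) (firew u ?p)"
        by (simp only: cv_word pnt_eval_firew cv)
      show "n + 24 < len (word (eps_top L) * (word u * w))"
      proof -
        have "n + 40 < len w"
          using M[OF w] big by linarith
        moreover have "len w \<le> length u + len (word u * w)"
          "len (word u * w) \<le> length (eps_top L) + len (word (eps_top L) * (word u * w))"
          by (rule len_word_ge)+
        moreover have "length u \<le> 5" "length (eps_top L) \<le> 5"
          using u by (auto simp: glides1_def eps_top_def)
        ultimately show ?thesis
          by linarith
      qed
      show "wt (fst (chw eps (eps_top L))) = top"
        using L_pos by (auto simp: eps_top_def top_def max_def simp del: sg.simps)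
    qed (rule cv, auto simp: ws12_def eps_top_def)
  qed
  then show ?thesis
    by (intro exI[of _ "max 30 M + 7"]) blast
qed

theorem w23_glide:
  "\<exists>M. \<forall>L x y z w u. weighted L \<longrightarrow> cv w = (x, y, z) \<longrightarrow> 0 < y \<longrightarrow> 0 < z \<longrightarrow> 0 < x + y \<longrightarrow> x + y < 6 \<longrightarrow> M \<le> y \<longrightarrow>
    u \<in> set glides2 \<longrightarrow> left_le L (w23 * (word u * w)) (w23 * w)"
proof -
  obtain n where n: "\<And>w x y z. cv w = (x, y, z) \<Longrightarrow> n < len w \<Longrightarrow> 400 < \<bar>x\<bar> \<or> 400 < \<bar>y\<bar>"
    using len_bound[of 400] by blast
  obtain M where M: "\<And>w x y z. cv w = (x, y, z) \<Longrightarrow> M < \<bar>x\<bar> \<or> M < \<bar>y\<bar> \<Longrightarrow> n + 40 < len w"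
    using coordinate_bound[of "n + 40"] by blast
  have "left_le L (w23 * (word u * w)) (w23 * w)"
    if L: "weighted L" and w: "cv w = (x, y, z)" and pos: "0 < y" "0 < z" "0 < x + y" "x + y < 6"
      and big: "max 100 M + 7 \<le> y" and u: "u \<in> set glides2" for L x y z w u
  proof -
    interpret weighted L
      by (rule L)
    interpret parabolic_operator L "[G2, G3]" ws23 idx op2 "[((2, 1), 1), ((2, - 1), 1)]" "(1, 3)" "- 1" "wt (0, 3)"
    proof
      have pos: "0 < L (sg G1)" "0 < L (sg G2)"
        by (rule L_sg_pos)+
      show "wt (fst (chw idx u)) \<le> wt (0, 3)" if "u \<in> set ws23" for u
        using that pos by (auto simp: ws23_def simp del: sg.simps)
      show "eigen_check ws23 idx s" if "s \<in> set [G2, G3]" for s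
        using eigen23 that by (auto simp: list_all_iff)
    qed (auto simp: ws23_def op2_def)
    let ?p = "pt23 (1, 1, 0) (100, 0, 1)"
    have cv: "cv w = pnt_eval (x + y - 1) (y - 100) ?p"
      by (rule cv_pt23[OF w]) simp_all
    show ?thesis
    proof (rule operator_left_le[OF check2, of n "Some 4" ?p "map (\<lambda>u. firew u ?p) glides2" "x + y - 1" "y - 100" _ "firew u ?p"])
      show "\<exists>(b, p, ts)\<in>set pats2. \<exists>P Q. in_box b P Q \<and> cv z = pnt_eval P Q p" if z: "p23.dom z" "n < len z" for z
      proof -
        obtain x y u where c: "cv z = (x, y, u)"
          by (cases "cv z")
        have "0 < y" "0 < u"
          using z(1) by (simp_all add: p23.dom_def c)
        then obtain b p P Q where b: "(b, p) \<in> set base23" "in_box b P Q" "cv z = pnt_eval P Q p"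
          using cover23[OF c] n[OF c z(2)] by blast
        then have "\<exists>ts. (b, p, ts) \<in> set pats2"
          unfolding pats2_def by force
        then show ?thesis
          using b(2,3) by blast
      qed
      show "(Some 4, ?p, map (\<lambda>u. firew u ?p) glides2) \<in> set pats2"
        by (simp add: pats2_def base23_def)
      show "in_box (Some 4) (x + y - 1) (y - 100)"
        using pos big by simp
      show "p23.dom w"
        using pos big by (simp add: p23.dom_def w)
      show "firew u ?p \<in> set (map (\<lambda>u. firew u ?p) glides2)"
        using u by simp
      show "cv (word u * w) = pnt_eval (x + y - 1) (y - 100) (firew u ?p)"
        by (simp only: cv_word pnt_eval_firew cv)
      show "n + 24 < len (w23 * (word u * w))"
      proof -
        have "n + 40 < len w"
          using M[OF w] big by linarith
        moreover have "len w \<le> length u + len (word u * w)"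
          "len (word u * w) \<le> length [G2, G3, G2] + len (w23 * (word u * w))"
          by (rule len_word_ge)+
        moreover have "length u \<le> 5"
          using u by (auto simp: glides2_def)
        ultimately show ?thesis
          by simp
      qed
    qed (rule cv, auto simp: ws23_def)
  qed
  then show ?thesis
    by (intro exI[of _ "max 100 M + 7"]) blast
qed

subsection \<open>Ascending paths\<close>

fun asc :: "gen list \<Rightarrow> vec \<Rightarrow> bool" where
  "asc [] c \<longleftrightarrow> True"
| "asc (s # u) c \<longleftrightarrow> 0 < sval s (actw u c) \<and> asc u c"

lemma asc_append: "asc (u @ v) c \<longleftrightarrow> asc u (actw v c) \<and> asc v c"
  by (induction u) (auto simp: actw_append)

context weighted
begin

lemma left_le_asc: "asc u (cv w) \<Longrightarrow> left_le L (word u * w) w"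
proof (induction u)
  case (Cons s u)
  then have "len (word u * w) < len (sg s * (word u * w))"
    by (simp add: len_less_iff cv_word)
  then have "left_le L (sg s * (word u * w)) (word u * w)"
    by (rule left_le_up)
  then show ?case
    using Cons left_le_trans by (simp add: word_Cons mult.assoc)
qed (simp add: word_Nil)

lemma left_le_asc_append:
  assumes "asc (u @ v) (cv w)"
  shows "left_le L (word (u @ v) * w) (word v * w)" "left_le L (word v * w) w"
  using assms left_le_asc[of u "word v * w"] left_le_asc[of v w]
  by (simp_all add: asc_append cv_word word_append mult.assoc)

text \<open>Transfers the equivalence of the translates \<open>word t * z i\<close> to any other
  suffix \<open>u\<close> of \<open>v\<close>. Ascending from \<open>z i\<close> one passes through
  \<open>word u * z i\<close> and \<open>word t * z i\<close> on the way to
  \<open>word v * z i\<close>, and from there reaches \<open>z (Suc i)\<close>. The suffix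
  \<open>t\<close> may thus depend on the weights while \<open>u\<close> does not.\<close>

lemma strip_left_le:
  assumes up: "\<And>i. left_le L (z (Suc i)) (word v * z i)"
    and asc: "\<And>i. asc v (cv (z i))"
    and glide: "\<And>i. left_le L (word t * z (Suc i)) (word t * z i)" "\<And>i. left_le L (word t * z i) (word t * z (Suc i))"
    and u: "v = u' @ u" and t: "v = t' @ t"
  shows "left_le L (word u * z 1) (word u * z 2)" "left_le L (word u * z 2) (word u * z 1)"
proof -
  have v: "left_le L (word v * z i) (word u * z i)" "left_le L (word v * z i) (word t * z i)"
    and le: "left_le L (word u * z i) (z i)" "left_le L (word t * z i) (z i)" for i
    using left_le_asc_append[of u' u "z i"] left_le_asc_append[of t' t "z i"] asc[of i] u t by simp_all
  have i: "Suc 0 = 1" "Suc 1 = 2" "Suc 2 = 3"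
    by simp_all
  show "left_le L (word u * z 2) (word u * z 1)"
    using le(1)[of 2] up[of 1] v(1)[of 1] left_le_trans unfolding i by blast
  \<comment> \<open>The nontrivial direction: descend in the preorder from
    \<open>word u * z 2\<close> to \<open>word t * z 3\<close>, return to
    \<open>word t * z 0\<close> by three glide equivalences, and descend from there to
    \<open>word u * z 1\<close>.\<close>
  have "left_le L (word u * z 1) (word t * z 0)"
    using le(1)[of 1] up[of 0] v(2)[of 0] left_le_trans unfolding i by blast
  moreover have "left_le L (word t * z 0) (word t * z 3)"
    using glide(2)[of 0] glide(2)[of 1] glide(2)[of 2] left_le_trans unfolding i by blast
  moreover have "left_le L (word t * z 3) (word u * z 2)"
    using le(2)[of 3] up[of 2] v(1)[of 2] left_le_trans unfolding i by blast
  ultimately show "left_le L (word u * z 1) (word u * z 2)"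
    using left_le_trans by blast
qed

end

subsection \<open>Finitely many representatives\<close>

text \<open>Quantifying over \<open>L\<close> here is what lets a single finite set of
  representatives serve all weights.\<close>

definition equivalent :: "W \<Rightarrow> W \<Rightarrow> bool" where
  "equivalent w w' \<longleftrightarrow> (\<forall>L. weighted L \<longrightarrow> left_le L w w' \<and> left_le L w' w)"

lemma equivalent_refl [simp]: "equivalent w w"
  by (simp add: equivalent_def weighted.left_le_refl)

lemma equivalent_sym: "equivalent w w' \<Longrightarrow> equivalent w' w"
  by (simp add: equivalent_def)

lemma equivalent_trans: "equivalent w w' \<Longrightarrow> equivalent w' w'' \<Longrightarrow> equivalent w w''"
  unfolding equivalent_def using weighted.left_le_trans by blast

text \<open>Translations by (6, 0) and (0, 6). In each word the letters applied first are an
  alternating word of length five in \<open>s1\<close> and \<open>s2\<close>, so the path to the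
  translate runs through coset elements \<open>word u * w\<close>.\<close>

definition tr1 :: "gen list" where
  "tr1 = [G3, G2, G1, G2, G3, G1, G2, G1, G2, G1]"

definition tr2 :: "gen list" where
  "tr2 = [G3, G2, G1, G2, G1, G2]"

lemma cv_tr:
  assumes "cv w = (x, y, z)"
  shows "cv (word tr1 * w) = (x + 6, y, z - 18)" "cv (word tr2 * w) = (x, y + 6, z - 12)"
    "cv (word (rev tr1) * w) = (x - 6, y, z + 18)" "cv (word (rev tr2) * w) = (x, y - 6, z + 12)"
  using cv_level[OF assms] by (simp_all add: cv_word assms tr1_def tr2_def)

lemma cv_tr_power:
  assumes "cv w = (x, y, z)"
  shows "cv (word tr1 ^ i * w) = (x + 6 * int i, y, z - 18 * int i)"
    "cv (word tr2 ^ i * w) = (x, y + 6 * int i, z - 12 * int i)"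
  by (induction i) (simp_all add: assms cv_tr mult.assoc)

lemma word_eqI: "actw u (1, 1, 1) = actw v (1, 1, 1) \<Longrightarrow> word u = word v"
  by (simp only: cv_inject[symmetric] cv_word_one)

lemma word_rev: "word (rev u) * (word u * w) = w" "word u * (word (rev u) * w) = w"
proof -
  have inv: "word (rev v) * word v = 1" for v
    using word_eq_rev_append[of v] by (simp add: one_W_def W.abs_eq_iff flip: word_append)
  show "word (rev u) * (word u * w) = w" "word u * (word (rev u) * w) = w"
    using inv[of u] inv[of "rev u"] by (simp_all flip: mult.assoc)
qed

text \<open>\<open>eps_glide\<close> only concerns \<open>eps_top L\<close>, which varies with the
  weights. Two glides make the translation \<open>tr1\<close>, and \<open>strip_left_le\<close>
  extends the result to every suffix \<open>u\<close>.\<close>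

lemma strip_horizontal:
  "\<exists>M. \<forall>w x y z u. cv w = (x, y, z) \<longrightarrow> 0 < y \<longrightarrow> y < 6 \<longrightarrow> M \<le> x \<longrightarrow> (\<exists>u'. [G1, G2, G1, G2, G1] = u' @ u) \<longrightarrow>
    equivalent (word u * (word tr1 * w)) (word u * (word tr1 * (word tr1 * w)))"
proof -
  obtain M where M: "\<And>L x y z w u. weighted L \<Longrightarrow> cv w = (x, y, z) \<Longrightarrow> 0 < y \<Longrightarrow> y < 6 \<Longrightarrow> M \<le> x \<Longrightarrow> u \<in> set glides1 \<Longrightarrow>
    left_le L (word (eps_top L) * (word u * w)) (word (eps_top L) * w)"
    using eps_glide by blast
  have "equivalent (word u * (word tr1 * w)) (word u * (word tr1 * (word tr1 * w)))"
    if w: "cv w = (x, y, z)" and y: "0 < y" "y < 6" and x: "max 20 M \<le> x"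
      and u: "[G1, G2, G1, G2, G1] = u' @ u" for w x y z u u'
  proof -
    let ?v = "[G1, G2, G1, G2, G1]" and ?g = "[G3, G2, G1, G2, G1]" and ?h = "[G1, G2, G1, G2, G3]"
    have "left_le L (word u * (word tr1 ^ 1 * w)) (word u * (word tr1 ^ 2 * w)) \<and>
        left_le L (word u * (word tr1 ^ 2 * w)) (word u * (word tr1 ^ 1 * w))" if L: "weighted L" for L
    proof -
      interpret weighted L
        by (rule L)
      note cv = cv_tr_power(1)[OF w]
      have Suc: "word tr1 ^ Suc i * w = word tr1 * (word tr1 ^ i * w)" for i
        by (simp add: mult.assoc)
      have level: "z - 18 * int i = 6 - 3 * (x + 6 * int i) - 2 * y" for i
        using cv_level[OF w] by simp
      have asc: "asc ?v (cv (word tr1 ^ i * w))" for i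
        using x y unfolding cv level by simp
      have up: "left_le L (word tr1 ^ Suc i * w) (word ?v * (word tr1 ^ i * w))" for i
      proof -
        have "asc [G3, G2, G1, G2, G3] (cv (word ?v * (word tr1 ^ i * w)))"
          using x y unfolding cv_word cv level by simp
        moreover have "word tr1 * v = word [G3, G2, G1, G2, G3] * (word ?v * v)" for v
          by (simp only: tr1_def mult.assoc[symmetric] word_append[symmetric] append.simps)
        ultimately show ?thesis
          unfolding Suc by (simp only: left_le_asc)
      qed
      have gg: "word ?g * (word ?g * v) = word tr1 * v" "word ?h * (word ?h * (word tr1 * v)) = v"
        "word ?h * (word tr1 * v) = word ?g * v" for v
      proof -
        have "word (?g @ ?g) = word tr1"
          by (rule word_eqI) (simp add: tr1_def)
        then show g: "word ?g * (word ?g * v) = word tr1 * v"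
          by (simp only: word_append mult.assoc[symmetric])
        have h: "?h = rev ?g"
          by simp
        show "word ?h * (word ?h * (word tr1 * v)) = v" "word ?h * (word tr1 * v) = word ?g * v"
          by (simp_all only: h g[symmetric] word_rev)
      qed
      have glide: "left_le L (word (eps_top L) * (word tr1 * v)) (word (eps_top L) * v)"
        "left_le L (word (eps_top L) * v) (word (eps_top L) * (word tr1 * v))"
        if v: "cv v = (x + 6 * int i, y, z - 18 * int i)" for v i
      proof -
        have cg: "cv (word ?g * v) = (x + y + 6 * int i, 6 - y, z - 18 * int i + y - 12)"
          unfolding cv_word v level by simp
        have ct: "cv (word tr1 * v) = (x + 6 * int i + 6, y, z - 18 * int i - 18)"
          by (rule cv_tr(1)[OF v])
        have gl: "?g \<in> set glides1" "?h \<in> set glides1"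
          by (simp_all add: glides1_def)
        have 1: "left_le L (word (eps_top L) * (word ?g * v)) (word (eps_top L) * v)"
          by (rule M[OF L v y _ gl(1)]) (use x in simp)
        have 2: "left_le L (word (eps_top L) * (word ?g * (word ?g * v))) (word (eps_top L) * (word ?g * v))"
          by (rule M[OF L cg _ _ _ gl(1)]) (use x y in simp_all)
        have 3: "left_le L (word (eps_top L) * (word ?h * (word tr1 * v))) (word (eps_top L) * (word tr1 * v))"
          by (rule M[OF L ct y _ gl(2)]) (use x in simp)
        have 4: "left_le L (word (eps_top L) * (word ?h * (word ?g * v))) (word (eps_top L) * (word ?g * v))"
          by (rule M[OF L cg _ _ _ gl(2)]) (use x y in simp_all)
        have hg: "word ?h * (word ?g * v) = v"
          using word_rev(1)[of ?g v] by simp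
        show "left_le L (word (eps_top L) * (word tr1 * v)) (word (eps_top L) * v)"
          using left_le_trans[OF 2 1] by (simp only: gg)
        show "left_le L (word (eps_top L) * v) (word (eps_top L) * (word tr1 * v))"
          using left_le_trans[OF 4[unfolded hg] 3[unfolded gg(3)]] .
      qed
      have t: "\<exists>t'. ?v = t' @ eps_top L"
        by (simp add: eps_top_def)
      then obtain t' where t': "?v = t' @ eps_top L"
        by blast
      note s = strip_left_le[where z = "\<lambda>i. word tr1 ^ i * w" and v = ?v and t = "eps_top L", OF up asc _ _ u t']
      show ?thesis
        using s glide[OF cv] unfolding Suc by blast
    qed
    then show ?thesis
      by (simp add: equivalent_def power2_eq_square mult.assoc)
  qed
  then show ?thesis
    by (intro exI[of _ "max 20 M"]) blast
qed

text \<open>The glide operator belongs to \<open>s2\<close> and \<open>s3\<close>, but the strip 0 <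
  x < 6 lies in the chamber of \<open>s1\<close> and \<open>s2\<close>. Multiplication by
  \<open>word [G2, G3]\<close> moves it to the strip of \<open>w23_glide\<close> and intertwines
  \<open>tr2\<close> with the square of the glide; since
  \<open>w23 * (word [G2, G3] * v) = word [G2] * v\<close>, the result concerns the suffix
  \<open>[G2]\<close>.\<close>

lemma strip_vertical:
  "\<exists>M. \<forall>w x y z u. cv w = (x, y, z) \<longrightarrow> 0 < x \<longrightarrow> x < 6 \<longrightarrow> M \<le> y \<longrightarrow> (\<exists>u'. [G2, G1, G2, G1, G2] = u' @ u) \<longrightarrow>
    equivalent (word u * (word tr2 * w)) (word u * (word tr2 * (word tr2 * w)))"
proof -
  obtain M where M: "\<And>L x y z w u. weighted L \<Longrightarrow> cv w = (x, y, z) \<Longrightarrow> 0 < y \<Longrightarrow> 0 < z \<Longrightarrow> 0 < x + y \<Longrightarrow> x + y < 6 \<Longrightarrow>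
    M \<le> y \<Longrightarrow> u \<in> set glides2 \<Longrightarrow> left_le L (w23 * (word u * w)) (w23 * w)"
    using w23_glide by blast
  have "equivalent (word u * (word tr2 * w)) (word u * (word tr2 * (word tr2 * w)))"
    if w: "cv w = (x, y, z)" and x: "0 < x" "x < 6" and y: "max 20 M + 20 \<le> y"
      and u: "[G2, G1, G2, G1, G2] = u' @ u" for w x y z u u'
  proof -
    let ?v = "[G2, G1, G2, G1, G2]" and ?g = "[G1, G2, G3]" and ?h = "[G3, G2, G1]" and ?d = "[G2, G3]"
    have y': "40 \<le> y" "M + 20 \<le> y"
      using y by simp_all
    have "left_le L (word u * (word tr2 ^ 1 * w)) (word u * (word tr2 ^ 2 * w)) \<and>
        left_le L (word u * (word tr2 ^ 2 * w)) (word u * (word tr2 ^ 1 * w))" if L: "weighted L" for L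
    proof -
      interpret weighted L
        by (rule L)
      note cv = cv_tr_power(2)[OF w]
      have Suc: "word tr2 ^ Suc i * w = word tr2 * (word tr2 ^ i * w)" for i
        by (simp add: mult.assoc)
      have level: "z - 12 * int i = 6 - 3 * x - 2 * (y + 6 * int i)" for i
        using cv_level[OF w] by simp
      have asc: "asc ?v (cv (word tr2 ^ i * w))" for i
        using x y' unfolding cv level by simp
      have up: "left_le L (word tr2 ^ Suc i * w) (word ?v * (word tr2 ^ i * w))" for i
      proof -
        have "asc [G3] (cv (word ?v * (word tr2 ^ i * w)))"
          using x y' unfolding cv_word cv level by simp
        moreover have "word tr2 * v = word [G3] * (word ?v * v)" for v
          by (simp only: tr2_def mult.assoc[symmetric] word_append[symmetric] append.simps)
        ultimately show ?thesis
          unfolding Suc by (simp only: left_le_asc)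
      qed
      have w23d: "w23 * (word ?d * v) = word [G2] * v" for v
      proof -
        have "word ([G2, G3, G2] @ ?d) = word [G2]"
          by (rule word_eqI) simp
        then show ?thesis
          by (simp only: word_append mult.assoc[symmetric])
      qed
      have gg: "word ?g * (word ?g * (word ?d * v)) = word ?d * (word tr2 * v)" for v
      proof -
        have "word (?g @ ?g @ ?d) = word (?d @ tr2)"
          by (rule word_eqI) (simp add: tr2_def)
        then show ?thesis
          by (simp only: word_append mult.assoc[symmetric])
      qed
      have glide: "left_le L (word [G2] * (word tr2 * v)) (word [G2] * v)"
        "left_le L (word [G2] * v) (word [G2] * (word tr2 * v))"
        if v: "cv v = (x, y + 6 * int i, z - 12 * int i)" for v i
      proof -
        define d where "d = word ?d * v"
        have cd: "cv d = (6 - 2 * x - (y + 6 * int i), 3 * x + (y + 6 * int i) - 6, y + 6 * int i)"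
          unfolding d_def cv_word v level by simp
        have cg: "cv (word ?g * d) = (- x - (y + 6 * int i), y + 6 * int i + 6, 3 * x + (y + 6 * int i) - 6)"
          unfolding cv_word cd by simp
        have cgg: "cv (word ?g * (word ?g * d)) = (- 2 * x - (y + 6 * int i), 3 * x + (y + 6 * int i), y + 6 * int i + 6)"
          unfolding cv_word cd by simp
        have gl: "?g \<in> set glides2" "?h \<in> set glides2"
          by (simp_all add: glides2_def)
        have 1: "left_le L (w23 * (word ?g * d)) (w23 * d)"
          by (rule M[OF L cd _ _ _ _ _ gl(1)]) (use x y' in simp_all)
        have 2: "left_le L (w23 * (word ?g * (word ?g * d))) (w23 * (word ?g * d))"
          by (rule M[OF L cg _ _ _ _ _ gl(1)]) (use x y' in simp_all)
        have 3: "left_le L (w23 * (word ?h * (word ?g * (word ?g * d)))) (w23 * (word ?g * (word ?g * d)))"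
          by (rule M[OF L cgg _ _ _ _ _ gl(2)]) (use x y' in simp_all)
        have 4: "left_le L (w23 * (word ?h * (word ?g * d))) (w23 * (word ?g * d))"
          by (rule M[OF L cg _ _ _ _ _ gl(2)]) (use x y' in simp_all)
        have hg: "word ?h * (word ?g * a) = a" for a
          using word_rev(1)[of ?g a] by simp
        have ggd: "w23 * (word ?g * (word ?g * d)) = word [G2] * (word tr2 * v)"
          by (simp only: d_def gg w23d)
        have wd: "w23 * d = word [G2] * v"
          by (simp only: d_def w23d)
        show "left_le L (word [G2] * (word tr2 * v)) (word [G2] * v)"
          using left_le_trans[OF 2 1] by (simp only: ggd wd)
        show "left_le L (word [G2] * v) (word [G2] * (word tr2 * v))"
          using left_le_trans[OF 4[unfolded hg] 3[unfolded hg]] by (simp only: ggd wd)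
      qed
      have t': "?v = [G2, G1, G2, G1] @ [G2]"
        by simp
      note s = strip_left_le[where z = "\<lambda>i. word tr2 ^ i * w" and v = ?v and t = "[G2]", OF up asc _ _ u t']
      show ?thesis
        using s glide[OF cv] unfolding Suc by blast
    qed
    then show ?thesis
      by (simp add: equivalent_def power2_eq_square mult.assoc)
  qed
  then show ?thesis
    by (intro exI[of _ "max 20 M + 20"]) blast
qed

text \<open>\<open>dirs\<close> is closed under negation, so \<open>w12_shift\<close> also applies
  from \<open>w'\<close> to \<open>w\<close>; the extra 6 keeps \<open>w'\<close> beyond the
  threshold.\<close>

lemma equivalent_shift:
  "\<exists>M. \<forall>w w' x y z d d' z'. cv w = (x, y, z) \<longrightarrow> cv w' = (x + d, y + d', z') \<longrightarrow> 0 < x \<longrightarrow> 0 < y \<longrightarrow>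
    0 < x + d \<longrightarrow> 0 < y + d' \<longrightarrow> M \<le> x \<or> M \<le> y \<longrightarrow> (d, d') \<in> set dirs \<longrightarrow> equivalent (w12 * w) (w12 * w')"
proof -
  obtain M where M: "\<And>L x y z d d' w w' z'. weighted L \<Longrightarrow> cv w = (x, y, z) \<Longrightarrow> cv w' = (x + d, y + d', z') \<Longrightarrow>
    0 < x \<Longrightarrow> 0 < y \<Longrightarrow> 0 < x + d \<Longrightarrow> 0 < y + d' \<Longrightarrow> M \<le> x \<or> M \<le> y \<Longrightarrow> (d, d') \<in> set dirs \<Longrightarrow>
    left_le L (w12 * w') (w12 * w)"
    using w12_shift by blast
  have "equivalent (w12 * w) (w12 * w')"
    if w: "cv w = (x, y, z)" "cv w' = (x + d, y + d', z')" and pos: "0 < x" "0 < y" "0 < x + d" "0 < y + d'"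
      and big: "M + 6 \<le> x \<or> M + 6 \<le> y" and d: "(d, d') \<in> set dirs" for w w' x y z d d' z'
    unfolding equivalent_def
  proof (intro allI impI conjI)
    fix L assume L: "weighted L"
    show "left_le L (w12 * w') (w12 * w)"
      by (rule M[OF L w pos _ d]) (use big in linarith)
    have d_bound: "- 6 \<le> d" "- 6 \<le> d'" and d': "(- d, - d') \<in> set dirs"
      using d by (auto simp: dirs_def)
    have cw: "cv w = (x + d + - d, y + d' + - d', z)"
      by (simp add: w(1))
    show "left_le L (w12 * w) (w12 * w')"
      by (rule M[OF L w(2) cw pos(3,4) _ _ _ d']) (use pos big d_bound in linarith)+
  qed
  then show ?thesis
    by (intro exI[of _ "M + 6"]) blast
qed

definition bounded :: "int \<Rightarrow> W \<Rightarrow> bool" where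
  "bounded M w \<longleftrightarrow> (\<exists>x y z. cv w = (x, y, z) \<and> 0 < x \<and> x \<le> M \<and> 0 < y \<and> y \<le> M)"

text \<open>Both shifts (0, -6) and (-6, 6) decrease 2 x + y. As long as a point is outside the box,
  one of them stays in the chamber: the first if y > 6, the second if y is small and hence x is
  large.\<close>

lemma w12_reduce:
  "\<exists>M. \<forall>w x y z. cv w = (x, y, z) \<longrightarrow> 0 < x \<longrightarrow> 0 < y \<longrightarrow> (\<exists>w'. bounded M w' \<and> equivalent (w12 * w) (w12 * w'))"
proof -
  obtain M where M: "\<And>w w' x y z d d' z'. cv w = (x, y, z) \<Longrightarrow> cv w' = (x + d, y + d', z') \<Longrightarrow> 0 < x \<Longrightarrow> 0 < y \<Longrightarrow>
    0 < x + d \<Longrightarrow> 0 < y + d' \<Longrightarrow> M \<le> x \<or> M \<le> y \<Longrightarrow> (d, d') \<in> set dirs \<Longrightarrow> equivalent (w12 * w) (w12 * w')"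
    using equivalent_shift by blast
  define N where "N = max M 0 + 12"
  have "\<exists>w'. bounded N w' \<and> equivalent (w12 * w) (w12 * w')"
    if "cv w = (x, y, z)" "0 < x" "0 < y" for w x y z
    using that
  proof (induction "nat (2 * x + y)" arbitrary: w x y z rule: less_induct)
    case less
    have N: "0 \<le> N" "M + 12 \<le> N" "12 \<le> N"
      by (simp_all add: N_def)
    consider "x \<le> N" "y \<le> N" | "6 < y" "N < x \<or> N < y" | "y \<le> 6" "N < x"
      using N by linarith
    then show ?case
    proof cases
      case 1
      then have "bounded N w"
        using less.prems by (auto simp: bounded_def)
      then show ?thesis
        using equivalent_refl by blast
    next
      case 2
      let ?v = "word (rev tr2) * w"
      have v: "cv ?v = (x, y - 6, z + 12)"
        by (rule cv_tr(4)[OF less.prems(1)])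
      obtain w' where "bounded N w'" "equivalent (w12 * ?v) (w12 * w')"
        using less.hyps[OF _ v] less.prems(2,3) 2(1) by auto
      moreover have "equivalent (w12 * w) (w12 * ?v)"
        by (rule M[OF less.prems(1), of _ 0 "- 6" "z + 12"])
          (use v less.prems(2,3) 2 N in \<open>auto simp: dirs_def\<close>)
      ultimately show ?thesis
        using equivalent_trans by blast
    next
      case 3
      let ?v = "word (rev tr1) * (word tr2 * w)"
      have v: "cv ?v = (x - 6, y + 6, z - 12 + 18)"
        by (rule cv_tr(3)[OF cv_tr(2)[OF less.prems(1)]])
      obtain w' where "bounded N w'" "equivalent (w12 * ?v) (w12 * w')"
        using less.hyps[OF _ v] less.prems(2,3) 3 N by auto
      moreover have "equivalent (w12 * w) (w12 * ?v)"
        by (rule M[OF less.prems(1), of _ "- 6" 6 "z - 12 + 18"])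
          (use v less.prems(2,3) 3 N in \<open>auto simp: dirs_def\<close>)
      ultimately show ?thesis
        using equivalent_trans by blast
    qed
  qed
  then show ?thesis
    by blast
qed

lemma asc_w12: "cv w = (x, y, z) \<Longrightarrow> 0 < x \<Longrightarrow> 0 < y \<Longrightarrow> asc [G1, G2, G1, G2, G1, G2] (cv w) \<and> asc [G2, G1, G2, G1, G2, G1] (cv w)"
  by simp

lemma w12_eq: "word [G2, G1, G2, G1, G2, G1] = w12"
  by (rule word_eqI) simp

lemma ws12_suffix:
  "u \<in> set ws12 \<Longrightarrow> (\<exists>u'. [G1, G2, G1, G2, G1, G2] = u' @ u) \<or> (\<exists>u'. [G2, G1, G2, G1, G2, G1] = u' @ u)"
  by (auto simp: ws12_def)

lemma (in weighted) w12_left_le: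
  assumes u: "u \<in> set ws12" and w: "cv w = (x, y, z)" "0 < x" "0 < y"
  shows "left_le L (w12 * w) (word u * w)" "left_le L (word u * w) w"
proof -
  have "left_le L (w12 * w) (word u * w) \<and> left_le L (word u * w) w"
    using ws12_suffix[OF u]
  proof (elim disjE exE)
    fix u' assume "[G1, G2, G1, G2, G1, G2] = u' @ u"
    then show ?thesis
      using left_le_asc_append[of u' u w] asc_w12[OF w] by metis
  next
    fix u' assume "[G2, G1, G2, G1, G2, G1] = u' @ u"
    then show ?thesis
      using left_le_asc_append[of u' u w] asc_w12[OF w] w12_eq by metis
  qed
  then show "left_le L (w12 * w) (word u * w)" "left_le L (word u * w) w"
    by blast+
qed

text \<open>Outside the boundary strips every element lies between \<open>w12 * w\<close> and \<open>w12 * w'\<close> for a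
  translate \<open>w'\<close> of \<open>w\<close>.\<close>

lemma equivalent_w12:
  "\<exists>M. \<forall>u w x y z. cv w = (x, y, z) \<longrightarrow> 0 < x \<longrightarrow> 0 < y \<longrightarrow> M \<le> x \<or> M \<le> y \<longrightarrow> u \<in> set ws12 \<longrightarrow>
    6 < x \<or> (\<exists>v. u = v @ [G1]) \<longrightarrow> 6 < y \<or> (\<exists>v. u = v @ [G2]) \<longrightarrow> equivalent (word u * w) (w12 * w)"
proof -
  obtain M where M: "\<And>w w' x y z d d' z'. cv w = (x, y, z) \<Longrightarrow> cv w' = (x + d, y + d', z') \<Longrightarrow> 0 < x \<Longrightarrow> 0 < y \<Longrightarrow>
    0 < x + d \<Longrightarrow> 0 < y + d' \<Longrightarrow> M \<le> x \<or> M \<le> y \<Longrightarrow> (d, d') \<in> set dirs \<Longrightarrow> equivalent (w12 * w) (w12 * w')"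
    using equivalent_shift by blast
  have "equivalent (word u * w) (w12 * w)"
    if w: "cv w = (x, y, z)" "0 < x" "0 < y" and big: "M + 20 \<le> x \<or> M + 20 \<le> y" and u: "u \<in> set ws12"
      and ux: "6 < x \<or> (\<exists>v. u = v @ [G1])" and uy: "6 < y \<or> (\<exists>v. u = v @ [G2])" for u w x y z
  proof -
    define a where "a = word (rev tr2) * w"
    have a: "cv a = (x, y - 6, z + 12)"
      unfolding a_def by (rule cv_tr(4)[OF w(1)])
    define b where "b = word (rev tr1) * w"
    have b: "cv b = (x - 6, y, z + 18)"
      unfolding b_def by (rule cv_tr(3)[OF w(1)])
    define c where "c = word (rev tr1) * a"
    have c: "cv c = (x - 6, y - 6, z + 12 + 18)"
      unfolding c_def by (rule cv_tr(3)[OF a])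
    have down2: "equivalent (w12 * w) (w12 * a)" if "6 < y"
      by (rule M[OF w(1), of _ 0 "- 6" "z + 12"]) (use a w(2,3) that big in \<open>auto simp: dirs_def\<close>)
    have down1: "equivalent (w12 * w) (w12 * b)" if "6 < x"
    proof -
      define d where "d = word tr2 * b"
      have d: "cv d = (x - 6, y + 6, z + 18 - 12)"
        unfolding d_def by (rule cv_tr(2)[OF b])
      have "equivalent (w12 * w) (w12 * d)"
        by (rule M[OF w(1), of _ "- 6" 6 "z + 18 - 12"]) (use d w(2,3) that big in \<open>auto simp: dirs_def\<close>)
      moreover have "equivalent (w12 * d) (w12 * b)"
        by (rule M[OF d, of _ 0 "- 6" "z + 18"]) (use b w(2,3) that big in \<open>auto simp: dirs_def\<close>)
      ultimately show ?thesis
        using equivalent_trans by blast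
    qed
    have down12: "equivalent (w12 * a) (w12 * c)" if "6 < x" "6 < y"
    proof -
      define d where "d = word tr2 * c"
      have d: "cv d = (x - 6, y - 6 + 6, z + 12 + 18 - 12)"
        unfolding d_def by (rule cv_tr(2)[OF c])
      have "equivalent (w12 * a) (w12 * d)"
        by (rule M[OF a, of _ "- 6" 6 "z + 12 + 18 - 12"]) (use d w(2,3) that big in \<open>auto simp: dirs_def\<close>)
      moreover have "equivalent (w12 * d) (w12 * c)"
        by (rule M[OF d, of _ 0 "- 6" "z + 12 + 18"]) (use c w(2,3) that big in \<open>auto simp: dirs_def\<close>)
      ultimately show ?thesis
        using equivalent_trans by blast
    qed
    have "left_le L (word u * w) (w12 * w) \<and> left_le L (w12 * w) (word u * w)" if L: "weighted L" for L
    proof -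
      interpret weighted L
        by (rule L)
      have eq: "left_le L p q" "left_le L q p" if "equivalent p q" for p q
        using that L by (simp_all add: equivalent_def)
      note uw = w12_left_le[OF u w]
      consider "6 < x" "6 < y" | v where "x \<le> 6" "6 < y" "u = v @ [G1]" | v where "6 < x" "y \<le> 6" "u = v @ [G2]"
        | "x \<le> 6" "y \<le> 6"
        using ux uy by fastforce
      then have "left_le L (word u * w) (w12 * w)"
      proof cases
        case 1
        \<comment> \<open>With room in both directions, \<open>w\<close> itself lies on an ascending
          path from \<open>w12 * c\<close>, so \<open>word u * w\<close> is below an element
          equivalent to \<open>w12 * w\<close>.\<close>
        have "asc [G3, G2, G1, G2, G3, G1, G2, G1, G2, G3] (cv (w12 * c))"
          using 1 cv_level[OF w(1)] by (simp add: cv_word c)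
        then have "left_le L (word [G3, G2, G1, G2, G3, G1, G2, G1, G2, G3] * (w12 * c)) (w12 * c)"
          by (rule left_le_asc)
        moreover have "word [G3, G2, G1, G2, G3, G1, G2, G1, G2, G3] * (w12 * c) = w"
          by (rule iffD1[OF cv_inject]) (use cv_level[OF w(1)] in \<open>simp add: cv_word c w(1)\<close>)
        moreover have "equivalent (w12 * w) (w12 * c)"
          using down2 down12 1 equivalent_trans by blast
        ultimately show ?thesis
          using uw(2) eq left_le_trans by metis
      next
        case (2 v)
        \<comment> \<open>Here the shift of \<open>x\<close> would leave the chamber. Since
          \<open>u\<close> applies \<open>G1\<close> first, it is enough to bound
          \<open>word [G1] * w\<close>, which is one ascent above \<open>w12 * a\<close>.\<close>
        have "asc u (cv w)"
          using ws12_suffix[OF u] asc_w12[OF w] by (metis asc_append)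
        then have "left_le L (word u * w) (word [G1] * w)"
          using 2(3) left_le_asc_append(1)[of v "[G1]" w] by simp
        moreover have "asc [G3] (cv (w12 * a))"
          using 2 w(2) cv_level[OF w(1)] by (simp add: cv_word a)
        then have "left_le L (word [G3] * (w12 * a)) (w12 * a)"
          by (rule left_le_asc)
        moreover have "word [G3] * (w12 * a) = word [G1] * w"
          by (rule iffD1[OF cv_inject]) (use cv_level[OF w(1)] in \<open>simp add: cv_word a w(1)\<close>)
        ultimately show ?thesis
          using down2 2(2) eq left_le_trans by metis
      next
        case (3 v)
        have "asc u (cv w)"
          using ws12_suffix[OF u] asc_w12[OF w] by (metis asc_append)
        then have "left_le L (word u * w) (word [G2] * w)"
          using 3(3) left_le_asc_append(1)[of v "[G2]" w] by simp
        moreover have "asc [G3, G2, G1, G2, G3] (cv (w12 * b))"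
          using 3 w(3) cv_level[OF w(1)] by (simp add: cv_word b)
        then have "left_le L (word [G3, G2, G1, G2, G3] * (w12 * b)) (w12 * b)"
          by (rule left_le_asc)
        moreover have "word [G3, G2, G1, G2, G3] * (w12 * b) = word [G2] * w"
          by (rule iffD1[OF cv_inject]) (use cv_level[OF w(1)] in \<open>simp add: cv_word b w(1)\<close>)
        ultimately show ?thesis
          using down1 3(1) eq left_le_trans by metis
      next
        case 4
        then show ?thesis
          using ux uy by fastforce
      qed
      then show ?thesis
        using uw(1) by blast
    qed
    then show ?thesis
      by (simp add: equivalent_def)
  qed
  then show ?thesis
    by (intro exI[of _ "M + 20"]) blast
qed

lemma ws12_cases:
  "u \<in> set ws12 \<Longrightarrow> u = [G1, G2, G1, G2, G1, G2] \<or>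
    (\<exists>u'. [G2, G1, G2, G1, G2] = u' @ u) \<and> ((\<exists>v. u = v @ [G2]) \<or> u = []) \<or>
    (\<exists>u'. [G1, G2, G1, G2, G1] = u' @ u) \<and> ((\<exists>v. u = v @ [G1]) \<or> u = [])"
  by (auto simp: ws12_def)

text \<open>A distant \<open>word u * w\<close> is either equivalent to \<open>w12 * w\<close> and
  is reduced in the chamber, or \<open>w\<close> lies in a strip along a wall that the first letter
  applied by \<open>u\<close> does not cross; then translation back along the strip decreases the
  coordinates.\<close>

theorem finite_representatives: "\<exists>K. finite K \<and> (\<forall>w. \<exists>k\<in>K. equivalent w k)"
proof -
  obtain M1 where M1: "\<And>w x y z u u'. cv w = (x, y, z) \<Longrightarrow> 0 < y \<Longrightarrow> y < 6 \<Longrightarrow> M1 \<le> x \<Longrightarrow>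
    [G1, G2, G1, G2, G1] = u' @ u \<Longrightarrow> equivalent (word u * (word tr1 * w)) (word u * (word tr1 * (word tr1 * w)))"
    using strip_horizontal by blast
  obtain M2 where M2: "\<And>w x y z u u'. cv w = (x, y, z) \<Longrightarrow> 0 < x \<Longrightarrow> x < 6 \<Longrightarrow> M2 \<le> y \<Longrightarrow>
    [G2, G1, G2, G1, G2] = u' @ u \<Longrightarrow> equivalent (word u * (word tr2 * w)) (word u * (word tr2 * (word tr2 * w)))"
    using strip_vertical by blast
  obtain M3 where M3: "\<And>w x y z. cv w = (x, y, z) \<Longrightarrow> 0 < x \<Longrightarrow> 0 < y \<Longrightarrow> \<exists>w'. bounded M3 w' \<and> equivalent (w12 * w) (w12 * w')"
    using w12_reduce by blast
  obtain M4 where M4: "\<And>u w x y z. cv w = (x, y, z) \<Longrightarrow> 0 < x \<Longrightarrow> 0 < y \<Longrightarrow> M4 \<le> x \<or> M4 \<le> y \<Longrightarrow> u \<in> set ws12 \<Longrightarrow>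
    6 < x \<or> (\<exists>v. u = v @ [G1]) \<Longrightarrow> 6 < y \<or> (\<exists>v. u = v @ [G2]) \<Longrightarrow> equivalent (word u * w) (w12 * w)"
    using equivalent_w12 by blast
  define M where "M = max (max 6 M3) (max M4 (max M1 M2)) + 12"
  have M: "M1 + 12 \<le> M" "M2 + 12 \<le> M" "M3 \<le> M" "M4 \<le> M" "6 < M" "18 \<le> M"
    by (simp_all add: M_def)
  have reduce: "\<exists>u'\<in>set ws12. \<exists>w'. bounded M w' \<and> equivalent (word u * w) (word u' * w')"
    if w: "cv w = (x, y, z)" "0 < x" "0 < y" and u: "u \<in> set ws12" for u w x y z
    using w
  proof (induction "nat (x + y)" arbitrary: w x y z rule: less_induct)
    case less
    note w = less.prems
    have w0: "[G1, G2, G1, G2, G1, G2] \<in> set ws12"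
      by (simp add: ws12_def)
    have c0: ?case if "equivalent (word u * w) (w12 * w)"
    proof -
      obtain w' where w': "bounded M3 w'" "equivalent (w12 * w) (w12 * w')"
        using M3[OF w] by blast
      have "bounded M w'"
        using w'(1) M(3) by (force simp: bounded_def)
      then show ?thesis
        using w0 w'(2) that equivalent_trans by blast
    qed
    have ne: "x \<noteq> 6" "y \<noteq> 6"
      using cv_residues[OF w(1)] by auto
    consider "x \<le> M" "y \<le> M" | "M < x \<or> M < y" "6 < x \<or> (\<exists>v. u = v @ [G1])" "6 < y \<or> (\<exists>v. u = v @ [G2])"
      | "M < y" "x < 6" "\<not> (\<exists>v. u = v @ [G1])" | "M < x" "y < 6" "\<not> (\<exists>v. u = v @ [G2])"
      using ne M(5) by (meson linorder_neqE_linordered_idom not_le order.strict_trans)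
    then show ?case
    proof cases
      case 1
      then have "bounded M w"
        using w by (auto simp: bounded_def)
      then show ?thesis
        using u equivalent_refl by blast
    next
      case 2
      then show ?thesis
        using M4[OF w _ u] M(4) by (intro c0) auto
    next
      case 3
      show ?thesis
      proof (cases "u = [G1, G2, G1, G2, G1, G2]")
        case True
        then show ?thesis
          using c0 by simp
      next
        case False
        then obtain u' where u': "[G2, G1, G2, G1, G2] = u' @ u"
          using ws12_cases[OF u] 3(3) by force
        define a where "a = word (rev tr2) * w"
        have a: "cv a = (x, y - 6, z + 12)"
          unfolding a_def by (rule cv_tr(4)[OF w(1)])
        \<comment> \<open>The strip lemma compares the first and second translates of its argument,
          so it must be applied two steps behind \<open>w\<close>.\<close>
        define b where "b = word (rev tr2) * a"
        have b: "cv b = (x, y - 6 - 6, z + 12 + 12)"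
          unfolding b_def by (rule cv_tr(4)[OF a])
        have "equivalent (word u * (word tr2 * b)) (word u * (word tr2 * (word tr2 * b)))"
          by (rule M2[OF b w(2) 3(2) _ u']) (use 3(1) M(2) in linarith)
        moreover have "word tr2 * b = a" "word tr2 * a = w"
          by (simp_all only: a_def b_def word_rev)
        ultimately have "equivalent (word u * w) (word u * a)"
          using equivalent_sym by simp
        moreover have "\<exists>u'\<in>set ws12. \<exists>w'. bounded M w' \<and> equivalent (word u * a) (word u' * w')"
          by (rule less.hyps[OF _ a]) (use w 3(1) M(6) in linarith)+
        ultimately show ?thesis
          using equivalent_trans by blast
      qed
    next
      case 4
      show ?thesis
      proof (cases "u = [G1, G2, G1, G2, G1, G2]")
        case True
        then show ?thesis
          using c0 by simp
      next
        case False
        then obtain u' where u': "[G1, G2, G1, G2, G1] = u' @ u"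
          using ws12_cases[OF u] 4(3) by force
        define a where "a = word (rev tr1) * w"
        have a: "cv a = (x - 6, y, z + 18)"
          unfolding a_def by (rule cv_tr(3)[OF w(1)])
        define b where "b = word (rev tr1) * a"
        have b: "cv b = (x - 6 - 6, y, z + 18 + 18)"
          unfolding b_def by (rule cv_tr(3)[OF a])
        have "equivalent (word u * (word tr1 * b)) (word u * (word tr1 * (word tr1 * b)))"
          by (rule M1[OF b w(3) 4(2) _ u']) (use 4(1) M(1) in linarith)
        moreover have "word tr1 * b = a" "word tr1 * a = w"
          by (simp_all only: a_def b_def word_rev)
        ultimately have "equivalent (word u * w) (word u * a)"
          using equivalent_sym by simp
        moreover have "\<exists>u'\<in>set ws12. \<exists>w'. bounded M w' \<and> equivalent (word u * a) (word u' * w')"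
          by (rule less.hyps[OF _ a]) (use w 4(1) M(6) in linarith)+
        ultimately show ?thesis
          using equivalent_trans by blast
      qed
    qed
  qed
  define K where "K = (\<lambda>(u, w). word u * w) ` (set ws12 \<times> {w. bounded M w})"
  have "{w. bounded M w} \<subseteq> {w. \<exists>x y z. cv w = (x, y, z) \<and> \<bar>x\<bar> \<le> M \<and> \<bar>y\<bar> \<le> M}"
    by (force simp: bounded_def)
  then have "finite {w. bounded M w}"
    using finite_bounded_cv finite_subset by blast
  then have "finite K"
    by (simp add: K_def)
  moreover have "\<exists>k\<in>K. equivalent w k" for w
  proof -
    obtain u v where uv: "u \<in> set ws12" "p12.dom v" "w = word u * v"
      using p12.decompose by blast
    obtain x y z where v: "cv v = (x, y, z)"
      by (cases "cv v")
    have "0 < x" "0 < y"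
      using uv(2) by (simp_all add: p12.dom_def v)
    then obtain u' w' where w': "u' \<in> set ws12" "bounded M w'" "equivalent w (word u' * w')"
      using reduce[OF v _ _ uv(1)] uv(3) by blast
    then have "word u' * w' \<in> K"
      unfolding K_def by (intro image_eqI[of _ _ "(u', w')"]) simp_all
    then show ?thesis
      using w'(3) by blast
  qed
  ultimately show ?thesis
    by blast
qed

section \<open>From representatives to the partition into left cells\<close>

lemma equiv_left_equiv: "equiv UNIV (left_equiv L)"
proof (rule equivI)
  show "refl (left_equiv L)"
    by (simp add: refl_on_def left_equiv_def left_le_def)
  show "sym (left_equiv L)"
    by (auto simp: sym_def left_equiv_def)
  show "trans (left_equiv L)"
    unfolding trans_def left_equiv_def left_le_def by auto
qed simp

theorem theorem1p1:
  "finite {left_cells L | L. weight_function L \<and> (\<forall>w. w \<noteq> 1 \<longrightarrow> L w > 0)} \<and>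
   (\<forall>L. weight_function L \<and> (\<forall>w. w \<noteq> 1 \<longrightarrow> L w > 0) \<longrightarrow> finite (left_cells L))"
proof -
  obtain K g where K: "finite K" "\<And>w. g w \<in> K" "\<And>w. equivalent w (g w)"
    using finite_representatives by metis
  have g: "(w, g w) \<in> left_equiv L" if "weighted L" for w L
    using K(3)[of w] that by (simp add: equivalent_def left_equiv_def)
  have weighted: "weighted L" if "weight_function L" "\<forall>w. w \<noteq> 1 \<longrightarrow> L w > 0" for L
    using that by (simp add: weighted_def)
  \<comment> \<open>Since \<open>g\<close> does not depend on \<open>L\<close>, the partition can be
    recovered from the restriction of the equivalence relation to \<open>K\<close>, and there are
    only finitely many relations on \<open>K\<close>.\<close>
  define \<Phi> where "\<Phi> r = (UNIV :: W set) // {(w, w'). (g w, g w') \<in> r}" for r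
  have "left_cells L = \<Phi> (left_equiv L \<inter> K \<times> K)" if L: "weighted L" for L
  proof -
    have "(w, w') \<in> left_equiv L \<longleftrightarrow> (g w, g w') \<in> left_equiv L" for w w'
      using g[OF L, of w] g[OF L, of w'] equiv_class_eq_iff[OF equiv_left_equiv]
      by (metis UNIV_I)
    then have "left_equiv L = {(w, w'). (g w, g w') \<in> left_equiv L \<inter> K \<times> K}"
      using K(2) by (simp add: set_eq_iff)
    then show ?thesis
      unfolding left_cells_def \<Phi>_def by metis
  qed
  then have "{left_cells L | L. weight_function L \<and> (\<forall>w. w \<noteq> 1 \<longrightarrow> L w > 0)} \<subseteq> \<Phi> ` Pow (K \<times> K)"
    using weighted by blast
  then have "finite {left_cells L | L. weight_function L \<and> (\<forall>w. w \<noteq> 1 \<longrightarrow> L w > 0)}"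
    by (rule finite_subset) (simp add: K(1))
  moreover have "finite (left_cells L)" if L: "weighted L" for L
  proof -
    have "left_cells L \<subseteq> (\<lambda>k. left_equiv L `` {k}) ` K"
    proof
      fix X assume "X \<in> left_cells L"
      then obtain w where "X = left_equiv L `` {w}"
        by (auto simp: left_cells_def elim: quotientE)
      then have "X = left_equiv L `` {g w}"
        using equiv_class_eq[OF equiv_left_equiv g[OF L]] by simp
      then show "X \<in> (\<lambda>k. left_equiv L `` {k}) ` K"
        using K(2) by blast
    qed
    then show ?thesis
      by (rule finite_subset) (simp add: K(1))
  qed
  ultimately show ?thesis
    using weighted by blast
qed

end
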